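(* Let $p>2$ be a prime and let $M$ be a simple $GF(p)$-representable matroid. The following are equivalent. (i) $M$ is $GF(p)$-chordal. (ii) $M$ has no induced minor isomorphic to a member of $\{U_{2,k}:3\leq k\leq p\}$. (iii) $M$ has no induced restriction isomorphic to a member of $\{U_{n,n+1}:n\geq 2\}\cup\{U_{2+t,k+t}:4\leq k\leq p \text{ and } 0\leq t\leq p+1-k\}$.
   Context: All matroids are finite and simple; every contraction is immediately followed by simplification. An induced restriction of $M$ is $M|F$ for a flat $F$ of $M$; an induced minor of $M$ is any matroid obtained from $M$ by a sequence of contractions (followed by simplification) and restrictions to flats. Generalized parallel connection: if $E(M_1)\cap E(M_2)=T$, $M_1|T=M_2|T=N$ and $T$ is a modular flat of $M_1$, then $P_N(M_1,M_2)$ is the matroid on $E(M_1)\cup E(M_2)$ whose flats are the sets $F$ with $F\cap E(M_i)$ a flat of $M_i$ for $i=1,2$. A matroid is $GF(q)$-chordal if it can be obtained, starting from projective geometries over $GF(q)$, by repeatedly taking generalized parallel connections $P_N(M_1,M_2)$ of previously obtained matroids across a common restriction $N$ that is a projective geometry over $GF(q)$. *)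

theory Defs
  imports Complex_Main "HOL-Library.Cardinality" "HOL-Library.Function_Algebras"
    "HOL-Computational_Algebra.Primes"
begin

section \<open>Finite matroids\<close>

datatype 'a matroid = Matroid (ground: "'a set") (indeps: "'a set set")

definition is_matroid :: "'a matroid \<Rightarrow> bool" where
  "is_matroid M \<longleftrightarrow>
     finite (ground M) \<and> indeps M \<subseteq> Pow (ground M) \<and> {} \<in> indeps M \<and>
     (\<forall>I\<in>indeps M. \<forall>J. J \<subseteq> I \<longrightarrow> J \<in> indeps M) \<and>
     (\<forall>I\<in>indeps M. \<forall>J\<in>indeps M. card I < card J \<longrightarrow> (\<exists>e\<in>J - I. insert e I \<in> indeps M))"

text \<open>The case \<open>x = y\<close> excludes loops, the case \<open>x \<noteq> y\<close> excludes parallel pairs.\<close>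

definition is_simple :: "'a matroid \<Rightarrow> bool" where
  "is_simple M \<longleftrightarrow> (\<forall>x\<in>ground M. \<forall>y\<in>ground M. {x, y} \<in> indeps M)"

definition rk :: "'a matroid \<Rightarrow> 'a set \<Rightarrow> nat" where
  "rk M X = Max (card ` {I \<in> indeps M. I \<subseteq> X})"

definition cl :: "'a matroid \<Rightarrow> 'a set \<Rightarrow> 'a set" where
  "cl M X = {e \<in> ground M. rk M (insert e X) = rk M X}"

definition flat :: "'a matroid \<Rightarrow> 'a set \<Rightarrow> bool" where
  "flat M F \<longleftrightarrow> F \<subseteq> ground M \<and> cl M F = F"

definition modular_flat :: "'a matroid \<Rightarrow> 'a set \<Rightarrow> bool" where
  "modular_flat M T \<longleftrightarrow>
     flat M T \<and> (\<forall>F. flat M F \<longrightarrow> rk M T + rk M F = rk M (T \<union> F) + rk M (T \<inter> F))"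

definition basis_of :: "'a matroid \<Rightarrow> 'a set \<Rightarrow> 'a set \<Rightarrow> bool" where
  "basis_of M X B \<longleftrightarrow>
     B \<in> indeps M \<and> B \<subseteq> X \<and> (\<forall>I\<in>indeps M. B \<subseteq> I \<and> I \<subseteq> X \<longrightarrow> I = B)"

definition restr :: "'a matroid \<Rightarrow> 'a set \<Rightarrow> 'a matroid" where
  "restr M X = Matroid X {I \<in> indeps M. I \<subseteq> X}"

definition contract :: "'a matroid \<Rightarrow> 'a set \<Rightarrow> 'a matroid" where
  "contract M X = Matroid (ground M - X)
     {I. I \<subseteq> ground M - X \<and> (\<exists>B. basis_of M X B \<and> I \<union> B \<in> indeps M)}"

definition parallel :: "'a matroid \<Rightarrow> 'a \<Rightarrow> 'a \<Rightarrow> bool" where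
  "parallel M x y \<longleftrightarrow>
     {x} \<in> indeps M \<and> {y} \<in> indeps M \<and> (x = y \<or> {x, y} \<notin> indeps M)"

text \<open>The simplification of a matroid is unique only up to isomorphism, so it is a relation:
  \<open>N\<close> arises from \<open>M\<close> by deleting all loops and all but one element of each parallel class.\<close>

definition simplification :: "'a matroid \<Rightarrow> 'a matroid \<Rightarrow> bool" where
  "simplification M N \<longleftrightarrow>
     (\<exists>S \<subseteq> {x \<in> ground M. {x} \<in> indeps M}.
        (\<forall>x\<in>ground M. {x} \<in> indeps M \<longrightarrow> (\<exists>!s. s \<in> S \<and> parallel M x s)) \<and> N = restr M S)"

definition isomorphic :: "'a matroid \<Rightarrow> 'b matroid \<Rightarrow> bool" where
  "isomorphic M N \<longleftrightarrow>
     (\<exists>f. bij_betw f (ground M) (ground N) \<and>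
          (\<forall>X \<subseteq> ground M. X \<in> indeps M \<longleftrightarrow> f ` X \<in> indeps N))"

definition uniform :: "nat \<Rightarrow> nat \<Rightarrow> nat matroid" where
  "uniform r n = Matroid {..<n} {X. X \<subseteq> {..<n} \<and> card X \<le> r}"

section \<open>Induced restrictions and induced minors\<close>

definition induced_restriction :: "'a matroid \<Rightarrow> 'a matroid \<Rightarrow> bool" where
  "induced_restriction M N \<longleftrightarrow> (\<exists>F. flat M F \<and> N = restr M F)"

text \<open>\<open>induced_minor M N\<close>: the matroid \<open>N\<close> is an induced minor of \<open>M\<close>.\<close>

inductive induced_minor :: "'a matroid \<Rightarrow> 'a matroid \<Rightarrow> bool" for M where
  self: "induced_minor M M"
| restriction: "induced_minor M N \<Longrightarrow> flat N F \<Longrightarrow> induced_minor M (restr N F)"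
| contraction: "induced_minor M N \<Longrightarrow> X \<subseteq> ground N \<Longrightarrow> simplification (contract N X) N' \<Longrightarrow>
    induced_minor M N'"

section \<open>Representability and projective geometries\<close>

text \<open>A finite field \<open>GF(q)\<close> is a type \<open>'f :: {finite, field}\<close> with \<open>CARD('f) = q\<close>. To let the
  dimension be an ordinary natural number, \<open>GF(q)\<^sup>r\<close> is the space of those sequences
  \<open>nat \<Rightarrow> 'f\<close> that vanish from index \<open>r\<close> on.\<close>

global_interpretation fvec: vector_space "\<lambda>(c::'f::field) (v::nat \<Rightarrow> 'f) i. c * v i"
  by unfold_locales (auto simp: fun_eq_iff algebra_simps)

definition coord_space :: "nat \<Rightarrow> (nat \<Rightarrow> 'f::field) set" where
  "coord_space r = {v. \<forall>i\<ge>r. v i = 0}"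

text \<open>The vector matroid of the matrix with columns \<open>\<phi> x\<close> for \<open>x \<in> E\<close>; equal columns with
  different labels are dependent, whence the injectivity.\<close>

definition vector_matroid :: "'a set \<Rightarrow> ('a \<Rightarrow> nat \<Rightarrow> 'f::field) \<Rightarrow> 'a matroid" where
  "vector_matroid E \<phi> = Matroid E {X. X \<subseteq> E \<and> inj_on \<phi> X \<and> fvec.independent (\<phi> ` X)}"

definition representable :: "'f::field itself \<Rightarrow> 'a matroid \<Rightarrow> bool" where
  "representable _ M \<longleftrightarrow>
     (\<exists>r (\<phi> :: 'a \<Rightarrow> nat \<Rightarrow> 'f). \<phi> ` ground M \<subseteq> coord_space r \<and> M = vector_matroid (ground M) \<phi>)"

text \<open>\<open>PG(r - 1, q)\<close> is the simple matroid associated with \<open>GF(q)\<^sup>r\<close>. Here \<open>r = 0\<close>, the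
  empty matroid, is included.\<close>

definition projective_geometry :: "'f::{finite,field} itself \<Rightarrow> 'a matroid \<Rightarrow> bool" where
  "projective_geometry _ M \<longleftrightarrow>
     (\<exists>r P. simplification (vector_matroid (coord_space r :: (nat \<Rightarrow> 'f) set) id) P \<and> isomorphic M P)"

section \<open>Generalized parallel connection and chordal matroids\<close>

text \<open>\<open>gen_par_conn N M1 M2 M\<close>: the generalized parallel connection \<open>P\<^sub>N(M1, M2)\<close> is defined
  and equals \<open>M\<close>. It is a relation because it is given by its flats, which determine a
  matroid.\<close>

definition gen_par_conn ::
    "'a matroid \<Rightarrow> 'a matroid \<Rightarrow> 'a matroid \<Rightarrow> 'a matroid \<Rightarrow> bool" where
  "gen_par_conn N M1 M2 M \<longleftrightarrow>
     restr M1 (ground M1 \<inter> ground M2) = N \<and>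
     restr M2 (ground M1 \<inter> ground M2) = N \<and>
     modular_flat M1 (ground M1 \<inter> ground M2) \<and>
     is_matroid M \<and> ground M = ground M1 \<union> ground M2 \<and>
     (\<forall>F. F \<subseteq> ground M \<longrightarrow>
        (flat M F \<longleftrightarrow> flat M1 (F \<inter> ground M1) \<and> flat M2 (F \<inter> ground M2)))"

text \<open>The base case requires \<open>is_matroid\<close> only to rule out a value of type \<open>'a matroid\<close> with
  \<open>indeps M\<close> not contained in \<open>Pow (ground M)\<close>, which \<open>isomorphic\<close> does not see.\<close>

inductive chordal :: "'f::{finite,field} itself \<Rightarrow> 'a matroid \<Rightarrow> bool" for k where
  geometry: "is_matroid M \<Longrightarrow> projective_geometry k M \<Longrightarrow> chordal k M"
| connection: "chordal k M1 \<Longrightarrow> chordal k M2 \<Longrightarrow> projective_geometry k N \<Longrightarrow>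
    gen_par_conn N M1 M2 M \<Longrightarrow> chordal k M"

end

theory Submission
  imports Defs "Jordan_Normal_Form.Determinant"
begin

text \<open>
Represent \<open>M\<close> by a finite set of vectors and call it clean if every interval of length two in its
lattice of flats has two or \<open>p + 1\<close> atoms. Generalized parallel connection along a full subspace
preserves cleanness, and a clean matroid has no induced minor \<open>U\<^sub>2\<^sub>,\<^sub>k\<close> with \<open>3 \<le> k \<le> p\<close>.

Conversely, let \<open>M\<close> be clean and let \<open>e, f\<close> span a line with two points. Contract a flat that is
maximal subject to \<open>e, f\<close> still spanning such a line. A further point \<open>g\<close> would lie in a plane in
which, after removing \<open>e, f\<close>, the lines through a fixed missing point of the line \<open>ef\<close> match the
points in pairs, while counting along the lines through \<open>g\<close> gives an odd number. So the contraction
is \<open>{e, f}\<close> and \<open>M\<close> is covered by two hyperplanes. For a cover by two flats \<open>W1, W2\<close> in modular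
position with the fewest points in \<open>W1 \<inter> W2\<close>, the intersection is a projective geometry: two
points \<open>x, y\<close> of \<open>W1 \<inter> W2\<close> on a line with two points are either linked by circuits on both
sides, which contradicts cleanness, or separated on one side, which yields a smaller cover.

If \<open>M\<close> is not clean, take a flat that is minimal with this property. An exchange argument shows that
it is uniform, of rank \<open>r\<close> on \<open>r - 2 + k\<close> elements with \<open>3 \<le> k \<le> p\<close>. The remaining bound
\<open>r - 2 + k \<le> p + 1\<close> for \<open>k \<ge> 4\<close> is Ball's theorem on MDS codes over prime fields.
\<close>

section \<open>Points of a contraction and clean configurations\<close>

text \<open>All three conditions are compared with cleanness. It is stated for vectors modulo a
  subspace because simplification is then automatic and because a point absent from \<open>E\<close>
  still has a name, which the parity count and the notion of a missing point rely on. The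
  hyperplanes of the first cover may meet in a flat with missing points, whereas chordality glues
  along projective geometries only; hence the descent on the number of points in the intersection.
  The arithmetic of the field enters as follows. Oddness makes \<open>q - 1\<close> and
  \<open>q + 1\<close> even, for the parity count and for the signs of determinants. A scalar other
  than 0 and 1 gives a third point in the argument with circuits on both sides. Primality makes the
  integers up to \<open>d - 1\<close> invertible in the double counting behind Ball's theorem. The
  families in (iii) come from the dimension \<open>k - 2\<close> of the code of relations: the
  length bound starts at dimension two, that is at \<open>k = 4\<close>, while \<open>k = 3\<close>
  gives the circuits, which occur without a bound on the rank.\<close>

lemma grid_parity:
  fixes S :: "('f::{finite,field} \<times> 'f) set"
  assumes odd: "odd CARD('f)" and origin: "(0, 0) \<in> S"
    and diag: "\<And>a b c. (a, b) \<in> S \<Longrightarrow> c \<noteq> 0 \<Longrightarrow> \<exists>!t. t \<noteq> 0 \<and> (a + t, b + c * t) \<in> S"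
    and row: "\<And>t t'. t \<noteq> 0 \<Longrightarrow> (t, 0) \<in> S \<Longrightarrow> (t', 0) \<in> S"
    and col: "\<And>t t'. t \<noteq> 0 \<Longrightarrow> (0, t) \<in> S \<Longrightarrow> (0, t') \<in> S"
  shows False
proof -
  \<comment> \<open>\<open>S\<close> holds affine coordinates of the points off a line at infinity.
    The lines of slope 1 partition them, and by \<open>diag\<close> each carries none or exactly
    two: an even total.\<close>
  have "even (card {x\<in>S. fst x - snd x = k})" (is "even (card ?L)") for k
  proof (cases "?L = {}")
    case False
    then obtain a b where ab: "(a, b) \<in> S" "a - b = k" by auto
    from diag[OF ab(1), of 1] obtain t where t: "t \<noteq> 0" "(a + t, b + t) \<in> S"
      and uniq: "\<And>s. s \<noteq> 0 \<Longrightarrow> (a + s, b + s) \<in> S \<Longrightarrow> s = t"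
      unfolding mult_1_left Ex1_def by (metis one_neq_zero)
    have "?L = {(a, b), (a + t, b + t)}"
    proof (intro Set.set_eqI iffI)
      fix x assume "x \<in> ?L"
      then obtain c d where x: "x = (c, d)" "(c, d) \<in> S" "c - d = a - b" using ab by (cases x) auto
      then have "d = b + (c - a)" by (simp add: algebra_simps)
      then show "x \<in> {(a, b), (a + t, b + t)}"
        using x uniq[of "c - a"] by (cases "c = a") auto
    qed (use ab t in auto)
    then show ?thesis using t by simp
  next
    case True
    then show ?thesis by (simp only: card.empty) simp
  qed
  then have "even (\<Sum>k\<in>UNIV. card {x\<in>S. fst x - snd x = k})" by (intro dvd_sum) simp
  also have "(\<Sum>k\<in>UNIV. card {x\<in>S. fst x - snd x = k}) = card (\<Union>k. {x\<in>S. fst x - snd x = k})"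
    by (intro card_UN_disjoint[symmetric]) auto
  also have "(\<Union>k. {x\<in>S. fst x - snd x = k}) = S" by auto
  finally have ev: "even (card S)" .
  \<comment> \<open>Second count, along the lines through the origin: every slope
    \<open>c \<noteq> 0\<close> contributes one further point, each axis none or all
    \<open>q - 1\<close>. These contributions are even, and the origin makes the total odd.\<close>
  define D R C where "D = {(a, b). (a, b) \<in> S \<and> a \<noteq> 0 \<and> b \<noteq> 0}"
    and "R = {(a, b). (a, b) \<in> S \<and> a \<noteq> 0 \<and> b = 0}"
    and "C = {(a, b). (a, b) \<in> S \<and> a = 0 \<and> b \<noteq> 0}"
  have units: "even (card (UNIV - {0 :: 'f}))" using odd by (simp add: card_Diff_singleton)
  have "bij_betw (\<lambda>(a, b). b / a) D (UNIV - {0})"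
  proof (rule bij_betw_imageI)
    show "inj_on (\<lambda>(a, b). b / a) D"
    proof (rule inj_onI, clarify)
      fix a b a' b' assume h: "(a, b) \<in> D" "(a', b') \<in> D" "b / a = b' / a'"
      then have "b / a \<noteq> 0" by (auto simp: D_def)
      moreover have "a \<noteq> 0 \<and> (0 + a, 0 + b / a * a) \<in> S" "a' \<noteq> 0 \<and> (0 + a', 0 + b' / a' * a') \<in> S"
        using h(1,2) by (auto simp: D_def)
      ultimately have "a = a'" using diag[OF origin] h(3) by (metis (no_types, lifting))
      then show "a = a' \<and> b = b'" using h by (auto simp: D_def)
    qed
    show "(\<lambda>(a, b). b / a) ` D = UNIV - {0}"
    proof (intro Set.set_eqI iffI)
      fix c :: 'f assume "c \<in> UNIV - {0}"
      then have c: "c \<noteq> 0" by simp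
      from diag[OF origin c] obtain t where "t \<noteq> 0" "(t, c * t) \<in> S" by auto
      then have "(t, c * t) \<in> D" "c = (\<lambda>(a, b). b / a) (t, c * t)" using c by (auto simp: D_def)
      then show "c \<in> (\<lambda>(a, b). b / a) ` D" by blast
    qed (auto simp: D_def)
  qed
  then have D: "even (card D)" using units by (simp add: bij_betw_same_card)
  have "R = {} \<or> R = (\<lambda>t. (t, 0)) ` (UNIV - {0})"
  proof (cases "\<exists>t. t \<noteq> 0 \<and> (t, 0) \<in> S")
    case True
    then obtain t where "t \<noteq> 0" "(t, 0) \<in> S" by blast
    from row[OF this] show ?thesis by (auto simp: R_def)
  qed (auto simp: R_def)
  then have R: "even (card R)"
    using units by (auto simp: card_image inj_on_def)
  have "C = {} \<or> C = (\<lambda>t. (0, t)) ` (UNIV - {0})"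
  proof (cases "\<exists>t. t \<noteq> 0 \<and> (0, t) \<in> S")
    case True
    then obtain t where "t \<noteq> 0" "(0, t) \<in> S" by blast
    from col[OF this] show ?thesis by (auto simp: C_def)
  qed (auto simp: C_def)
  then have C: "even (card C)"
    using units by (auto simp: card_image inj_on_def)
  have "S = insert (0, 0) (D \<union> R \<union> C)" using origin by (auto simp: D_def R_def C_def)
  moreover have "(0, 0) \<notin> D \<union> R \<union> C" by (auto simp: D_def R_def C_def)
  moreover have "card (D \<union> R \<union> C) = card D + card R + card C"
    by (subst card_Un_disjoint, simp, simp, force simp: D_def R_def C_def,
        subst card_Un_disjoint, simp, simp, force simp: D_def R_def C_def, simp)
  ultimately have "card S = Suc (card D + card R + card C)" by (metis card_insert_disjoint finite)
  then show False using ev D R C by simp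
qed

lemma exists_maximal_between:
  assumes "finite E" "X \<subseteq> E" "P X"
  obtains Y where "X \<subseteq> Y" "Y \<subseteq> E" "P Y" "\<And>Z. Y \<subseteq> Z \<Longrightarrow> Z \<subseteq> E \<Longrightarrow> P Z \<Longrightarrow> Z = Y"
proof -
  let ?F = "{Y. X \<subseteq> Y \<and> Y \<subseteq> E \<and> P Y}"
  have "finite ?F" using assms(1) by (auto intro: finite_subset[of _ "Pow E"])
  moreover have "X \<in> ?F" using assms by simp
  ultimately have "\<exists>Y\<in>?F. X \<subseteq> Y \<and> (\<forall>Z\<in>?F. Y \<subseteq> Z \<longrightarrow> Y = Z)"
    by (rule finite_has_maximal2)
  then obtain Y where "Y \<in> ?F" "\<forall>Z\<in>?F. Y \<subseteq> Z \<longrightarrow> Y = Z" by blast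
  then have "X \<subseteq> Y" "Y \<subseteq> E" "P Y" and "\<And>Z. Y \<subseteq> Z \<Longrightarrow> Z \<subseteq> E \<Longrightarrow> P Z \<Longrightarrow> Z = Y"
    by (simp_all) (metis order_trans)
  then show ?thesis by (rule that)
qed

section \<open>Vectors over a finite field modulo a subspace\<close>

locale finite_field_space = vector_space scale
  for scale :: "'f::{finite,field} \<Rightarrow> 'v::ab_group_add \<Rightarrow> 'v" (infixr "*s" 75)
begin

lemma lin1: "subspace A \<Longrightarrow> x \<in> A \<Longrightarrow> z = a *s x \<Longrightarrow> z \<in> A"
  by (simp add: subspace_scale)

lemma lin2: "subspace A \<Longrightarrow> x \<in> A \<Longrightarrow> y \<in> A \<Longrightarrow> z = a *s x + b *s y \<Longrightarrow> z \<in> A"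
  by (simp add: subspace_scale subspace_add)

lemma lin3: "subspace A \<Longrightarrow> x \<in> A \<Longrightarrow> y \<in> A \<Longrightarrow> w \<in> A \<Longrightarrow> z = a *s x + b *s y + c *s w \<Longrightarrow> z \<in> A"
  by (simp add: subspace_scale subspace_add)

lemma scale_mem_iff: "subspace A \<Longrightarrow> c \<noteq> 0 \<Longrightarrow> c *s x \<in> A \<longleftrightarrow> x \<in> A"
  using lin1[of A "c *s x" x "1 / c"] subspace_scale by auto

lemma diff_mem_cong: "subspace A \<Longrightarrow> x - y \<in> A \<Longrightarrow> x \<in> A \<longleftrightarrow> y \<in> A"
  using lin2[of A "x - y" y x 1 1] lin2[of A "x - y" x y "-1" 1] by auto

text \<open>Contraction is rendered by working modulo a subspace \<open>A\<close>: \<open>pt E A z\<close> says that \<open>z\<close> spans a point of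
  the simplification of the contraction of \<open>E\<close> by \<open>A\<close>.\<close>

definition pt :: "'v set \<Rightarrow> 'v set \<Rightarrow> 'v \<Rightarrow> bool" where
  "pt E A z \<longleftrightarrow> z \<notin> A \<and> (\<exists>e\<in>E. \<exists>c. z - c *s e \<in> A)"

text \<open>Counting-free form of the condition that a line of a contraction has two or \<open>q + 1\<close> points: as
  soon as it has a third point \<open>u + v\<close>, it has all of them.\<close>

definition clean :: "'v set \<Rightarrow> bool" where
  "clean E \<longleftrightarrow> (\<forall>X u v d. X \<subseteq> E \<longrightarrow> pt E (span X) u \<longrightarrow> pt E (span X) v \<longrightarrow>
     pt E (span X) (u + v) \<longrightarrow> u + d *s v \<notin> span X \<longrightarrow> pt E (span X) (u + d *s v))"

definition indep2 :: "'v set \<Rightarrow> 'v \<Rightarrow> 'v \<Rightarrow> bool" where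
  "indep2 A u v \<longleftrightarrow> (\<forall>a b. a *s u + b *s v \<in> A \<longrightarrow> a = 0 \<and> b = 0)"

text \<open>Up to scalars, the points of the line through \<open>u\<close> and \<open>v\<close>
  other than these two are the \<open>u + c *s v\<close> with \<open>c \<noteq> 0\<close>, so this
  describes a line with exactly two points. The condition \<open>u + c *s v \<notin> A\<close>
  excludes parallel \<open>u\<close> and \<open>v\<close>.\<close>

definition nonadj :: "'v set \<Rightarrow> 'v set \<Rightarrow> 'v \<Rightarrow> 'v \<Rightarrow> bool" where
  "nonadj E A u v \<longleftrightarrow> pt E A u \<and> pt E A v \<and> (\<forall>c. c \<noteq> 0 \<longrightarrow> u + c *s v \<notin> A \<and> \<not> pt E A (u + c *s v))"

lemma ptE:
  assumes "pt E A z" "subspace A"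
  obtains e c where "e \<in> E" "c \<noteq> 0" "z - c *s e \<in> A" "e \<notin> A" "z \<notin> A"
proof -
  from assms obtain e c where h: "z \<notin> A" "e \<in> E" "z - c *s e \<in> A" by (auto simp: pt_def)
  have "c \<noteq> 0" using h by auto
  moreover have "e \<notin> A" using h diff_mem_cong[OF assms(2) h(3)] subspace_scale[OF assms(2)] by blast
  ultimately show ?thesis using h that by blast
qed

lemma pt_mem: "e \<in> E \<Longrightarrow> e \<notin> A \<Longrightarrow> subspace A \<Longrightarrow> pt E A e"
  unfolding pt_def by (auto intro!: bexI[of _ e] exI[of _ 1] simp: subspace_0)

lemma pt_notin: "pt E A z \<Longrightarrow> z \<notin> A"
  by (simp add: pt_def)

lemma pt_scale: assumes "subspace A" "pt E A z" "c \<noteq> 0" shows "pt E A (c *s z)"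
proof -
  from assms(2) obtain e k where h: "z \<notin> A" "e \<in> E" "z - k *s e \<in> A" by (auto simp: pt_def)
  have "c *s z - (c * k) *s e \<in> A"
    by (rule lin1[OF assms(1) h(3), of _ c]) (simp add: algebra_simps)
  then show ?thesis using h scale_mem_iff[OF assms(1,3)] unfolding pt_def by blast
qed

lemma pt_scale_iff: "subspace A \<Longrightarrow> c \<noteq> 0 \<Longrightarrow> pt E A (c *s z) \<longleftrightarrow> pt E A z"
  using pt_scale[of A E z c] pt_scale[of A E "c *s z" "1 / c"] by auto

lemma pt_mono: assumes "pt E A z" "A \<subseteq> B" "z \<notin> B" "E \<subseteq> E'" shows "pt E' B z"
  using assms unfolding pt_def by blast

lemma pt_cong: assumes "subspace A" "pt E A z" "z - z' \<in> A" shows "pt E A z'"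
proof -
  from assms(2) obtain e k where h: "z \<notin> A" "e \<in> E" "z - k *s e \<in> A" by (auto simp: pt_def)
  have "z' - k *s e \<in> A"
    by (rule lin2[OF assms(1) h(3) assms(3), of _ 1 "-1"]) (simp add: algebra_simps)
  then show ?thesis using h diff_mem_cong[OF assms(1,3)] unfolding pt_def by blast
qed

text \<open>Lifts a point from the contraction by one more element \<open>g\<close>: its
  representatives differ by multiples of \<open>g\<close>, and one of them is a point already before
  \<open>g\<close> is contracted.\<close>

lemma pt_insert:
  assumes "pt E (span (insert g X)) z"
  obtains t where "pt E (span X) (z - t *s g)"
proof -
  from assms obtain e k where h: "z \<notin> span (insert g X)" "e \<in> E" "z - k *s e \<in> span (insert g X)"
    by (auto simp: pt_def)
  from h(3) obtain t where t: "z - k *s e - t *s g \<in> span X" using span_breakdown_eq by blast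
  have "z - t *s g \<notin> span X" using h(1) span_breakdown_eq by blast
  moreover have "z - t *s g - k *s e \<in> span X" using t by (simp add: algebra_simps)
  ultimately show ?thesis using h that unfolding pt_def by blast
qed

text \<open>Rescaling \<open>P\<close> and \<open>R\<close> turns the third point
  \<open>a *s P + b *s R\<close> into the \<open>u + v\<close> of the definition of
  \<open>clean\<close>. So any way of exhibiting a third point fills the line.\<close>

lemma clean_line:
  assumes "clean E" "X \<subseteq> E" and P: "pt E (span X) P" and R: "pt E (span X) R"
    and PR: "pt E (span X) (a *s P + b *s R)" and ab: "a \<noteq> 0" "b \<noteq> 0"
    and out: "c *s P + d *s R \<notin> span X"
  shows "pt E (span X) (c *s P + d *s R)"
proof (cases "c = 0")
  case True
  then have "d \<noteq> 0" using out by (auto simp: span_zero)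
  then show ?thesis using True pt_scale[OF subspace_span R] by simp
next
  case False
  have eq: "a *s P + (d * a / (c * b)) *s b *s R = (a / c) *s (c *s P + d *s R)"
    using ab False by (simp add: algebra_simps)
  have "pt E (span X) (a *s P)" "pt E (span X) (b *s R)"
    using P R ab pt_scale subspace_span by blast+
  then have "pt E (span X) (a *s P + (d * a / (c * b)) *s b *s R)"
    using assms(1,2) PR out ab False scale_mem_iff[OF subspace_span, of "a / c"]
    unfolding clean_def eq by (metis divide_eq_0_iff eq)
  then show ?thesis unfolding eq using ab False by (simp add: pt_scale_iff)
qed

lemma indep2_notin:
  assumes "indep2 A u v" shows "u \<notin> A" "v \<notin> A" "u + c *s v \<notin> A"
  using assms[unfolded indep2_def, rule_format, of 1 0] assms[unfolded indep2_def, rule_format, of 0 1]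
    assms[unfolded indep2_def, rule_format, of 1 c] by auto

lemma indep2_commute: "indep2 A u v \<Longrightarrow> indep2 A v u"
  unfolding indep2_def by (metis add.commute)

lemma indep2_mono: "indep2 A u v \<Longrightarrow> B \<subseteq> A \<Longrightarrow> indep2 B u v"
  unfolding indep2_def by blast

lemma indep2I:
  assumes "subspace A" "v \<notin> A" "\<And>b. u + b *s v \<notin> A" shows "indep2 A u v"
  unfolding indep2_def
proof (intro allI impI)
  fix a b assume h: "a *s u + b *s v \<in> A"
  have "a = 0"
  proof (rule ccontr)
    assume "a \<noteq> 0"
    then have "u + (b / a) *s v \<in> A" by (intro lin1[OF assms(1) h, of _ "1 / a"]) (simp add: algebra_simps)
    then show False using assms(3) by blast
  qed
  moreover have "b = 0" using h \<open>a = 0\<close> assms(2) scale_mem_iff[OF assms(1), of b v] by auto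
  ultimately show "a = 0 \<and> b = 0" by simp
qed

lemma nonadj_indep2: assumes "subspace A" "nonadj E A u v" shows "indep2 A u v"
proof (rule indep2I[OF assms(1)])
  show "v \<notin> A" using assms(2) by (auto simp: nonadj_def pt_def)
  show "u + b *s v \<notin> A" for b using assms(2) by (cases "b = 0") (auto simp: nonadj_def pt_def)
qed

lemma adj_all:
  assumes "clean E" "X \<subseteq> E" "pt E (span X) u" "pt E (span X) v" "indep2 (span X) u v"
    and "\<not> nonadj E (span X) u v" "a \<noteq> 0 \<or> b \<noteq> 0"
  shows "pt E (span X) (a *s u + b *s v)"
proof -
  from assms obtain c where c: "c \<noteq> 0" "pt E (span X) (u + c *s v)"
    by (auto simp: nonadj_def indep2_notin)
  have "a *s u + b *s v \<notin> span X" using assms(5,7) unfolding indep2_def by blast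
  then show ?thesis using clean_line[OF assms(1-4), of 1 c a b] c by simp
qed

lemma clean_separate:
  assumes "odd CARD('f)" and cl: "clean E" and fin: "finite E" and X: "X \<subseteq> E"
    and non: "nonadj E (span X) u v"
  obtains X' where "X \<subseteq> X'" "X' \<subseteq> E" "nonadj E (span X') u v"
    "E \<subseteq> span (insert u X') \<union> span (insert v X')"
proof -
  obtain Y where Y: "X \<subseteq> Y" "Y \<subseteq> E" "nonadj E (span Y) u v"
    and max: "\<And>Y'. Y \<subseteq> Y' \<Longrightarrow> Y' \<subseteq> E \<Longrightarrow> nonadj E (span Y') u v \<Longrightarrow> Y' = Y"
    using exists_maximal_between[where P = "\<lambda>Y. nonadj E (span Y) u v", OF fin X non] by metis
  let ?A = "span Y"
  have nonY: "nonadj E ?A u v" and YE: "Y \<subseteq> E" using Y by auto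
  then have pu: "pt E ?A u" and pv: "pt E ?A v"
    and no: "\<And>c. c \<noteq> 0 \<Longrightarrow> \<not> pt E ?A (u + c *s v)" by (auto simp: nonadj_def)
  have iuv: "indep2 ?A u v" using nonadj_indep2 nonY by blast
  have sA: "subspace ?A" by simp
  have "E \<subseteq> span (insert u Y) \<union> span (insert v Y)"
  proof (rule ccontr)
    assume "\<not> ?thesis"
    then obtain g where g: "g \<in> E" "g \<notin> span (insert u Y)" "g \<notin> span (insert v Y)" by blast
    \<comment> \<open>A \<open>g\<close> dependent on \<open>u\<close> and \<open>v\<close> modulo
      \<open>?A\<close> would be a third point of their line or lie in the span of \<open>Y\<close>
      with one of them; hence \<open>g\<close>, \<open>u\<close>, \<open>v\<close> span a
      plane.\<close>
    have g3: "z *s g + x *s u + y *s v \<in> ?A \<Longrightarrow> z = 0" for x y z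
    proof (rule ccontr)
      assume h: "z *s g + x *s u + y *s v \<in> ?A" and z: "z \<noteq> 0"
      have h': "g + (x / z) *s u + (y / z) *s v \<in> ?A"
        by (rule lin1[OF sA h, of _ "1 / z"]) (use z in \<open>simp add: algebra_simps\<close>)
      have x: "x \<noteq> 0"
      proof
        assume "x = 0"
        then have "g - (- y / z) *s v \<in> ?A" using h' by simp
        then show False using g(3) span_breakdown_eq by blast
      qed
      have y: "y \<noteq> 0"
      proof
        assume "y = 0"
        then have "g - (- x / z) *s u \<in> ?A" using h' by simp
        then show False using g(2) span_breakdown_eq by blast
      qed
      have "g \<notin> ?A" using g(2) span_mono[of Y "insert u Y"] by blast
      then have "pt E ?A g" using g(1) pt_mem by blast
      then have "pt E ?A ((- z / x) *s g)" by (intro pt_scale[OF sA]) (use x z in auto)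
      moreover have "(- z / x) *s g - (u + (y / x) *s v) \<in> ?A"
        by (rule lin1[OF sA h, of _ "- 1 / x"]) (use x in \<open>simp add: algebra_simps\<close>)
      ultimately have "pt E ?A (u + (y / x) *s v)" using pt_cong[OF sA] by blast
      then show False using no[of "y / x"] x y by simp
    qed
    have g3': "g + x *s u + y *s v \<notin> ?A" for x y using g3[of 1 x y] by auto
    \<comment> \<open>Affine coordinates in that plane, with \<open>g\<close> as origin and the line
      of \<open>u\<close> and \<open>v\<close> at infinity; the missing point
      \<open>u + c *s v\<close> is the direction of slope \<open>c\<close>.\<close>
    define S where "S = {(x, y). pt E ?A (g + x *s u + y *s v)}"
    have through: "\<exists>s. s \<noteq> 0 \<and> (x + s, y + c * s) \<in> S" if xy: "(x, y) \<in> S" and c: "c \<noteq> 0" for x y c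
    proof -
      let ?w = "g + x *s u + y *s v"
      from xy obtain e k where e: "e \<in> E" "k \<noteq> 0" "?w - k *s e \<in> ?A" "e \<notin> ?A"
        unfolding S_def using ptE[OF _ sA] by blast
      have ind: "indep2 (span (insert e Y)) u v"
        unfolding indep2_def
      proof (intro allI impI)
        fix a b assume "a *s u + b *s v \<in> span (insert e Y)"
        then obtain r where r: "a *s u + b *s v - r *s e \<in> ?A" using span_breakdown_eq by blast
        have r': "(- r / k) *s g + (a - r / k * x) *s u + (b - r / k * y) *s v \<in> ?A"
          by (rule lin2[OF sA r e(3), of _ 1 "- (r / k)"]) (use e in \<open>simp add: algebra_simps\<close>)
        then have "r = 0" using g3[OF r'] e by simp
        then show "a = 0 \<and> b = 0" using r iuv unfolding indep2_def by simp
      qed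
      have notY: "e \<notin> Y" using e(4) span_base by blast
      \<comment> \<open>Here the maximality of \<open>Y\<close> is used: once the element
        \<open>e\<close> representing the point \<open>(x, y)\<close> is contracted, the line of
        \<open>u\<close> and \<open>v\<close> is full. Its point \<open>u + c *s v\<close> then
        lifts to a second point on the line of slope \<open>c\<close> through
        \<open>(x, y)\<close>.\<close>
      then have nn: "\<not> nonadj E (span (insert e Y)) u v"
        using max[of "insert e Y"] Y e(1) by auto
      have mono: "?A \<subseteq> span (insert e Y)" by (rule span_mono) blast
      have "pt E (span (insert e Y)) u" "pt E (span (insert e Y)) v"
        using pt_mono[OF pu mono] pt_mono[OF pv mono] indep2_notin[OF ind] by auto
      from adj_all[OF cl _ this ind nn, of 1 c]
      have "pt E (span (insert e Y)) (u + c *s v)" using YE e(1) by simp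
      from pt_insert[OF this] obtain t where t: "pt E ?A (u + c *s v - t *s e)" .
      have t0: "t \<noteq> 0" using t no[OF c] by auto
      have "pt E ?A ((- k / t) *s (u + c *s v - t *s e))" by (intro pt_scale[OF sA t]) (use t0 e in auto)
      moreover have "(- k / t) *s (u + c *s v - t *s e) - (g + (x - k / t) *s u + (y - c * k / t) *s v) \<in> ?A"
        by (rule lin1[OF sA e(3), of _ "-1"]) (use t0 in \<open>simp add: algebra_simps\<close>)
      ultimately have "pt E ?A (g + (x - k / t) *s u + (y - c * k / t) *s v)"
        using pt_cong[OF sA] by blast
      then have "(x + - (k / t), y + c * - (k / t)) \<in> S" unfolding S_def by simp
      moreover have "- (k / t) \<noteq> 0" using t0 e by simp
      ultimately show ?thesis by blast
    qed
    show False
    proof (rule grid_parity[OF assms(1), of S])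
      have "g \<notin> ?A" using g(2) span_mono[of Y "insert u Y"] by blast
      then have pg: "pt E ?A g" using g(1) pt_mem by blast
      then show "(0, 0) \<in> S" by (simp add: S_def)
      show "\<exists>!t. t \<noteq> 0 \<and> (x + t, y + c * t) \<in> S" if xy: "(x, y) \<in> S" and c: "c \<noteq> 0" for x y c
      proof (rule ex_ex1I)
        show "\<exists>t. t \<noteq> 0 \<and> (x + t, y + c * t) \<in> S" using through[OF that] .
        fix s t assume s: "s \<noteq> 0 \<and> (x + s, y + c * s) \<in> S" and t: "t \<noteq> 0 \<and> (x + t, y + c * t) \<in> S"
        show "s = t"
        proof (rule ccontr)
          \<comment> \<open>Three points on a line of slope \<open>c\<close> would fill it, and its
            point at infinity \<open>u + c *s v\<close> would no longer be missing.\<close>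
          assume st: "s \<noteq> t"
          define p0 p1 where "p0 = g + x *s u + y *s v" and "p1 = g + (x + s) *s u + (y + c * s) *s v"
          have p: "pt E ?A p0" "pt E ?A p1" using xy s by (auto simp: S_def p0_def p1_def)
          have "(1 - t / s) *s p0 + (t / s) *s p1 = g + (x + t) *s u + (y + c * t) *s v"
            unfolding p0_def p1_def using s by (simp add: algebra_simps add_divide_distrib diff_divide_distrib)
          then have p2: "pt E ?A ((1 - t / s) *s p0 + (t / s) *s p1)" using t by (simp add: S_def)
          have eq: "(- 1 / s) *s p0 + (1 / s) *s p1 = u + c *s v"
            unfolding p0_def p1_def using s by (simp add: algebra_simps)
          have "(- 1 / s) *s p0 + (1 / s) *s p1 \<notin> ?A"
            unfolding eq using indep2_notin(3)[OF iuv] .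
          then have "pt E ?A ((- 1 / s) *s p0 + (1 / s) *s p1)"
            by (rule clean_line[OF cl YE p p2, rotated 2]) (use s t st in auto)
          then show False using no[OF c] unfolding eq by simp
        qed
      qed
      show "(t', 0) \<in> S" if "t \<noteq> 0" "(t, 0) \<in> S" for t t'
      proof -
        have "pt E ?A (1 *s g + t *s u)" using that by (simp add: S_def)
        from clean_line[OF cl YE pg pu this, of 1 t']
        show ?thesis using that g3'[of t' 0] by (simp add: S_def)
      qed
      show "(0, t') \<in> S" if "t \<noteq> 0" "(0, t) \<in> S" for t t'
      proof -
        have "pt E ?A (1 *s g + t *s v)" using that by (simp add: S_def)
        from clean_line[OF cl YE pg pv this, of 1 t']
        show ?thesis using that g3'[of 0 t'] by (simp add: S_def)
      qed
    qed
  qed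
  then show ?thesis using that Y by blast
qed

end

section \<open>Separations and linked pairs\<close>

context finite_field_space
begin

text \<open>In the contraction by \<open>span Z\<close>, the elements \<open>x\<close> and \<open>y\<close> lie in a common circuit of size at
  least three.\<close>

definition linked :: "'v set \<Rightarrow> 'v set \<Rightarrow> 'v \<Rightarrow> 'v \<Rightarrow> bool" where
  "linked E Z x y \<longleftrightarrow> (\<exists>K e a b. K \<subseteq> E \<and> e \<in> E \<and> indep2 (span (Z \<union> K)) x y \<and>
     a \<noteq> 0 \<and> b \<noteq> 0 \<and> e - (a *s x + b *s y) \<in> span (Z \<union> K))"

text \<open>Modulo \<open>span Z\<close> the subspaces \<open>D1\<close> and \<open>D2\<close> are
  in direct sum, so \<open>x\<close> and \<open>y\<close> lie in different summands of the
  contraction. The first two equations identify the subspaces with flats of the matroid.\<close>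

definition separated :: "'v set \<Rightarrow> 'v set \<Rightarrow> 'v \<Rightarrow> 'v \<Rightarrow> bool" where
  "separated E Z x y \<longleftrightarrow> (\<exists>D1 D2. D1 = span (E \<inter> D1) \<and> D2 = span (E \<inter> D2) \<and>
     D1 \<inter> D2 = span Z \<and> x \<in> D1 \<and> y \<in> D2 \<and> E \<subseteq> D1 \<union> D2)"

text \<open>A vector of \<open>W1 \<inter> W2\<close> need not be a combination of elements of
  \<open>E\<close> lying there; the third equation demands this, which says that the two flats form
  a modular pair. Both flats are proper so that the induction in \<open>clean_imp_chordal\<close>
  descends.\<close>

definition cover :: "'v set \<Rightarrow> 'v set \<Rightarrow> 'v set \<Rightarrow> bool" where
  "cover E W1 W2 \<longleftrightarrow> W1 = span (E \<inter> W1) \<and> W2 = span (E \<inter> W2) \<and>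
     W1 \<inter> W2 = span (E \<inter> (W1 \<inter> W2)) \<and> E \<subseteq> W1 \<union> W2 \<and> \<not> E \<subseteq> W1 \<and> \<not> E \<subseteq> W2"

lemma span_Int_span: "X \<subseteq> E \<Longrightarrow> span (E \<inter> span X) = span X"
  by (rule antisym[OF span_minimal[OF _ subspace_span] span_mono]) (use span_superset in blast)+

lemma separated_sym: "separated E Z x y \<Longrightarrow> separated E Z y x"
  unfolding separated_def by (metis Int_commute Un_commute)

lemma span_insert_Int:
  assumes "indep2 (span Z) x y" shows "span (insert x Z) \<inter> span (insert y Z) = span Z"
proof
  show "span (insert x Z) \<inter> span (insert y Z) \<subseteq> span Z"
  proof
    fix v assume "v \<in> span (insert x Z) \<inter> span (insert y Z)"
    then obtain a b where h: "v - a *s x \<in> span Z" "v - b *s y \<in> span Z"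
      using span_breakdown_eq by blast
    have "a *s x + (- b) *s y \<in> span Z"
      by (rule lin2[OF subspace_span h, of _ "-1" 1]) (simp add: algebra_simps)
    then have "a = 0" using assms unfolding indep2_def by blast
    then show "v \<in> span Z" using h by simp
  qed
  show "span Z \<subseteq> span (insert x Z) \<inter> span (insert y Z)"
    by (simp add: span_mono subset_insertI)
qed

lemma in_span_insert2:
  "v \<in> span (insert x (insert y Z)) \<longleftrightarrow> (\<exists>a b. v - (a *s x + b *s y) \<in> span Z)"
  by (simp add: span_breakdown_eq diff_diff_eq)

lemma in_span_Un: "v \<in> span (S \<union> T) \<longleftrightarrow> (\<exists>a b. a \<in> span S \<and> b \<in> span T \<and> v = a + b)"
  unfolding span_Un by blast

lemma subset_of_spanned: "D = span (E \<inter> D) \<Longrightarrow> E \<subseteq> W \<Longrightarrow> subspace W \<Longrightarrow> D \<subseteq> W"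
  by (metis inf.coboundedI1 span_minimal)

text \<open>Undoes the contraction of \<open>g\<close> in a separation. If \<open>D1\<close> splits
  further into \<open>P\<close> containing \<open>x\<close> and \<open>R\<close> containing
  \<open>g\<close>, then \<open>R\<close> can be glued to \<open>D2\<close> along \<open>g\<close>:
  a vector of \<open>P\<close> in the sum of \<open>R\<close> and \<open>D2\<close> already lies in
  \<open>R\<close>, since its \<open>D2\<close> part falls into
  \<open>D1 \<inter> D2\<close>.\<close>

lemma separated_step:
  assumes D: "D1 = span (E \<inter> D1)" "D2 = span (E \<inter> D2)" "D1 \<inter> D2 = span (insert g Z)"
    "y \<in> D2" "E \<subseteq> D1 \<union> D2" and Z: "Z \<subseteq> E"
    and sep: "separated (E \<inter> D1) Z x g"
  shows "separated E Z x y"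
proof -
  from sep obtain P R where P: "P = span (E \<inter> D1 \<inter> P)" and R: "R = span (E \<inter> D1 \<inter> R)"
    and PR: "P \<inter> R = span Z" "x \<in> P" "g \<in> R" "E \<inter> D1 \<subseteq> P \<union> R" unfolding separated_def by blast
  have sub: "subspace P" "subspace R" "subspace D1" "subspace D2"
    using P R D by (metis subspace_span)+
  have PD: "P \<subseteq> D1" "R \<subseteq> D1"
    using subset_of_spanned[OF P _ sub(3)] subset_of_spanned[OF R _ sub(3)] by blast+
  have ZR: "span (insert g Z) \<subseteq> R" using PR sub span_superset[of Z] by (intro span_minimal) auto
  have ZD: "span Z \<subseteq> D2" using D(3) span_mono[of Z "insert g Z"] by blast
  let ?Q = "span (R \<union> D2)"
  have "P \<inter> ?Q = span Z"
  proof
    show "P \<inter> ?Q \<subseteq> span Z"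
    proof
      fix v assume v: "v \<in> P \<inter> ?Q"
      then obtain r d where rd: "r \<in> R" "d \<in> D2" "v = r + d"
        using in_span_Un sub by (metis IntD2 span_eq_iff)
      then have "d = v - r" by simp
      then have "d \<in> D1" using v rd PD sub by (metis IntD1 subsetD subspace_diff)
      then have "d \<in> R" using rd D(3) ZR by blast
      then show "v \<in> span Z" using v rd sub PR(1) by (metis IntD1 IntI subspace_add)
    qed
    show "span Z \<subseteq> P \<inter> ?Q" using ZD PR(1) span_superset[of "R \<union> D2"] by blast
  qed
  moreover have "P = span (E \<inter> P)"
    by (rule antisym, subst P, rule span_mono, blast, rule span_minimal) (use sub in auto)
  moreover have "?Q = span (E \<inter> ?Q)"
  proof (rule antisym)
    have "R \<subseteq> span (E \<inter> ?Q)"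
      by (subst R, rule span_mono) (use span_superset[of "R \<union> D2"] in blast)
    moreover have "D2 \<subseteq> span (E \<inter> ?Q)"
      by (subst D(2), rule span_mono) (use span_superset[of "R \<union> D2"] in blast)
    ultimately show "?Q \<subseteq> span (E \<inter> ?Q)" by (simp add: span_minimal)
  qed (simp add: span_minimal)
  moreover have "y \<in> ?Q" "E \<subseteq> P \<union> ?Q" using D PR span_superset[of "R \<union> D2"] by blast+
  ultimately show ?thesis unfolding separated_def using PR(2) by blast
qed

text \<open>Vector version of the fact that two elements of one matroid component share a circuit.
  The induction contracts some \<open>g\<close> outside the span of \<open>x\<close>,
  \<open>y\<close> and \<open>Z\<close>. If this separates \<open>x\<close> from \<open>y\<close>,
  the pairs \<open>x\<close>, \<open>g\<close> and \<open>y\<close>, \<open>g\<close> are compared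
  on the two sides.\<close>

lemma linked_or_separated:
  assumes "finite E" "Z \<subseteq> E" "x \<in> E" "y \<in> E" "indep2 (span Z) x y"
  shows "linked E Z x y \<or> separated E Z x y"
  using assms
proof (induction "card (E - span Z)" arbitrary: E Z x y rule: less_induct)
  case less
  note fin = less.prems(1) and ZE = less.prems(2) and xE = less.prems(3) and yE = less.prems(4)
    and ind = less.prems(5)
  let ?A = "span Z"
  have sA: "subspace ?A" by simp
  show ?case
  proof (cases "E \<subseteq> span (insert x (insert y Z))")
    case True
    show ?thesis
    proof (rule disjCI)
      assume nsep: "\<not> separated E Z x y"
      have "E \<subseteq> span (insert x Z) \<union> span (insert y Z) \<Longrightarrow> separated E Z x y"
        unfolding separated_def
        using span_Int_span[of "insert x Z" E] span_Int_span[of "insert y Z" E]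
          span_insert_Int[OF ind] ZE xE yE span_base[of x "insert x Z"] span_base[of y "insert y Z"]
        by (intro exI[of _ "span (insert x Z)"] exI[of _ "span (insert y Z)"]) simp
      then obtain e where e: "e \<in> E" "e \<notin> span (insert x Z)" "e \<notin> span (insert y Z)" using nsep by blast
      from e True obtain a b where ab: "e - (a *s x + b *s y) \<in> ?A" using in_span_insert2 by blast
      have "a \<noteq> 0" "b \<noteq> 0" using e ab by (auto simp: span_breakdown_eq)
      then show "linked E Z x y" unfolding linked_def using e ind ab
        by (intro exI[of _ "{}"] exI[of _ e] exI[of _ a] exI[of _ b]) simp
    qed
  next
    case False
    then obtain g where g: "g \<in> E" "g \<notin> span (insert x (insert y Z))" by blast
    have gxy: "r = 0" if "a *s x + b *s y - r *s g \<in> ?A" for a b r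
    proof (rule ccontr)
      assume r: "r \<noteq> 0"
      have "g - ((a / r) *s x + (b / r) *s y) \<in> ?A"
        by (rule lin1[OF sA that, of _ "- 1 / r"]) (use r in \<open>simp add: algebra_simps\<close>)
      then show False using g(2) in_span_insert2 by blast
    qed
    have ind': "indep2 (span (insert g Z)) x y"
      unfolding indep2_def
    proof (intro allI impI)
      fix a b assume "a *s x + b *s y \<in> span (insert g Z)"
      then obtain r where r: "a *s x + b *s y - r *s g \<in> ?A" using span_breakdown_eq by blast
      then have "r = 0" by (rule gxy)
      then show "a = 0 \<and> b = 0" using r ind unfolding indep2_def by simp
    qed
    have gA: "g \<notin> ?A" using g(2) span_mono[of Z "insert x (insert y Z)"] by blast
    have indg: "indep2 ?A z g" if "z \<notin> span (insert g Z)" for z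
    proof -
      have "indep2 ?A z g"
      proof (rule indep2I[OF sA gA])
        show "z + b *s g \<notin> ?A" for b
          using that span_breakdown_eq[of z g Z] by (metis diff_minus_eq_add scale_minus_left)
      qed
      then show ?thesis .
    qed
    have out: "x \<notin> span (insert g Z)" "y \<notin> span (insert g Z)" using indep2_notin[OF ind'] by auto
    note indxg = indg[OF out(1)] and indyg = indg[OF out(2)]
    have "card (E - span (insert g Z)) < card (E - ?A)"
      using fin g(1) gA span_mono[of Z "insert g Z"] span_base[of g "insert g Z"]
      by (intro psubset_card_mono) auto
    from less.hyps[OF this fin _ xE yE ind']
    have "linked E (insert g Z) x y \<or> separated E (insert g Z) x y" using ZE g by simp
    then show ?thesis
    proof
      assume "linked E (insert g Z) x y"
      then obtain K e a b where K: "K \<subseteq> E" "e \<in> E" "indep2 (span (insert g Z \<union> K)) x y"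
        "a \<noteq> 0" "b \<noteq> 0" "e - (a *s x + b *s y) \<in> span (insert g Z \<union> K)" unfolding linked_def by blast
      have "insert g Z \<union> K = Z \<union> insert g K" by blast
      then have "linked E Z x y" unfolding linked_def using K g(1)
        by (intro exI[of _ "insert g K"] exI[of _ e] exI[of _ a] exI[of _ b]) simp
      then show ?thesis ..
    next
      assume "separated E (insert g Z) x y"
      then obtain D1 D2 where D: "D1 = span (E \<inter> D1)" "D2 = span (E \<inter> D2)"
        "D1 \<inter> D2 = span (insert g Z)" "x \<in> D1" "y \<in> D2" "E \<subseteq> D1 \<union> D2" unfolding separated_def by blast
      have sub: "subspace D1" "subspace D2" using D by (metis subspace_span)+
      have nin: "y \<notin> D1" "x \<notin> D2" using out D by blast+
      have gD: "g \<in> D1" "g \<in> D2" using D(3) span_base[of g "insert g Z"] by blast+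
      have AD: "?A \<subseteq> D1" "?A \<subseteq> D2" using D(3) span_mono[of Z "insert g Z"] by blast+
      have ZD: "Z \<subseteq> D1" "Z \<subseteq> D2" using AD span_superset[of Z] by blast+
      have xyA: "x \<notin> ?A" "y \<notin> ?A" using nin AD by blast+
      \<comment> \<open>The measure drops because \<open>y\<close> is missing from \<open>D1\<close>
        and \<open>x\<close> from \<open>D2\<close>.\<close>
      have "card (E \<inter> D1 - ?A) < card (E - ?A)" "card (E \<inter> D2 - ?A) < card (E - ?A)"
        using fin xE yE nin xyA by (intro psubset_card_mono; blast)+
      note IH = less.hyps[OF this(1) _ _ _ _ indxg] less.hyps[OF this(2) _ _ _ _ indyg]
      have "linked (E \<inter> D1) Z x g \<or> separated (E \<inter> D1) Z x g"
        using IH(1) fin ZE ZD xE D g gD by simp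
      moreover have "linked (E \<inter> D2) Z y g \<or> separated (E \<inter> D2) Z y g"
        using IH(2) fin ZE ZD yE D g gD by simp
      moreover have "separated E Z x y" if "separated (E \<inter> D1) Z x g"
        using separated_step[OF D(1-3,5,6) ZE that] .
      moreover have "separated E Z x y" if "separated (E \<inter> D2) Z y g"
        using separated_step[OF D(2,1) _ D(4) _ ZE that] D(3,6)
        by (simp add: Int_commute Un_commute separated_sym)
      \<comment> \<open>Two circuits are glued at \<open>g\<close>. Contracting \<open>e1\<close>
        together with \<open>K1\<close> identifies \<open>g\<close> with \<open>- (a / b)\<close>
        times \<open>x\<close>, so \<open>e2\<close> becomes a point of the line of \<open>x\<close>
        and \<open>y\<close>; this is the origin of the coefficient
        \<open>- (d * a / b)\<close>.\<close>
      moreover have "linked E Z x y" if l1: "linked (E \<inter> D1) Z x g" and l2: "linked (E \<inter> D2) Z y g"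
      proof -
        from l1 obtain K1 e1 a b where K1: "K1 \<subseteq> E \<inter> D1" "e1 \<in> E \<inter> D1" "indep2 (span (Z \<union> K1)) x g"
          "a \<noteq> 0" "b \<noteq> 0" "e1 - (a *s x + b *s g) \<in> span (Z \<union> K1)" unfolding linked_def by blast
        from l2 obtain K2 e2 c d where K2: "K2 \<subseteq> E \<inter> D2" "e2 \<in> E \<inter> D2" "indep2 (span (Z \<union> K2)) y g"
          "c \<noteq> 0" "d \<noteq> 0" "e2 - (c *s y + d *s g) \<in> span (Z \<union> K2)" unfolding linked_def by blast
        let ?K = "insert e1 (K1 \<union> K2)"
        let ?B = "span (Z \<union> ?K)"
        have m: "span (Z \<union> K1) \<subseteq> ?B" "span (Z \<union> K2) \<subseteq> ?B" by (intro span_mono; blast)+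
        have sD: "span (Z \<union> K1) \<subseteq> D1" "span (Z \<union> K2) \<subseteq> D2"
          using ZD K1 K2 sub by (intro span_minimal; blast)+
        have A1: "?A \<subseteq> span (Z \<union> K1)" "?A \<subseteq> span (Z \<union> K2)" by (intro span_mono; blast)+
        have "e2 - ((- (d * a / b)) *s x + c *s y) \<in> ?B"
        proof (rule lin3[OF subspace_span])
          show "e2 - (c *s y + d *s g) \<in> ?B" "e1 - (a *s x + b *s g) \<in> ?B" "e1 \<in> ?B"
            using K1 K2 m by (auto intro: span_base)
          show "e2 - ((- (d * a / b)) *s x + c *s y) = 1 *s (e2 - (c *s y + d *s g)) +
            (- (d / b)) *s (e1 - (a *s x + b *s g)) + (d / b) *s e1"
            using K1 by (simp add: algebra_simps)
        qed
        moreover have "indep2 ?B x y"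
          unfolding indep2_def
        proof (intro allI impI)
          fix \<alpha> \<beta> assume "\<alpha> *s x + \<beta> *s y \<in> ?B"
          moreover have "Z \<union> ?K = insert e1 ((Z \<union> K1) \<union> (Z \<union> K2))" by blast
          ultimately obtain t where "\<alpha> *s x + \<beta> *s y - t *s e1 \<in> span ((Z \<union> K1) \<union> (Z \<union> K2))"
            using span_breakdown_eq by metis
          then obtain s1 s2 where s: "s1 \<in> span (Z \<union> K1)" "s2 \<in> span (Z \<union> K2)"
            "\<alpha> *s x + \<beta> *s y - t *s e1 = s1 + s2" using in_span_Un by blast
          have q: "\<alpha> *s x - t *s e1 - s1 = s2 - \<beta> *s y" using s(3) by (simp add: algebra_simps)
          have "\<alpha> *s x - t *s e1 - s1 \<in> D1"
            using sub(1) D(4) K1(2) s(1) sD(1) by (intro subspace_diff subspace_scale) auto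
          moreover have "s2 - \<beta> *s y \<in> D2"
            using sub(2) D(5) s(2) sD(2) by (intro subspace_diff subspace_scale) auto
          ultimately have "s2 - \<beta> *s y \<in> span (insert g Z)" using D(3) unfolding q by blast
          then obtain s where s': "s2 - \<beta> *s y - s *s g \<in> ?A" using span_breakdown_eq by blast
          have "\<beta> *s y + s *s g \<in> span (Z \<union> K2)"
            by (rule lin2[OF subspace_span s(2) subsetD[OF A1(2) s'], of _ 1 "-1"]) (simp add: algebra_simps)
          then have bs: "\<beta> = 0" "s = 0" using K2(3) unfolding indep2_def by blast+
          have q': "\<alpha> *s x - t *s e1 - s1 \<in> ?A" using s' bs q by simp
          have "(\<alpha> - t * a) *s x + (- (t * b)) *s g \<in> span (Z \<union> K1)"
            by (rule lin3[OF subspace_span subsetD[OF A1(1) q'] s(1) K1(6), of _ 1 1 t])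
              (simp add: algebra_simps)
          then have "\<alpha> - t * a = 0" "- (t * b) = 0" using K1(3) unfolding indep2_def by blast+
          then show "\<alpha> = 0 \<and> \<beta> = 0" using bs K1(5) by simp
        qed
        ultimately show ?thesis unfolding linked_def using K1 K2
          by (intro exI[of _ ?K] exI[of _ e2] exI[of _ "- (d * a / b)"] exI[of _ c]) auto
      qed
      ultimately show ?thesis by blast
    qed
  qed
qed

section \<open>Restriction to a flat, and pairs linked on two sides\<close>

lemma pt_restrict:
  assumes "subspace W" "subspace A" "A \<subseteq> W" "z \<in> W"
  shows "pt (E \<inter> W) A z \<longleftrightarrow> pt E A z"
proof
  assume "pt E A z"
  from ptE[OF this assms(2)] obtain e c where h: "e \<in> E" "c \<noteq> 0" "z - c *s e \<in> A" "z \<notin> A" by metis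
  have "e \<in> W"
    by (rule lin2[OF assms(1,4) subsetD[OF assms(3) h(3)], of _ "1 / c" "- 1 / c"])
      (use h in \<open>simp add: algebra_simps\<close>)
  then show "pt (E \<inter> W) A z" using h unfolding pt_def by blast
qed (auto simp: pt_def)

lemma pt_in: assumes "subspace W" "A \<subseteq> W" "E \<subseteq> W" "pt E A z" shows "z \<in> W"
proof -
  from assms(4) obtain e c where "e \<in> E" "z - c *s e \<in> A" unfolding pt_def by blast
  then show ?thesis using assms(2,3) by (intro lin2[OF assms(1), of "z - c *s e" e z 1 c]) auto
qed

lemma clean_restrict: assumes "clean E" "subspace W" shows "clean (E \<inter> W)"
  unfolding clean_def
proof (intro allI impI)
  fix X u v d
  assume X: "X \<subseteq> E \<inter> W" and p: "pt (E \<inter> W) (span X) u" "pt (E \<inter> W) (span X) v"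
    "pt (E \<inter> W) (span X) (u + v)" and out: "u + d *s v \<notin> span X"
  have XW: "span X \<subseteq> W" using X assms(2) by (simp add: span_minimal)
  note r = pt_restrict[OF assms(2) subspace_span XW]
  have uv: "u \<in> W" "v \<in> W" using p pt_in[OF assms(2) XW] by blast+
  then have "u + v \<in> W" "u + d *s v \<in> W" using assms(2) by (auto intro: subspace_add subspace_scale)
  then show "pt (E \<inter> W) (span X) (u + d *s v)" using X p out uv assms(1) r unfolding clean_def by simp
qed

lemma nonadj_restrict:
  assumes "subspace W" "subspace A" "A \<subseteq> W" "u \<in> W" "v \<in> W"
  shows "nonadj (E \<inter> W) A u v \<longleftrightarrow> nonadj E A u v"
  unfolding nonadj_def using assms pt_restrict[OF assms(1-3)]
  by (simp add: subspace_add subspace_scale)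

text \<open>Contracting all of the linking set makes \<open>e\<close> a third point of the line of
  \<open>x\<close> and \<open>y\<close>. So a maximal subset that keeps the line at two points is
  proper, and any further element \<open>g\<close> of the linking set fills the line.\<close>

lemma linked_imp_adjacent_contraction:
  assumes "clean E" "finite E" "Z \<subseteq> E" "nonadj E (span Z) x y" "linked E Z x y"
  obtains K g where "K \<subseteq> E" "g \<in> E" "nonadj E (span (Z \<union> K)) x y"
    "indep2 (span (insert g (Z \<union> K))) x y"
    "\<And>a b. a \<noteq> 0 \<or> b \<noteq> 0 \<Longrightarrow> pt E (span (insert g (Z \<union> K))) (a *s x + b *s y)"
proof -
  from assms(5) obtain K e a b where K: "K \<subseteq> E" "e \<in> E" "indep2 (span (Z \<union> K)) x y"
    "a \<noteq> 0" "b \<noteq> 0" "e - (a *s x + b *s y) \<in> span (Z \<union> K)" unfolding linked_def by blast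
  obtain Y where Y: "Y \<subseteq> K" "nonadj E (span (Z \<union> Y)) x y"
    and max: "\<And>Y'. Y \<subseteq> Y' \<Longrightarrow> Y' \<subseteq> K \<Longrightarrow> nonadj E (span (Z \<union> Y')) x y \<Longrightarrow> Y' = Y"
  proof (rule exists_maximal_between[where P = "\<lambda>Y. nonadj E (span (Z \<union> Y)) x y" and E = K and X = "{}"])
    show "finite K" using K(1) assms(2) finite_subset by blast
  qed (use assms(4) in auto)
  have sK: "subspace (span (Z \<union> K))" by simp
  have "Y \<noteq> K"
  proof
    assume "Y = K"
    then have non: "nonadj E (span (Z \<union> K)) x y" using Y by simp
    have "a *s x + b *s y \<notin> span (Z \<union> K)" using K unfolding indep2_def by blast
    moreover have "(a *s x + b *s y) - 1 *s e \<in> span (Z \<union> K)"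
      by (rule lin1[OF sK K(6), of _ "-1"]) simp
    ultimately have "pt E (span (Z \<union> K)) (a *s x + b *s y)" using K(2) unfolding pt_def by blast
    then have "pt E (span (Z \<union> K)) ((1 / a) *s (a *s x + b *s y))" using K by (intro pt_scale) auto
    then have "pt E (span (Z \<union> K)) (x + (b / a) *s y)" using K by (simp add: algebra_simps)
    then show False using non K unfolding nonadj_def by simp
  qed
  then obtain g where g: "g \<in> K" "g \<notin> Y" using Y by blast
  have ins: "insert g (Z \<union> Y) = Z \<union> insert g Y" by blast
  let ?B = "span (insert g (Z \<union> Y))"
  have non: "\<not> nonadj E ?B x y" using max[of "insert g Y"] g Y unfolding ins by auto
  have ind: "indep2 ?B x y" by (rule indep2_mono[OF K(3)], rule span_mono) (use g Y in blast)
  have "span (Z \<union> Y) \<subseteq> ?B" by (rule span_mono) blast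
  then have p: "pt E ?B x" "pt E ?B y"
    using Y(2) indep2_notin[OF ind] unfolding nonadj_def by (blast intro: pt_mono)+
  have "insert g (Z \<union> Y) \<subseteq> E" using K Y g assms(3) by blast
  note adj_all[OF assms(1) this p ind non]
  then show ?thesis using that[of Y g] Y g ind K(1) by blast
qed

text \<open>After contracting \<open>g1\<close> from one side, \<open>x + y\<close> becomes a point, and then so do all points of the
  line through it and \<open>g2\<close>; those lie on the second side, where they make \<open>x + y\<close> a point without
  contracting \<open>g1\<close>.\<close>

lemma not_linked_on_both_sides:
  assumes two: "CARD('f) > 2" and cl: "clean E" and fin: "finite E"
    and W: "W1 = span (E \<inter> W1)" "W2 = span (E \<inter> W2)" "E \<subseteq> W1 \<union> W2"
    and U: "W1 \<inter> W2 = span (insert x (insert y Z))"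
    and ZE: "Z \<subseteq> E" and non: "nonadj E (span Z) x y"
    and l1: "linked (E \<inter> W1) Z x y" and l2: "linked (E \<inter> W2) Z x y"
  shows False
proof -
  have sub: "subspace W1" "subspace W2" using W by (metis subspace_span)+
  have xy: "x \<in> W1" "x \<in> W2" "y \<in> W1" "y \<in> W2"
    using U span_base[of x "insert x (insert y Z)"] span_base[of y "insert x (insert y Z)"] by blast+
  have ZU: "span Z \<subseteq> W1 \<inter> W2" unfolding U by (rule span_mono) blast
  then have ZW: "Z \<subseteq> W1" "Z \<subseteq> W2" using span_superset[of Z] by blast+
  have non1: "nonadj (E \<inter> W1) (span Z) x y" and non2: "nonadj (E \<inter> W2) (span Z) x y"
    using nonadj_restrict[OF sub(1) subspace_span _ xy(1,3)] nonadj_restrict[OF sub(2) subspace_span _ xy(2,4)]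
      ZU non by auto
  obtain K1 g1 where K1: "K1 \<subseteq> E \<inter> W1" "g1 \<in> E \<inter> W1" "nonadj (E \<inter> W1) (span (Z \<union> K1)) x y"
    "indep2 (span (insert g1 (Z \<union> K1))) x y"
    "\<And>a b. a \<noteq> 0 \<or> b \<noteq> 0 \<Longrightarrow> pt (E \<inter> W1) (span (insert g1 (Z \<union> K1))) (a *s x + b *s y)"
    by (rule linked_imp_adjacent_contraction[OF clean_restrict[OF cl sub(1)] _ _ non1 l1])
      (use fin ZE ZW in blast)+
  obtain K2 g2 where K2: "K2 \<subseteq> E \<inter> W2" "g2 \<in> E \<inter> W2" "nonadj (E \<inter> W2) (span (Z \<union> K2)) x y"
    "indep2 (span (insert g2 (Z \<union> K2))) x y"
    "\<And>a b. a \<noteq> 0 \<or> b \<noteq> 0 \<Longrightarrow> pt (E \<inter> W2) (span (insert g2 (Z \<union> K2))) (a *s x + b *s y)"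
    by (rule linked_imp_adjacent_contraction[OF clean_restrict[OF cl sub(2)] _ _ non2 l2])
      (use fin ZE ZW in blast)+
  let ?A2 = "span (Z \<union> K2)" and ?B1 = "span (insert g1 (Z \<union> K1))" and ?B2 = "span (insert g2 (Z \<union> K2))"
  let ?C = "span (insert g1 (Z \<union> K1 \<union> K2))"
  have BW: "?B1 \<subseteq> W1" "?B2 \<subseteq> W2"
    using K1(1,2) K2(1,2) ZW by (simp_all add: span_minimal[OF _ sub(1)] span_minimal[OF _ sub(2)])
  have A2B2: "?A2 \<subseteq> ?B2" by (rule span_mono) blast
  have ZB: "span Z \<subseteq> ?B1" "span Z \<subseteq> ?A2" by (intro span_mono; blast)+
  \<comment> \<open>\<open>W1 \<inter> W2\<close> is the span of \<open>x\<close>, \<open>y\<close>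
    and \<open>Z\<close>. As \<open>x\<close> and \<open>y\<close> are independent modulo
    \<open>B\<close>, a common vector of both sides that lies in \<open>B\<close> has no
    \<open>x\<close> part and no \<open>y\<close> part.\<close>
  have tiny: "v \<in> span Z" if v: "v \<in> W1" "v \<in> W2" and B: "span Z \<subseteq> B" "v \<in> B" "subspace B" "indep2 B x y" for v B
  proof -
    from v U obtain a b where ab: "v - (a *s x + b *s y) \<in> span Z" using in_span_insert2 by blast
    have "a *s x + b *s y \<in> B"
      by (rule lin2[OF B(3,2) subsetD[OF B(1) ab], of _ 1 "-1"]) simp
    then show ?thesis using ab B(4) unfolding indep2_def by (metis diff_zero scale_zero_left add_0)
  qed
  have small1: "v \<in> span Z" if "v \<in> W2" "v \<in> ?B1" for v
    using tiny[of v ?B1] that BW(1) ZB(1) K1(4) by blast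
  have small2: "v \<in> span Z" if "v \<in> W1" "v \<in> ?B2" for v
    using tiny[of v ?B2] that BW(2) ZB(2) A2B2 K2(4) by blast
  have g2: "g2 \<notin> ?A2"
  proof
    assume "g2 \<in> ?A2"
    then have "?B2 = ?A2" by (rule span_redundant)
    then have "pt (E \<inter> W2) ?A2 (x + 1 *s y)" using K2(5)[of 1 1] by simp
    then show False using K2(3) unfolding nonadj_def by (metis one_neq_zero)
  qed
  have C_split: "\<exists>b1 a2. b1 \<in> ?B1 \<and> a2 \<in> ?A2 \<and> v = b1 + a2" if "v \<in> ?C" for v
  proof -
    have "insert g1 (Z \<union> K1 \<union> K2) = insert g1 (Z \<union> K1) \<union> (Z \<union> K2)" by blast
    then show ?thesis using that in_span_Un by metis
  qed
  \<comment> \<open>After contracting \<open>K1\<close>, \<open>g1\<close> and \<open>K2\<close>,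
    the vectors \<open>x + y\<close> and \<open>g2\<close> still span a line.\<close>
  have out: "\<alpha> = 0 \<and> s = 0" if h: "\<alpha> *s (x + y) - s *s g2 \<in> ?C" for \<alpha> s
  proof -
    from C_split[OF h] obtain b1 a2 where ba: "b1 \<in> ?B1" "a2 \<in> ?A2" "\<alpha> *s (x + y) - s *s g2 = b1 + a2" by blast
    have eq: "\<alpha> *s (x + y) - b1 = s *s g2 + a2" using ba(3) by (simp add: algebra_simps)
    have "\<alpha> *s (x + y) - b1 \<in> W1" using sub xy ba BW by (intro subspace_diff subspace_scale subspace_add) auto
    moreover have "s *s g2 + a2 \<in> ?B2" using ba(2) A2B2 by (intro span_add span_scale) (auto intro: span_base)
    ultimately have z: "s *s g2 + a2 \<in> span Z" using small2 unfolding eq by blast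
    then have z1: "\<alpha> *s (x + y) - b1 \<in> ?B1" unfolding eq using ZB by blast
    have "\<alpha> *s x + \<alpha> *s y \<in> ?B1"
      by (rule lin2[OF subspace_span z1 ba(1), of _ 1 1]) (simp add: algebra_simps)
    then have "\<alpha> = 0" using K1(4) unfolding indep2_def by blast
    moreover have "s *s g2 \<in> ?A2"
      by (rule lin2[OF subspace_span subsetD[OF ZB(2) z] ba(2), of _ 1 "-1"]) simp
    then have "s = 0" using g2 scale_mem_iff[OF subspace_span] by blast
    ultimately show ?thesis by simp
  qed
  have out': "(x + y) - s *s g2 \<notin> ?C" "g2 \<notin> ?C" for s
    using out[of 1 s] out[of 0 "-1"] by auto
  have A2C: "?A2 \<subseteq> ?C" and B1C: "?B1 \<subseteq> ?C" by (intro span_mono; blast)+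
  have "pt (E \<inter> W2) ?B2 (x + y)" using K2(5)[of 1 1] by simp
  \<comment> \<open>On the second side \<open>x + y\<close> becomes a point only once
    \<open>g2\<close> is contracted. Lifted back, it is a point of the line through
    \<open>x + y\<close> and \<open>g2\<close> other than these two.\<close>
  from pt_insert[OF this] obtain t where t: "pt (E \<inter> W2) ?A2 (x + y - t *s g2)" .
  have t0: "t \<noteq> 0"
  proof
    assume "t = 0"
    then have "pt (E \<inter> W2) ?A2 (x + 1 *s y)" using t by simp
    then show False using K2(3) unfolding nonadj_def by (metis one_neq_zero)
  qed
  have pC: "pt E ?C (x + y)" "pt E ?C g2" "pt E ?C (1 *s (x + y) + (- t) *s g2)"
    using pt_mono[OF K1(5)[of 1 1] B1C] out'(1)[of 0] pt_mem[of g2 E ?C] K2(2) out'(2)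
      pt_mono[OF t A2C] out'(1)[of t] by auto
  have XE: "insert g1 (Z \<union> K1 \<union> K2) \<subseteq> E" "Z \<union> K2 \<subseteq> E" using K1 K2 ZE by auto
  \<comment> \<open>The line through \<open>x + y\<close> and \<open>g2\<close> is full modulo
    \<open>?C\<close>. An element representing one of its points with \<open>s \<noteq> 0\<close>
    cannot lie in \<open>W1\<close>, because \<open>g2\<close> would then fall into
    \<open>?A2\<close>. So it lies in \<open>W2\<close> and represents the point already modulo
    \<open>?A2\<close>.\<close>
  have key: "pt E ?A2 (x + y - s *s g2)" if s: "s \<noteq> 0" for s
  proof -
    have "pt E ?C (1 *s (x + y) + (- s) *s g2)"
      by (rule clean_line[OF cl XE(1) pC]) (use t0 out'(1)[of s] in auto)
    then have "pt E ?C (x + y - s *s g2)" by simp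
    from ptE[OF this subspace_span] obtain e k where e: "e \<in> E" "x + y - s *s g2 - k *s e \<in> ?C" by metis
    from C_split[OF e(2)] obtain b1 a2 where ba: "b1 \<in> ?B1" "a2 \<in> ?A2"
      "x + y - s *s g2 - k *s e = b1 + a2" by blast
    have "x + y - s *s g2 \<notin> ?A2" using out'(1)[of s] A2C by blast
    moreover have "x + y - s *s g2 - k *s e \<in> ?A2"
    proof (cases "e \<in> W2")
      case True
      have eq: "b1 = x + y - s *s g2 - k *s e - a2" using ba(3) by (simp add: algebra_simps)
      have "b1 \<in> W2" unfolding eq using sub xy True K2(2) ba(2) A2B2 BW(2)
        by (intro subspace_diff subspace_scale subspace_add) auto
      then have "b1 \<in> ?A2" using small1 ba(1) ZB by blast
      then show ?thesis unfolding ba(3) using ba(2) by (rule span_add)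
    next
      case False
      then have eW: "e \<in> W1" using e W(3) by blast
      have eq: "s *s g2 + a2 = x + y - k *s e - b1" using ba(3) by (simp add: algebra_simps)
      have "x + y - k *s e - b1 \<in> W1" using sub xy eW ba(1) BW(1)
        by (intro subspace_diff subspace_scale subspace_add) auto
      moreover have "s *s g2 + a2 \<in> ?B2" using ba(2) A2B2 by (intro span_add span_scale) (auto intro: span_base)
      ultimately have z: "s *s g2 + a2 \<in> span Z" using small2 unfolding eq by blast
      have "s *s g2 \<in> ?A2"
        by (rule lin2[OF subspace_span subsetD[OF ZB(2) z] ba(2), of _ 1 "-1"]) simp
      then show ?thesis using s g2 scale_mem_iff[OF subspace_span] by blast
    qed
    ultimately show ?thesis using e(1) unfolding pt_def by blast
  qed
  \<comment> \<open>The scalars 1 and \<open>s\<close> give two points which, with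
    \<open>g2\<close>, fill their line modulo \<open>?A2\<close>; the line contains
    \<open>x + y\<close>, against the choice of \<open>K2\<close>.\<close>
  obtain s :: 'f where s: "s \<noteq> 0" "s \<noteq> 1"
  proof -
    have "\<not> (UNIV :: 'f set) \<subseteq> {0, 1}" using two card_mono[of "{0, 1 :: 'f}" UNIV] by auto
    then show ?thesis using that by blast
  qed
  define P where "P = x + y - 1 *s g2"
  have pP: "pt E ?A2 P" using key[of 1] by (simp add: P_def)
  have pg: "pt E ?A2 g2" using pt_mem[of g2 E ?A2] g2 K2(2) by simp
  have eq: "1 *s P + (1 - s) *s g2 = x + y - s *s g2" by (simp add: P_def algebra_simps)
  have eq2: "1 *s P + 1 *s g2 = x + 1 *s y" by (simp add: P_def)
  have nin: "x + 1 *s y \<notin> ?A2" using out'(1)[of 0] A2C by auto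
  have pS: "pt E ?A2 (1 *s P + (1 - s) *s g2)" unfolding eq using key[OF s(1)] .
  have nin2: "1 *s P + 1 *s g2 \<notin> ?A2" unfolding eq2 using nin .
  have "pt E ?A2 (1 *s P + 1 *s g2)"
    by (rule clean_line[OF cl XE(2) pP pg pS _ _ nin2]) (use s in simp_all)
  then have "pt E ?A2 (x + 1 *s y)" unfolding eq2 .
  moreover have "x + 1 *s y \<in> W2" using sub xy by (auto intro: subspace_add)
  ultimately have "pt (E \<inter> W2) ?A2 (x + 1 *s y)"
    using pt_restrict[OF sub(2) subspace_span, of "Z \<union> K2"] A2B2 BW by blast
  then show False using K2(3) unfolding nonadj_def by (metis one_neq_zero)
qed

end

section \<open>Decomposition of clean configurations\<close>

context finite_field_space
begin

text \<open>Lines that have all their points make \<open>E\<close> closed under addition up to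
  scalars, so a linear combination can be built one summand at a time.\<close>

lemma full_if_all_adjacent:
  assumes cl: "clean E" and no: "\<And>x y. x \<in> E \<Longrightarrow> y \<in> E \<Longrightarrow> \<not> nonadj E {0} x y"
    and z: "z \<in> span E" "z \<noteq> 0"
  shows "pt E {0} z"
proof -
  have "z = 0 \<or> pt E {0} z"
    using z(1)
  proof (induction rule: span_induct_alt)
    case (step c e y)
    show ?case
    proof (cases "y = 0 \<or> c = 0")
      case True
      then consider "y = 0" "c \<noteq> 0" | "c = 0" | "y = 0" "c = 0" by blast
      then show ?thesis
      proof cases
        case 1
        then show ?thesis using step(1) by (auto simp: pt_def intro!: bexI[of _ e])
      qed (use step in auto)
    next
      case False
      then have c: "c \<noteq> 0" and "pt E {0} y" using step by auto
      then obtain e' k where e': "e' \<in> E" "k \<noteq> 0" "y = k *s e'" "e' \<noteq> 0"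
        using ptE[of E "{0}" y] by (auto simp: subspace_def)
      show ?thesis
      proof (cases "indep2 {0} e e'")
        case True
        then have "e \<noteq> 0" using indep2_notin by blast
        have "pt E {0} (c *s e + k *s e')"
          using adj_all[OF cl, of "{}" e e' c k] True no[OF step(1) e'(1)] c e' step(1) \<open>e \<noteq> 0\<close>
            pt_mem[of e E "{0}"] pt_mem[of e' E "{0}"] by simp
        then show ?thesis using e' by simp
      next
        case False
        then obtain a b where ab: "a *s e + b *s e' = 0" "a \<noteq> 0 \<or> b \<noteq> 0" unfolding indep2_def by auto
        have "a \<noteq> 0" using ab e' by auto
        have "e = (- b / a) *s e'"
        proof -
          have "(1 / a) *s (a *s e + b *s e') = 0" using ab by simp
          then have "e + (b / a) *s e' = 0" using \<open>a \<noteq> 0\<close> by (simp add: algebra_simps)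
          then show ?thesis by (simp add: eq_neg_iff_add_eq_0)
        qed
        then have "c *s e + y = (c * (- b / a) + k) *s e'" using e' by (simp add: algebra_simps)
        then show ?thesis using e'(1) unfolding pt_def by auto
      qed
    qed
  qed simp
  then show ?thesis using z by simp
qed

lemma cover_sym: "cover E W1 W2 \<Longrightarrow> cover E W2 W1"
  unfolding cover_def by (simp add: Int_commute Un_commute)

text \<open>A separation \<open>D1\<close>, \<open>D2\<close> of the elements in \<open>W1\<close>
  allows \<open>D2\<close> to move to the other side: by the modular law \<open>D1\<close> and the
  span of \<open>W2 \<union> D2\<close> meet only in the span of \<open>x\<close> and
  \<open>Z\<close>, so \<open>y\<close> leaves the intersection. The mirror move loses
  \<open>x\<close> instead.\<close>

lemma smaller_cover:
  assumes cov: "cover E W1 W2" and U: "W1 \<inter> W2 = span (insert x (insert y Z))"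
    and Z: "Z \<subseteq> E" "x \<in> E" "y \<in> E" and ind: "indep2 (span Z) x y"
    and sep: "separated (E \<inter> W1) Z x y"
  obtains F1 F2 where "cover E F1 F2" "E \<inter> (F1 \<inter> F2) \<subset> E \<inter> (W1 \<inter> W2)"
proof -
  note result = that
  note W = cov[unfolded cover_def]
  have EW: "E \<subseteq> W1 \<union> W2" using W by (elim conjE)
  have sub: "subspace W1" "subspace W2" using W by (metis subspace_span)+
  from sep obtain D1 D2 where D: "D1 = span (E \<inter> W1 \<inter> D1)" "D2 = span (E \<inter> W1 \<inter> D2)"
    "D1 \<inter> D2 = span Z" "x \<in> D1" "y \<in> D2" "E \<inter> W1 \<subseteq> D1 \<union> D2" unfolding separated_def by blast
  have sD: "subspace D1" "subspace D2" using D by (metis subspace_span)+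
  have DW: "D1 \<subseteq> W1" "D2 \<subseteq> W1"
    using subset_of_spanned[OF D(1) _ sub(1)] subset_of_spanned[OF D(2) _ sub(1)] by blast+
  have xyU: "x \<in> W1 \<inter> W2" "y \<in> W1 \<inter> W2" "Z \<subseteq> W1 \<inter> W2"
    unfolding U using span_superset[of "insert x (insert y Z)"] by blast+
  have meet: "D \<inter> span (W2 \<union> D') = span (insert u Z)"
    if h: "subspace D" "subspace D'" "D \<subseteq> W1" "D' \<subseteq> W1" "D \<inter> D' = span Z" "u \<in> D" "v \<in> D'" "u \<in> W2"
      and UV: "W1 \<inter> W2 = span (insert u (insert v Z))" for D D' u v
  proof
    show "D \<inter> span (W2 \<union> D') \<subseteq> span (insert u Z)"
    proof
      fix z assume z: "z \<in> D \<inter> span (W2 \<union> D')"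
      then obtain w d where wd: "w \<in> W2" "d \<in> D'" "z = w + d" using in_span_Un sub h(2) by (metis IntD2 span_eq_iff)
      have "w = z - d" using wd by simp
      then have "w \<in> W1 \<inter> W2" using wd z h sub by (metis IntD1 IntI subsetD subspace_diff)
      then obtain a b where ab: "w - (a *s u + b *s v) \<in> span Z" using UV in_span_insert2 by blast
      have Zs: "span Z \<subseteq> D" "span Z \<subseteq> D'" using h by blast+
      have "z - a *s u \<in> D" using z h by (intro subspace_diff subspace_scale) auto
      moreover have "z - a *s u \<in> D'"
        by (rule lin3[OF h(2) wd(2) h(7) subsetD[OF Zs(2) ab], of _ 1 b 1]) (simp add: wd algebra_simps)
      ultimately show "z \<in> span (insert u Z)" using h(5) span_breakdown_eq by blast
    qed
    have "insert u Z \<subseteq> D" using h span_superset[of Z] by blast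
    moreover have "insert u Z \<subseteq> span (W2 \<union> D')" using h xyU span_superset[of "W2 \<union> D'"] by blast
    ultimately show "span (insert u Z) \<subseteq> D \<inter> span (W2 \<union> D')"
      using h by (intro span_minimal subspace_inter) auto
  qed
  have swap: "insert x (insert y Z) = insert y (insert x Z)" by blast
  have m1: "D1 \<inter> span (W2 \<union> D2) = span (insert x Z)"
    using meet[OF sD DW D(3,4,5) _ U] xyU by blast
  have xyW: "x \<in> W2" "y \<in> W2" using xyU by blast+
  have m2: "D2 \<inter> span (W2 \<union> D1) = span (insert y Z)"
    using meet[OF sD(2,1) DW(2,1) _ D(5,4)] D(3) xyW U unfolding swap by (simp add: Int_commute)
  have good: thesis
    if c: "\<not> E \<subseteq> span (W2 \<union> D')" "D \<inter> span (W2 \<union> D') = span (insert u Z)" "v \<notin> D" "v \<in> E"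
      "D = span (E \<inter> W1 \<inter> D)" "D' = span (E \<inter> W1 \<inter> D')" "E \<inter> W1 \<subseteq> D \<union> D'" "u \<in> E"
      "v \<in> W1 \<inter> W2" "u \<in> W1 \<inter> W2"
    for D D' u v
  proof (rule result)
    have sD: "subspace D" using c(5) by (metis subspace_span)
    let ?F = "span (W2 \<union> D')"
    have F1: "D = span (E \<inter> D)"
      by (rule antisym, subst c(5), rule span_mono, blast, rule span_minimal) (use sD in auto)
    have F2: "?F = span (E \<inter> ?F)"
    proof (rule antisym)
      have "D' \<subseteq> span (E \<inter> ?F)"
        by (subst c(6), rule span_mono) (use span_superset[of "W2 \<union> D'"] in blast)
      moreover have "span (E \<inter> W2) \<subseteq> span (E \<inter> ?F)"
        by (rule span_mono) (use span_superset[of "W2 \<union> D'"] in blast)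
      then have "W2 \<subseteq> span (E \<inter> ?F)" using W by blast
      ultimately show "?F \<subseteq> span (E \<inter> ?F)" by (simp add: span_minimal)
    qed (simp add: span_minimal)
    have F3: "D \<inter> ?F = span (E \<inter> (D \<inter> ?F))" using c(2,8) Z(1) span_Int_span[of "insert u Z" E] by simp
    have F4: "E \<subseteq> D \<union> ?F" using EW c(7) span_superset[of "W2 \<union> D'"] by blast
    have "\<not> E \<subseteq> D" using c(3,4) by blast
    then show "cover E D ?F" unfolding cover_def using F1 F2 F3 F4 c(1) by (intro conjI)
    have "span (insert u Z) \<subseteq> W1 \<inter> W2"
      using c(10) xyU by (intro span_minimal subspace_inter sub) auto
    then show "E \<inter> (D \<inter> ?F) \<subset> E \<inter> (W1 \<inter> W2)" using c(2,3,4,9) by blast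
  qed
  have yD: "y \<notin> D1"
  proof
    assume "y \<in> D1"
    then have "y \<in> span Z" using D by blast
    then show False using indep2_notin[OF ind] by blast
  qed
  have xD: "x \<notin> D2"
  proof
    assume "x \<in> D2"
    then have "x \<in> span Z" using D by blast
    then show False using indep2_notin[OF ind] by blast
  qed
  consider "\<not> E \<subseteq> span (W2 \<union> D2)" | "\<not> E \<subseteq> span (W2 \<union> D1)"
    | "E \<subseteq> span (W2 \<union> D2)" "E \<subseteq> span (W2 \<union> D1)" by blast
  then show thesis
  proof cases
    case 1
    then show thesis using good[OF 1 m1 yD Z(3) D(1,2,6) Z(2) xyU(2,1)] by blast
  next
    case 2
    then show thesis using good[OF 2 m2 xD Z(2) D(2,1) _ Z(3) xyU(1,2)] D(6) by blast
  next
    \<comment> \<open>Both moves fail only if the enlarged second flat swallows \<open>E\<close>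
      each time. Then both parts of \<open>W1\<close> lie in \<open>W2\<close>, against the
      properness of the given cover.\<close>
    case 3
    have "E \<inter> D1 \<subseteq> span (insert x Z)" "E \<inter> D2 \<subseteq> span (insert y Z)" using 3 m1 m2 by blast+
    moreover have "span (insert x Z) \<subseteq> W2" "span (insert y Z) \<subseteq> W2"
      using xyU sub by (intro span_minimal; blast)+
    ultimately have "E \<subseteq> W2" using D(6) W by blast
    then show thesis using W by blast
  qed
qed

lemma full_cover:
  assumes odd: "odd CARD('f)" and two: "CARD('f) > 2" and cl: "clean E" and fin: "finite E"
    and cov: "cover E W1 W2"
  shows "\<exists>W1 W2. cover E W1 W2 \<and> (\<forall>z\<in>W1 \<inter> W2. z \<noteq> 0 \<longrightarrow> pt E {0} z)"
  using cov
proof (induction "card (E \<inter> (W1 \<inter> W2))" arbitrary: W1 W2 rule: less_induct)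
  case less
  note cov = less.prems
  note W = cov[unfolded cover_def]
  let ?U = "W1 \<inter> W2"
  have sub: "subspace W1" "subspace W2" using W by (metis subspace_span)+
  then have sU: "subspace ?U" by (rule subspace_inter)
  have clU: "clean (E \<inter> ?U)" using clean_restrict[OF cl sU] .
  show ?case
  proof (cases "\<exists>x\<in>E \<inter> ?U. \<exists>y\<in>E \<inter> ?U. nonadj (E \<inter> ?U) {0} x y")
    case False
    have "pt E {0} z" if z: "z \<in> ?U" "z \<noteq> 0" for z
    proof -
      have "z \<in> span (E \<inter> ?U)" using W z(1) by blast
      from full_if_all_adjacent[OF clU _ this z(2)] False
      have "pt (E \<inter> ?U) {0} z" by blast
      then show ?thesis unfolding pt_def by blast
    qed
    then show ?thesis using cov by blast
  next
    case True
    then obtain x y where x: "x \<in> E \<inter> ?U" and y: "y \<in> E \<inter> ?U" and non: "nonadj (E \<inter> ?U) {0} x y" by blast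
    have "nonadj (E \<inter> ?U) (span {}) x y" using non by simp
    \<comment> \<open>Applied inside the intersection, this makes \<open>?U\<close> the span of
      \<open>x\<close>, \<open>y\<close> and \<open>Z\<close>, the shape that
      \<open>not_linked_on_both_sides\<close> and \<open>smaller_cover\<close> require.\<close>
    from clean_separate[OF odd clU _ _ this] fin obtain Z where Z: "Z \<subseteq> E \<inter> ?U"
      "nonadj (E \<inter> ?U) (span Z) x y" "E \<inter> ?U \<subseteq> span (insert x Z) \<union> span (insert y Z)"
      by (metis empty_subsetI finite_Int)
    have ZU: "span Z \<subseteq> ?U" by (rule span_minimal) (use Z sU in auto)
    have nonE: "nonadj E (span Z) x y"
      using Z(2) nonadj_restrict[OF sU subspace_span ZU] x y by blast
    have ind: "indep2 (span Z) x y" using nonadj_indep2[OF subspace_span nonE] .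
    have Ueq: "?U = span (insert x (insert y Z))"
    proof
      have "span (insert x Z) \<union> span (insert y Z) \<subseteq> span (insert x (insert y Z))"
        by (intro Un_least span_mono) auto
      then have "span (E \<inter> ?U) \<subseteq> span (insert x (insert y Z))"
        using Z(3) by (intro span_minimal) auto
      then show "?U \<subseteq> span (insert x (insert y Z))" using W by blast
      show "span (insert x (insert y Z)) \<subseteq> ?U" by (rule span_minimal) (use x y Z sU in auto)
    qed
    have ZE: "Z \<subseteq> E" "x \<in> E" "y \<in> E" using Z x y by auto
    have "\<not> (linked (E \<inter> W1) Z x y \<and> linked (E \<inter> W2) Z x y)"
      using not_linked_on_both_sides[OF two cl fin _ _ _ Ueq ZE(1) nonE] W by blast
    moreover have "linked (E \<inter> W1) Z x y \<or> separated (E \<inter> W1) Z x y"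
      "linked (E \<inter> W2) Z x y \<or> separated (E \<inter> W2) Z x y"
      using linked_or_separated[OF _ _ _ _ ind] fin x y Z by auto
    ultimately consider "separated (E \<inter> W1) Z x y" | "separated (E \<inter> W2) Z x y" by blast
    then obtain F1 F2 where F: "cover E F1 F2" "E \<inter> (F1 \<inter> F2) \<subset> E \<inter> ?U"
    proof cases
      case 1
      then show ?thesis using smaller_cover[OF cov Ueq ZE ind] that by metis
    next
      case 2
      have "W2 \<inter> W1 = span (insert x (insert y Z))" using Ueq by blast
      from smaller_cover[OF cover_sym[OF cov] this ZE ind 2] show ?thesis using that
        by (metis Int_commute)
    qed
    have "card (E \<inter> (F1 \<inter> F2)) < card (E \<inter> ?U)" using F(2) fin by (intro psubset_card_mono) auto
    from less.hyps[OF this F(1)] show ?thesis .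
  qed
qed

theorem clean_decomposition:
  assumes odd: "odd CARD('f)" and two: "CARD('f) > 2" and cl: "clean E" and fin: "finite E"
  shows "(\<forall>z\<in>span E. z \<noteq> 0 \<longrightarrow> pt E {0} z) \<or>
    (\<exists>W1 W2. cover E W1 W2 \<and> (\<forall>z\<in>W1 \<inter> W2. z \<noteq> 0 \<longrightarrow> pt E {0} z))"
proof (cases "\<exists>x\<in>E. \<exists>y\<in>E. nonadj E {0} x y")
  case False
  then show ?thesis using full_if_all_adjacent[OF cl] by blast
next
  case True
  then obtain x y where x: "x \<in> E" and y: "y \<in> E" and "nonadj E (span {}) x y" by auto
  from clean_separate[OF odd cl fin _ this(3)] obtain X where X: "X \<subseteq> E" "nonadj E (span X) x y"
    "E \<subseteq> span (insert x X) \<union> span (insert y X)" by (metis empty_subsetI)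
  note ind = nonadj_indep2[OF subspace_span X(2)]
  let ?W1 = "span (insert x X)" and ?W2 = "span (insert y X)"
  have "x \<notin> ?W2" "y \<notin> ?W1"
    using span_insert_Int[OF ind] indep2_notin[OF ind] span_base[of x "insert x X"] span_base[of y "insert y X"] by blast+
  then have "cover E ?W1 ?W2" unfolding cover_def
    using X x y span_insert_Int[OF ind] span_Int_span[of "insert x X" E] span_Int_span[of "insert y X" E]
      span_Int_span[of X E] by auto
  then show ?thesis using full_cover[OF odd two cl fin] by blast
qed

end

section \<open>Minimal configurations that are not clean\<close>

context finite_field_space
begin

section \<open>Independent pairs modulo a subspace\<close>

lemma indep2_transform:
  assumes A: "subspace A" and ind: "indep2 A u v"
    and x: "x - (p *s u + q *s v) \<in> A" and y: "y - (r *s u + s *s v) \<in> A" and det: "p * s - q * r \<noteq> 0"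
  shows "indep2 A x y"
  unfolding indep2_def
proof (intro allI impI)
  fix l m assume h: "l *s x + m *s y \<in> A"
  have "(l * p + m * r) *s u + (l * q + m * s) *s v \<in> A"
    by (rule lin3[OF A h x y, of _ 1 "- l" "- m"]) (simp add: algebra_simps)
  then have e: "l * p + m * r = 0" "l * q + m * s = 0" using ind unfolding indep2_def by blast+
  have "l * (p * s - q * r) = s * (l * p + m * r) - r * (l * q + m * s)" by (simp add: algebra_simps)
  moreover have "m * (p * s - q * r) = p * (l * q + m * s) - q * (l * p + m * r)" by (simp add: algebra_simps)
  ultimately show "l = 0 \<and> m = 0" using e det by simp
qed

lemma indep2_scale_left:
  assumes A: "subspace A" and ind: "indep2 A u v" and x: "x - k *s u \<in> A" and k: "k \<noteq> 0"
  shows "indep2 A x v"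
  by (rule indep2_transform[OF A ind, of _ k 0 _ 0 1]) (use x k A in \<open>simp_all add: subspace_0\<close>)

lemma not_indep2_multiple:
  assumes A: "subspace A" and nind: "\<not> indep2 A u v" and uv: "u \<notin> A" "v \<notin> A"
  obtains k where "k \<noteq> 0" "v - k *s u \<in> A"
proof -
  from nind obtain s t where st: "s *s u + t *s v \<in> A" "s \<noteq> 0 \<or> t \<noteq> 0" unfolding indep2_def by blast
  have t: "t \<noteq> 0" using st uv scale_mem_iff[OF A, of s u] by auto
  have s: "s \<noteq> 0" using st uv scale_mem_iff[OF A, of t v] by auto
  have "v - (- s / t) *s u \<in> A"
    by (rule lin1[OF A st(1), of _ "1 / t"]) (use t in \<open>simp add: algebra_simps\<close>)
  then show ?thesis using that[of "- s / t"] s t by simp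
qed

lemma not_indep2_trans:
  assumes A: "subspace A" and nind: "\<not> indep2 A u v" and u: "u \<notin> A" and ind: "indep2 A v w"
  shows "indep2 A u w"
proof -
  have v: "v \<notin> A" using indep2_notin[OF ind] by blast
  have "\<not> indep2 A v u" using nind indep2_commute by blast
  then obtain k where "k \<noteq> 0" "u - k *s v \<in> A" using not_indep2_multiple[OF A _ v u] by blast
  then show ?thesis using indep2_scale_left[OF A ind] by blast
qed

text \<open>Cramer's rule: modulo \<open>span Y\<close> the vectors \<open>x\<close> and
  \<open>y\<close> are combinations of \<open>a\<close> and \<open>b\<close> with nonzero
  determinant, so \<open>a\<close> and \<open>b\<close> can be solved for.\<close>

lemma indep2_span_transfer:
  assumes ind: "indep2 (span Y) a b" and E: "E \<subseteq> span (insert a (insert b Y))"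
    and x: "x \<in> E" and y: "y \<in> E" and xy: "indep2 (span Y) x y"
  shows "E \<subseteq> span (insert x (insert y Y))"
proof -
  let ?A = "span Y"
  from E x y in_span_insert2 obtain p q r s where
    p: "x - (p *s a + q *s b) \<in> ?A" and r: "y - (r *s a + s *s b) \<in> ?A" by (meson subsetD)
  have det: "p * s - q * r \<noteq> 0"
  proof
    assume d: "p * s - q * r = 0"
    have "s *s x + (- q) *s y \<in> ?A"
      by (rule lin2[OF subspace_span p r, of _ s "- q"])
        (use d in \<open>simp add: algebra_simps flip: scale_left_diff_distrib\<close>)
    then have "s = 0" "- q = 0" using xy unfolding indep2_def by blast+
    then have s0: "s = 0" "q = 0" by simp_all
    have "r *s x + (- p) *s y \<in> ?A"
      by (rule lin2[OF subspace_span p r, of _ r "- p"]) (simp add: s0 algebra_simps)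
    then have "r = 0" using xy unfolding indep2_def by blast
    then show False using r s0 indep2_notin[OF xy] by simp
  qed
  let ?D = "p * s - q * r"
  let ?T = "span (insert x (insert y Y))"
  have AT: "?A \<subseteq> ?T" by (rule span_mono) blast
  have xyT: "x \<in> ?T" "y \<in> ?T" by (auto intro: span_base)
  have "s *s (x - (p *s a + q *s b)) + (- q) *s (y - (r *s a + s *s b)) = s *s x - q *s y - ?D *s a"
    by (simp add: algebra_simps)
  moreover have "s *s (x - (p *s a + q *s b)) + (- q) *s (y - (r *s a + s *s b)) \<in> ?T"
    using AT p r by (intro span_add span_scale) auto
  ultimately have "s *s x - q *s y - ?D *s a \<in> ?T" by simp
  then have "?D *s a \<in> ?T"
    by (rule lin3[OF subspace_span _ xyT, of _ _ "-1" s "- q"]) (simp add: algebra_simps)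
  then have aT: "a \<in> ?T" using det scale_mem_iff[OF subspace_span] by blast
  have "(- r) *s (x - (p *s a + q *s b)) + p *s (y - (r *s a + s *s b)) = p *s y - r *s x - ?D *s b"
    by (simp add: algebra_simps)
  moreover have "(- r) *s (x - (p *s a + q *s b)) + p *s (y - (r *s a + s *s b)) \<in> ?T"
    using AT p r by (intro span_add span_scale) auto
  ultimately have "p *s y - r *s x - ?D *s b \<in> ?T" by simp
  then have "?D *s b \<in> ?T"
    by (rule lin3[OF subspace_span _ xyT, of _ _ "-1" "- r" p]) (simp add: algebra_simps)
  then have "b \<in> ?T" using det scale_mem_iff[OF subspace_span] by blast
  then have "span (insert a (insert b Y)) \<subseteq> ?T" using aT xyT AT span_superset[of Y] by (intro span_minimal) auto
  then show ?thesis using E by blast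
qed

lemma minimal_spanning_subset:
  assumes "finite Y" "v \<in> span Y"
  obtains S where "S \<subseteq> Y" "v \<in> span S" "\<And>y. y \<in> S \<Longrightarrow> v \<notin> span (S - {y})"
proof -
  let ?F = "{S. S \<subseteq> Y \<and> v \<in> span S}"
  have "finite ?F" using assms(1) by simp
  moreover have "Y \<in> ?F" using assms(2) by simp
  ultimately have "\<exists>S\<in>?F. S \<subseteq> Y \<and> (\<forall>T\<in>?F. T \<subseteq> S \<longrightarrow> S = T)" by (rule finite_has_minimal2)
  then obtain S where S: "S \<in> ?F" "\<forall>T\<in>?F. T \<subseteq> S \<longrightarrow> S = T" by blast
  have "v \<notin> span (S - {y})" if "y \<in> S" for y
    using S(1) S(2)[rule_format, of "S - {y}"] that by blast
  then show ?thesis using that S(1) by blast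
qed

lemma minimal_span_coeff:
  assumes "v \<in> span S" "y \<in> S" "v \<notin> span (S - {y})"
  obtains k where "k \<noteq> 0" "v - k *s y \<in> span (S - {y})"
proof -
  have "v \<in> span (insert y (S - {y}))" using assms by (simp add: insert_absorb)
  then obtain k where k: "v - k *s y \<in> span (S - {y})" using span_breakdown_eq by blast
  have "k \<noteq> 0" using k assms(3) by auto
  then show ?thesis using that k by blast
qed

text \<open>The line of \<open>a\<close> and \<open>b\<close> has \<open>q + 1\<close> points.
  Elements of \<open>Y\<close> represent none of them, so the at most \<open>q\<close> remaining
  elements leave one out.\<close>

lemma missing_point:
  assumes fin: "finite E" and card: "card (E - Y) \<le> CARD('f)" and ab: "a \<in> E" "b \<in> E" "indep2 (span Y) a b"
  shows "\<exists>z\<in>span E. z \<notin> span Y \<and> \<not> pt E (span Y) z"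
proof (rule ccontr)
  let ?A = "span Y"
  assume no: "\<not> ?thesis"
  \<comment> \<open>The projective line is the field with a point \<open>None\<close> at infinity;
    \<open>'f option\<close> has \<open>q + 1\<close> elements.\<close>
  define dir where "dir k = (case k of None \<Rightarrow> b | Some c \<Rightarrow> a + c *s b)" for k
  have dir: "dir k \<in> span E" "dir k \<notin> ?A" for k
    using ab indep2_notin[OF ab(3)] by (auto simp: dir_def span_base span_add span_scale split: option.split)
  then have "\<forall>k. \<exists>e\<in>E. e \<notin> ?A \<and> (\<exists>m. m \<noteq> 0 \<and> dir k - m *s e \<in> ?A)"
    using no ptE[OF _ subspace_span] by metis
  then obtain f m where f: "\<And>k. f k \<in> E" "\<And>k. f k \<notin> ?A" "\<And>k. m k \<noteq> 0" "\<And>k. dir k - m k *s f k \<in> ?A"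
    by metis
  have distinct: "k = l" if "dir k - c *s dir l \<in> ?A" for k l c
  proof (cases k)
    case None
    show ?thesis
    proof (cases l)
      case (Some y)
      then have "(- c) *s a + (1 - c * y) *s b \<in> ?A" using that None by (simp add: dir_def algebra_simps)
      then have "- c = 0" "1 - c * y = 0" using ab(3) unfolding indep2_def by blast+
      then show ?thesis by simp
    qed (simp add: None)
  next
    case (Some x)
    show ?thesis
    proof (cases l)
      case None
      then have "1 *s a + (x - c) *s b \<in> ?A" using that Some by (simp add: dir_def algebra_simps)
      then show ?thesis using ab(3) unfolding indep2_def by (metis zero_neq_one)
    next
      fix y assume l: "l = Some y"
      then have "(1 - c) *s a + (x - c * y) *s b \<in> ?A" using that Some by (simp add: dir_def algebra_simps)
      then have "1 - c = 0" "x - c * y = 0" using ab(3) unfolding indep2_def by blast+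
      then show ?thesis using l Some by simp
    qed
  qed
  have "inj f"
  proof (rule injI)
    fix k l assume eq: "f k = f l"
    have "dir k - (m k / m l) *s dir l \<in> ?A"
      by (rule lin2[OF subspace_span f(4)[of k] f(4)[of l], of _ 1 "- (m k / m l)"])
        (use f(3)[of l] eq in \<open>simp add: algebra_simps\<close>)
    then show "k = l" by (rule distinct)
  qed
  moreover have "range f \<subseteq> E - Y" using f span_superset[of Y] by blast
  ultimately have "CARD('f option) \<le> card (E - Y)" using fin by (intro card_inj_on_le) auto
  then show False using card by (simp add: card_UNIV_option)
qed

text \<open>\<open>Y\<close> is a basis of a flat of corank two whose contraction is a line with at least three but not all
  points.\<close>

definition bad :: "'v set \<Rightarrow> 'v set \<Rightarrow> bool" where
  "bad E Y \<longleftrightarrow> Y \<subseteq> E \<and> independent Y \<and>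
     (\<exists>a\<in>E. \<exists>b\<in>E. \<exists>c\<in>E. indep2 (span Y) a b \<and> indep2 (span Y) a c \<and> indep2 (span Y) b c \<and>
        E \<subseteq> span (insert a (insert b Y))) \<and>
     (\<exists>z\<in>span E. z \<notin> span Y \<and> \<not> pt E (span Y) z)"

context
  fixes E :: "'v set"
  assumes fin: "finite E"
    and simple: "\<And>x y. x \<in> E \<Longrightarrow> y \<in> E \<Longrightarrow> independent {x, y}"
    and minimal: "\<And>W. subspace W \<Longrightarrow> \<not> E \<subseteq> W \<Longrightarrow> clean (E \<inter> W)"
begin

lemma simple_notin: assumes "x \<in> E" "y \<in> E" "x \<noteq> y" shows "x \<notin> span {y}"
  using simple[OF assms(1,2)] assms(3) by (simp add: independent_insert)

text \<open>A failure of cleanness modulo \<open>span X\<close> takes place in the flat spanned by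
  \<open>X\<close> and two elements, and minimality forces this flat to be all of \<open>E\<close>.
  Replacing \<open>X\<close> by a basis changes no span.\<close>

lemma bad_exists: assumes "\<not> clean E" shows "\<exists>Y. bad E Y"
proof -
  from assms obtain X u v d where X: "X \<subseteq> E" and p: "pt E (span X) u" "pt E (span X) v" "pt E (span X) (u + v)"
    and out: "u + d *s v \<notin> span X" and np: "\<not> pt E (span X) (u + d *s v)" unfolding clean_def by blast
  obtain Y where Y: "Y \<subseteq> X" "independent Y" "X \<subseteq> span Y" using maximal_independent_subset by blast
  have YX: "span Y = span X" using Y span_mono[OF Y(1)] span_minimal[OF Y(3) subspace_span] by blast
  let ?A = "span X"
  have sA: "subspace ?A" by simp
  have uv: "indep2 ?A u v"
  proof (rule ccontr)
    assume n: "\<not> indep2 ?A u v"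
    then have "\<not> indep2 ?A v u" using indep2_commute by blast
    then obtain k where k: "k \<noteq> 0" "u - k *s v \<in> ?A"
      using not_indep2_multiple[OF sA _ pt_notin[OF p(2)] pt_notin[OF p(1)]] by blast
    have d': "(k + d) *s v - (u + d *s v) \<in> ?A"
      by (rule lin1[OF sA k(2), of _ "-1"]) (simp add: algebra_simps)
    have "k + d \<noteq> 0" using d' out diff_mem_cong[OF sA d'] by (auto simp: span_zero)
    then have "pt E ?A ((k + d) *s v)" using p(2) by (intro pt_scale) auto
    then show False using pt_cong[OF sA _ d'] np by blast
  qed
  obtain a \<alpha> where a: "a \<in> E" "\<alpha> \<noteq> 0" "u - \<alpha> *s a \<in> ?A" using ptE[OF p(1) sA] by metis
  obtain b \<beta> where b: "b \<in> E" "\<beta> \<noteq> 0" "v - \<beta> *s b \<in> ?A" using ptE[OF p(2) sA] by metis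
  obtain c \<gamma> where c: "c \<in> E" "\<gamma> \<noteq> 0" "u + v - \<gamma> *s c \<in> ?A" using ptE[OF p(3) sA] by metis
  have a': "a - ((1 / \<alpha>) *s u + 0 *s v) \<in> ?A"
    by (rule lin1[OF sA a(3), of _ "- 1 / \<alpha>"]) (use a in \<open>simp add: algebra_simps\<close>)
  have b': "b - (0 *s u + (1 / \<beta>) *s v) \<in> ?A"
    by (rule lin1[OF sA b(3), of _ "- 1 / \<beta>"]) (use b in \<open>simp add: algebra_simps\<close>)
  have c': "c - ((1 / \<gamma>) *s u + (1 / \<gamma>) *s v) \<in> ?A"
    by (rule lin1[OF sA c(3), of _ "- 1 / \<gamma>"]) (use c in \<open>simp add: algebra_simps\<close>)
  have ab: "indep2 ?A a b" by (rule indep2_transform[OF sA uv a' b']) (use a b in simp)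
  have ac: "indep2 ?A a c" by (rule indep2_transform[OF sA uv a' c']) (use a c in simp)
  have bc: "indep2 ?A b c" by (rule indep2_transform[OF sA uv b' c']) (use b c in simp)
  let ?W = "span (insert a (insert b X))"
  have abW: "a \<in> ?W" "b \<in> ?W" by (auto intro: span_base)
  have AW: "?A \<subseteq> ?W" by (rule span_mono) blast
  have uW: "u \<in> ?W"
    by (rule lin2[OF subspace_span abW(1) subsetD[OF AW a(3)], of _ \<alpha> 1]) simp
  have vW: "v \<in> ?W"
    by (rule lin2[OF subspace_span abW(2) subsetD[OF AW b(3)], of _ \<beta> 1]) simp
  have zW: "u + d *s v \<in> ?W" "u + v \<in> ?W" using uW vW by (auto intro: span_add span_scale)
  have EW: "E \<subseteq> ?W"
  proof (rule ccontr)
    assume "\<not> E \<subseteq> ?W"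
    then have cl: "clean (E \<inter> ?W)" by (intro minimal) auto
    have "X \<subseteq> ?W" using AW span_superset by blast
    note r = pt_restrict[OF subspace_span sA AW]
    have "pt (E \<inter> ?W) ?A (u + d *s v)"
      using cl[unfolded clean_def, rule_format, of X u v d] X \<open>X \<subseteq> ?W\<close> p r uW vW zW out by simp
    then show False using np r zW by simp
  qed
  have "a \<in> span E" "b \<in> span E" using a b by (auto intro: span_base)
  then have "span (insert a (insert b X)) \<subseteq> span E" using a b X by (intro span_mono) auto
  then have "u + d *s v \<in> span E" using zW by blast
  moreover have "span (insert a (insert b Y)) = ?W" by (metis YX span_insert)
  ultimately have "bad E Y" unfolding bad_def YX
    using Y X a(1) b(1) c(1) ab ac bc EW out np by blast
  then show ?thesis by blast
qed

context
  fixes Y :: "'v set"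
  assumes bad: "bad E Y"
begin

lemma bad_sub: "Y \<subseteq> E" and bad_indep: "independent Y"
  using bad unfolding bad_def by auto

lemma bad_finite: "finite Y"
  using bad_sub fin finite_subset by blast

lemma bad_span: "a \<in> E \<Longrightarrow> b \<in> E \<Longrightarrow> indep2 (span Y) a b \<Longrightarrow> E \<subseteq> span (insert a (insert b Y))"
  using bad indep2_span_transfer unfolding bad_def by meson

lemma bad_delete_notin: "y \<in> Y \<Longrightarrow> y \<notin> span (Y - {y})"
  using bad_indep unfolding dependent_def by blast

text \<open>If a relation between three pairwise non-parallel elements used only a proper part of \<open>Y\<close>,
  it would live in a proper flat, where lines are either trivial or full.\<close>

lemma bad_relation:
  assumes abc: "a \<in> E" "b \<in> E" "c \<in> E" "indep2 (span Y) a b" "indep2 (span Y) a c" "indep2 (span Y) b c"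
    and rel: "\<alpha> *s a + \<beta> *s b + \<gamma> *s c \<in> span Y'" "\<gamma> \<noteq> 0"
    and Y': "Y' \<subseteq> E" "span Y' \<subseteq> span Y"
  shows "span Y' = span Y"
proof (rule ccontr)
  let ?A = "span Y" and ?A' = "span Y'"
  assume "?A' \<noteq> ?A"
  then have "\<not> Y \<subseteq> ?A'" using Y'(2) span_minimal[OF _ subspace_span] by blast
  then obtain y where y: "y \<in> Y" "y \<notin> ?A'" by blast
  have rel': "\<alpha> *s a + \<beta> *s b + \<gamma> *s c \<in> ?A" using rel Y' by blast
  have al: "\<alpha> \<noteq> 0" using rel' rel(2) abc(6) unfolding indep2_def by auto
  have be: "\<beta> \<noteq> 0" using rel' rel(2) abc(5) unfolding indep2_def by auto
  let ?W = "span (insert a (insert b Y'))"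
  \<comment> \<open>Since \<open>a\<close> and \<open>b\<close> are independent modulo
    \<open>?A\<close>, adding them to \<open>Y'\<close> does not recover \<open>y\<close>. So
    \<open>?W\<close> is proper and clean, its line of \<open>a\<close> and \<open>b\<close> is full
    modulo \<open>?A'\<close>, and the missing point \<open>z\<close> would be present.\<close>
  have "y \<notin> ?W"
  proof
    assume "y \<in> ?W"
    then obtain s t where st: "y - (s *s a + t *s b) \<in> ?A'" using in_span_insert2 by blast
    have yA: "y \<in> ?A" using y span_base by blast
    have "s *s a + t *s b \<in> ?A"
      by (rule lin2[OF subspace_span yA subsetD[OF Y'(2) st], of _ 1 "-1"]) simp
    then have "s = 0" "t = 0" using abc(4) unfolding indep2_def by blast+
    then show False using st y by simp
  qed
  then have "\<not> E \<subseteq> ?W" using y bad_sub by blast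
  then have cl: "clean (E \<inter> ?W)" by (intro minimal) auto
  have abW: "a \<in> ?W" "b \<in> ?W" by (auto intro: span_base)
  have AW: "?A' \<subseteq> ?W" by (rule span_mono) blast
  have c_eq: "c - ((- \<alpha> / \<gamma>) *s a + (- \<beta> / \<gamma>) *s b) \<in> ?A'"
    by (rule lin1[OF subspace_span rel(1), of _ "1 / \<gamma>"]) (use rel in \<open>simp add: algebra_simps\<close>)
  then have cW: "c \<in> ?W" using in_span_insert2 by blast
  have nin: "a \<notin> ?A" "b \<notin> ?A" "c \<notin> ?A" using indep2_notin[OF abc(4)] indep2_notin[OF abc(5)] by auto
  then have nin': "a \<notin> ?A'" "b \<notin> ?A'" "c \<notin> ?A'" using Y' by auto
  have pts: "pt (E \<inter> ?W) ?A' a" "pt (E \<inter> ?W) ?A' b" "pt (E \<inter> ?W) ?A' c"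
    using abc abW cW nin' by (auto intro: pt_mem)
  have pc: "pt (E \<inter> ?W) ?A' ((- \<alpha> / \<gamma>) *s a + (- \<beta> / \<gamma>) *s b)"
    using pt_cong[OF subspace_span pts(3) c_eq] .
  have Y'W: "Y' \<subseteq> E \<inter> ?W" using Y' AW span_superset by blast
  from bad obtain z where z: "z \<in> span E" "z \<notin> ?A" "\<not> pt E ?A z" unfolding bad_def by blast
  have "z \<in> span (insert a (insert b Y))"
    using z(1) span_minimal[OF bad_span[OF abc(1,2,4)] subspace_span] by blast
  then obtain s t where st: "z - (s *s a + t *s b) \<in> ?A" using in_span_insert2 by blast
  then have out: "s *s a + t *s b \<notin> ?A" using z diff_mem_cong[OF subspace_span st] by blast
  then have "s *s a + t *s b \<notin> ?A'" using Y' by blast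
  from clean_line[OF cl Y'W pts(1,2) pc _ _ this] al be rel
  have "pt (E \<inter> ?W) ?A' (s *s a + t *s b)" by simp
  then have "pt E ?A (s *s a + t *s b)" using pt_mono[OF _ Y'(2) out] by blast
  moreover have "(s *s a + t *s b) - z \<in> ?A"
    by (rule lin1[OF subspace_span st, of _ "-1"]) simp
  ultimately show False using pt_cong[OF subspace_span] z by blast
qed

lemma bad_triple: assumes "a \<in> E" "a \<notin> span Y"
  obtains b c \<alpha> \<beta> \<gamma> where "b \<in> E" "c \<in> E" "indep2 (span Y) a b" "indep2 (span Y) a c" "indep2 (span Y) b c"
    "\<alpha> *s a + \<beta> *s b + \<gamma> *s c \<in> span Y" "\<alpha> \<noteq> 0" "\<beta> \<noteq> 0" "\<gamma> \<noteq> 0"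
proof -
  let ?A = "span Y"
  from bad obtain a0 b0 c0 where t: "a0 \<in> E" "b0 \<in> E" "c0 \<in> E"
    "indep2 ?A a0 b0" "indep2 ?A a0 c0" "indep2 ?A b0 c0" unfolding bad_def by blast
  note tr = not_indep2_trans[OF subspace_span _ assms(2)]
  obtain b c where bc: "b \<in> E" "c \<in> E" "indep2 ?A a b" "indep2 ?A a c" "indep2 ?A b c"
  proof (cases "indep2 ?A a b0")
    case True
    show ?thesis
    proof (cases "indep2 ?A a c0")
      case False
      then have "indep2 ?A a a0" using tr t(5) indep2_commute by blast
      then show ?thesis using that[of a0 b0] t True by blast
    qed (use that[of b0 c0] t True in blast)
  next
    case False
    then have "indep2 ?A a a0" "indep2 ?A a c0" using tr t(4,6) indep2_commute by blast+
    then show ?thesis using that[of a0 c0] t by blast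
  qed
  from bad_span[OF assms(1) bc(1,3)] bc(2) obtain p q where pq: "c - (p *s a + q *s b) \<in> ?A"
    using in_span_insert2 by blast
  have rel: "(- p) *s a + (- q) *s b + 1 *s c \<in> ?A" using pq by (simp add: algebra_simps)
  have "p \<noteq> 0"
  proof
    assume "p = 0"
    then have "(- q) *s b + 1 *s c \<in> ?A" using rel by simp
    then show False using bc(5) unfolding indep2_def by (metis zero_neq_one)
  qed
  moreover have "q \<noteq> 0"
  proof
    assume "q = 0"
    then have "(- p) *s a + 1 *s c \<in> ?A" using rel by simp
    then show False using bc(4) unfolding indep2_def by (metis zero_neq_one)
  qed
  ultimately show ?thesis using that[OF bc rel] by simp
qed

lemma bad_outside: "\<exists>a\<in>E. a \<notin> span Y"
  using bad indep2_notin unfolding bad_def by meson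

text \<open>A further element \<open>y0\<close> of the flat would be the third point of the line of
  \<open>y1\<close> and \<open>y2\<close> once the rest of \<open>Y\<close> is contracted, and this
  line is full because \<open>span Y\<close> is a proper flat. An element \<open>e\<close> on it
  then carries the relation between \<open>a\<close>, \<open>b\<close> and \<open>c\<close>, which
  so lives over a set smaller than \<open>Y\<close>, against \<open>bad_relation\<close>.\<close>

lemma bad_flat: "E \<inter> span Y = Y"
proof (rule ccontr)
  let ?A = "span Y"
  assume "E \<inter> ?A \<noteq> Y"
  then obtain y0 where y0: "y0 \<in> E" "y0 \<in> ?A" "y0 \<notin> Y" using bad_sub span_superset[of Y] by blast
  obtain S where S: "S \<subseteq> Y" "y0 \<in> span S" "\<And>y. y \<in> S \<Longrightarrow> y0 \<notin> span (S - {y})"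
    using minimal_spanning_subset[OF bad_finite y0(2)] by blast
  have "y0 \<noteq> 0" using simple[OF y0(1) y0(1)] by simp
  then have "S \<noteq> {}" using S(2) by auto
  then obtain y1 where y1: "y1 \<in> S" by blast
  have "S \<noteq> {y1}"
  proof
    assume "S = {y1}"
    then show False using S y0 y1 bad_sub simple_notin[of y0 y1] by blast
  qed
  then obtain y2 where y2: "y2 \<in> S" "y2 \<noteq> y1" using y1 by blast
  obtain k where k: "k \<noteq> 0" "y0 - k *s y1 \<in> span (S - {y1})"
    using minimal_span_coeff[OF S(2) y1 S(3)[OF y1]] .
  have "S - {y1} = insert y2 (S - {y1, y2})" using y2 by blast
  then obtain l where l: "y0 - k *s y1 - l *s y2 \<in> span (S - {y1, y2})" using k(2) span_breakdown_eq by metis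
  have l0: "l \<noteq> 0"
  proof
    assume l0: "l = 0"
    have "span (S - {y1, y2}) \<subseteq> span (S - {y2})" by (rule span_mono) blast
    moreover have "y1 \<in> span (S - {y2})" using y1 y2 by (auto intro: span_base)
    ultimately have "y0 \<in> span (S - {y2})" using l
      by (intro lin2[OF subspace_span, of y1 "S - {y2}" "y0 - k *s y1" y0 k 1]) (auto simp: l0)
    then show False using S(3) y2 by blast
  qed
  let ?Y'' = "Y - {y1, y2}"
  let ?B = "span ?Y''"
  have yY: "y1 \<in> Y" "y2 \<in> Y" using S y1 y2 by auto
  have lB: "(k *s y1 + l *s y2) - y0 \<in> ?B"
  proof -
    have "span (S - {y1, y2}) \<subseteq> ?B" by (rule span_mono) (use S in blast)
    then have "y0 - k *s y1 - l *s y2 \<in> ?B" using l by blast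
    then show ?thesis by (rule lin1[OF subspace_span, of _ _ _ "-1"]) (simp add: algebra_simps)
  qed
  have ins: "insert y1 (insert y2 ?Y'') = Y" using yY by blast
  have BA: "?B \<subseteq> ?A" by (rule span_mono) blast
  have y1B: "y1 \<notin> ?B"
    using bad_delete_notin[OF yY(1)] span_mono[of ?Y'' "Y - {y1}"] by blast
  have ind: "indep2 ?B y1 y2"
  proof (rule indep2I[OF subspace_span])
    show "y2 \<notin> ?B" using bad_delete_notin[OF yY(2)] span_mono[of ?Y'' "Y - {y2}"] by blast
    show "y1 + b *s y2 \<notin> ?B" for b
    proof
      assume h: "y1 + b *s y2 \<in> ?B"
      have "span ?Y'' \<subseteq> span (Y - {y1})" by (rule span_mono) blast
      moreover have "y2 \<in> span (Y - {y1})" using yY y2 by (auto intro: span_base)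
      ultimately have "y1 + b *s y2 \<in> span (Y - {y1})" "y2 \<in> span (Y - {y1})" using h by blast+
      then have "y1 \<in> span (Y - {y1})" by (rule lin2[OF subspace_span, of _ _ _ _ 1 "- b"]) simp
      then show False using bad_delete_notin[OF yY(1)] by blast
    qed
  qed
  obtain a where a: "a \<in> E" "a \<notin> ?A" using bad_outside by blast
  obtain b c \<alpha> \<beta> \<gamma> where t: "b \<in> E" "c \<in> E" "indep2 ?A a b" "indep2 ?A a c" "indep2 ?A b c"
    "\<alpha> *s a + \<beta> *s b + \<gamma> *s c \<in> ?A" "\<alpha> \<noteq> 0" "\<beta> \<noteq> 0" "\<gamma> \<noteq> 0" using bad_triple[OF a] .
  let ?w = "\<alpha> *s a + \<beta> *s b + \<gamma> *s c"
  have cl: "clean (E \<inter> ?A)" using a by (intro minimal) auto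
  have YE: "?Y'' \<subseteq> E \<inter> ?A" using bad_sub span_superset[of Y] by blast
  have mem: "y1 \<in> E \<inter> ?A" "y2 \<in> E \<inter> ?A" "y0 \<in> E \<inter> ?A" using bad_sub yY y0 span_base by auto
  have p: "pt (E \<inter> ?A) ?B y1" "pt (E \<inter> ?A) ?B y2"
    using mem indep2_notin[OF ind] by (auto intro!: pt_mem)
  have "k *s y1 + l *s y2 \<notin> ?B" using ind k l0 unfolding indep2_def by blast
  moreover have "(k *s y1 + l *s y2) - 1 *s y0 \<in> ?B" using lB by simp
  ultimately have p0: "pt (E \<inter> ?A) ?B (k *s y1 + l *s y2)" using mem(3) unfolding pt_def by blast
  have "?w \<in> span (insert y1 (insert y2 ?Y''))" unfolding ins by (rule t(6))
  then obtain s r where sr: "?w - (s *s y1 + r *s y2) \<in> ?B" using in_span_insert2 by blast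
  show False
  proof (cases "s *s y1 + r *s y2 \<in> ?B")
    case True
    have wB: "?w \<in> ?B"
      by (rule lin2[OF subspace_span sr True, of _ 1 1]) simp
    have "?B = ?A" using bad_relation[OF a(1) t(1-5) wB t(9) _ BA] bad_sub by blast
    then show False using y1B yY span_base by blast
  next
    case False
    from clean_line[OF cl YE p p0 k(1) l0 this] obtain e m where
      e: "e \<in> E \<inter> ?A" "s *s y1 + r *s y2 - m *s e \<in> ?B" unfolding pt_def by blast
    let ?Y' = "insert e ?Y''"
    have "?w - m *s e \<in> ?B"
      by (rule lin2[OF subspace_span sr e(2), of _ 1 1]) simp
    then have w: "?w \<in> span ?Y'" using span_breakdown_eq by blast
    have Y'A: "span ?Y' \<subseteq> ?A" by (rule span_minimal) (use e BA span_superset[of ?Y''] in auto)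
    have "?Y' \<subseteq> E" using e bad_sub by blast
    then have "span ?Y' = ?A" using bad_relation[OF a(1) t(1-5) w t(9) _ Y'A] by blast
    then have "y1 \<in> span ?Y'" "y2 \<in> span ?Y'" using mem by blast+
    then obtain f g where fg: "y1 - f *s e \<in> ?B" "y2 - g *s e \<in> ?B" using span_breakdown_eq by blast
    have "g *s y1 + (- f) *s y2 \<in> ?B"
      by (rule lin2[OF subspace_span fg, of _ g "- f"]) (simp add: algebra_simps)
    then have "- f = 0" using ind unfolding indep2_def by blast
    then show False using fg y1B by simp
  qed
qed

text \<open>If \<open>a\<close> and \<open>a'\<close> were parallel modulo \<open>span Y\<close>,
  contracting all of \<open>Y\<close> except a suitable \<open>y\<close> would make them two points
  of a line through \<open>y\<close>, full because it lies in a proper flat. Some \<open>e\<close>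
  on this line can replace \<open>a\<close> so that \<open>y\<close> cancels from the relation with
  \<open>b\<close> and \<open>c\<close>, against \<open>bad_relation\<close>.\<close>

lemma bad_transversal:
  assumes a: "a \<in> E" "a \<notin> span Y" and a': "a' \<in> E" "a' \<notin> span Y" and ne: "a \<noteq> a'"
  shows "indep2 (span Y) a a'"
proof (rule ccontr)
  let ?A = "span Y"
  assume "\<not> ?thesis"
  then obtain m where m: "m \<noteq> 0" "a' - m *s a \<in> ?A" using not_indep2_multiple a a' by (metis subspace_span)
  let ?h = "a' - m *s a"
  have "?h \<noteq> 0"
  proof
    assume "?h = 0"
    then have "a' \<in> span {a}" by (auto simp: span_singleton)
    then show False using simple_notin[OF a'(1) a(1)] ne by blast
  qed
  obtain S where S: "S \<subseteq> Y" "?h \<in> span S" "\<And>y. y \<in> S \<Longrightarrow> ?h \<notin> span (S - {y})"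
    using minimal_spanning_subset[OF bad_finite m(2)] by blast
  have "S \<noteq> {}" using S(2) \<open>?h \<noteq> 0\<close> by auto
  then obtain y where y: "y \<in> S" by blast
  obtain \<eta> where eta: "\<eta> \<noteq> 0" "?h - \<eta> *s y \<in> span (S - {y})" using minimal_span_coeff[OF S(2) y S(3)[OF y]] .
  let ?Y' = "Y - {y}"
  let ?B = "span ?Y'"
  have yY: "y \<in> Y" using S y by blast
  have "span (S - {y}) \<subseteq> ?B" by (rule span_mono) (use S in blast)
  then have eta': "?h - \<eta> *s y \<in> ?B" using eta by blast
  have BA: "?B \<subseteq> ?A" by (rule span_mono) blast
  have yB: "y \<notin> ?B" using bad_delete_notin[OF yY] .
  obtain b c \<alpha> \<beta> \<gamma> where t: "b \<in> E" "c \<in> E" "indep2 ?A a b" "indep2 ?A a c" "indep2 ?A b c"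
    "\<alpha> *s a + \<beta> *s b + \<gamma> *s c \<in> ?A" "\<alpha> \<noteq> 0" "\<beta> \<noteq> 0" "\<gamma> \<noteq> 0" using bad_triple[OF a] .
  let ?w = "\<alpha> *s a + \<beta> *s b + \<gamma> *s c"
  let ?H = "span (insert a Y)"
  have "b \<notin> ?H"
  proof
    assume "b \<in> ?H"
    then obtain k where "b - k *s a \<in> ?A" using span_breakdown_eq by blast
    then have "(- k) *s a + 1 *s b \<in> ?A" by simp
    then show False using t(3) unfolding indep2_def by (metis zero_neq_one)
  qed
  then have cl: "clean (E \<inter> ?H)" using t(1) by (intro minimal) auto
  have AH: "?A \<subseteq> ?H" by (rule span_mono) blast
  have YE: "?Y' \<subseteq> E \<inter> ?H" using bad_sub span_superset[of "insert a Y"] by blast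
  have aH: "a \<in> ?H" "y \<in> ?H" using yY by (auto intro: span_base)
  have a'H: "a' \<in> ?H" using m(2) span_breakdown_eq by blast
  have nB: "a \<notin> ?B" "a' \<notin> ?B" using a a' BA by auto
  have p: "pt (E \<inter> ?H) ?B a" "pt (E \<inter> ?H) ?B y" "pt (E \<inter> ?H) ?B a'"
    using a aH a' a'H nB yB yY bad_sub by (auto intro!: pt_mem)
  have "a' - (m *s a + \<eta> *s y) \<in> ?B" using eta' by (simp add: algebra_simps)
  from pt_cong[OF subspace_span p(3) this] have p': "pt (E \<inter> ?H) ?B (m *s a + \<eta> *s y)" .
  have "?w \<in> span (insert y ?Y')" using t(6) yY by (simp add: insert_absorb)
  then obtain \<theta> where th: "?w - \<theta> *s y \<in> ?B" using span_breakdown_eq by blast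
  \<comment> \<open>\<open>\<theta>\<close> is the \<open>y\<close> coordinate of the relation
    \<open>?w\<close>; shifting \<open>a\<close> by this multiple of \<open>y\<close> removes
    it.\<close>
  have out: "1 *s a + (- \<theta> / \<alpha>) *s y \<notin> ?A"
  proof
    assume h: "1 *s a + (- \<theta> / \<alpha>) *s y \<in> ?A"
    have yA: "y \<in> ?A" using yY span_base by blast
    have "a \<in> ?A" by (rule lin2[OF subspace_span h yA, of _ 1 "\<theta> / \<alpha>"]) simp
    then show False using a by blast
  qed
  then have "1 *s a + (- \<theta> / \<alpha>) *s y \<notin> ?B" using BA by blast
  from clean_line[OF cl YE p(1,2) p' m(1) eta(1) this]
  obtain e k where e: "e \<in> E" "k \<noteq> 0" "1 *s a + (- \<theta> / \<alpha>) *s y - k *s e \<in> ?B"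
    using ptE[OF _ subspace_span] by (metis IntD1)
  have rel: "(\<alpha> * k) *s e + \<beta> *s b + \<gamma> *s c \<in> ?B"
    by (rule lin2[OF subspace_span th e(3), of _ 1 "- \<alpha>"]) (use t in \<open>simp add: algebra_simps\<close>)
  have yA: "y \<in> ?A" using yY span_base by blast
  have ea: "e - (1 / k) *s a \<in> ?A"
    by (rule lin2[OF subspace_span subsetD[OF BA e(3)] yA, of _ "- 1 / k" "- \<theta> / (\<alpha> * k)"])
      (use e t in \<open>simp add: algebra_simps\<close>)
  have "indep2 ?A e b" "indep2 ?A e c"
    using indep2_scale_left[OF subspace_span t(3) ea] indep2_scale_left[OF subspace_span t(4) ea] e by auto
  from bad_relation[OF e(1) t(1,2) this t(5) rel t(9) _ BA] bad_sub have "?B = ?A" by blast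
  then show False using yA yB by blast
qed

text \<open>Slopes with respect to \<open>a\<close> and \<open>b\<close> map \<open>E - Y\<close> to
  the projective line, injectively by \<open>bad_transversal\<close>. The slope of the missing point
  is not taken, which leaves \<open>q\<close> of the \<open>q + 1\<close> values.\<close>

lemma bad_card_le: "card (E - Y) \<le> CARD('f)"
proof -
  let ?A = "span Y"
  obtain a where a: "a \<in> E" "a \<notin> ?A" using bad_outside by blast
  obtain b c \<alpha> \<beta> \<gamma> where t: "b \<in> E" "c \<in> E" "indep2 ?A a b" "indep2 ?A a c" "indep2 ?A b c"
    "\<alpha> *s a + \<beta> *s b + \<gamma> *s c \<in> ?A" "\<alpha> \<noteq> 0" "\<beta> \<noteq> 0" "\<gamma> \<noteq> 0" using bad_triple[OF a] .
  have sp: "span E \<subseteq> span (insert a (insert b Y))"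
    using span_minimal[OF bad_span[OF a(1) t(1,3)] subspace_span] .
  then have "\<forall>e\<in>span E. \<exists>s r. e - (s *s a + r *s b) \<in> ?A" using in_span_insert2 by blast
  then obtain s r where sr: "\<And>e. e \<in> span E \<Longrightarrow> e - (s e *s a + r e *s b) \<in> ?A" by metis
  define \<sigma> where "\<sigma> e = (if s e = 0 then None else Some (r e / s e))" for e
  have mult: "\<exists>k. x - k *s e \<in> ?A" if x: "x \<in> span E" and e: "e \<in> span E" "e \<notin> ?A" and eq: "\<sigma> x = \<sigma> e" for x e
  proof -
    note se = sr[OF e(1)] and sx = sr[OF x]
    show ?thesis
    proof (cases "s e = 0")
      case True
      then have sx0: "s x = 0" using eq by (auto simp: \<sigma>_def split: if_splits)
      have r: "r e \<noteq> 0" using se True e(2) by auto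
      have "x - (r x / r e) *s e \<in> ?A"
        by (rule lin2[OF subspace_span sx se, of _ 1 "- (r x / r e)"])
          (use True sx0 r in \<open>simp add: algebra_simps\<close>)
      then show ?thesis by blast
    next
      case False
      then have sx0: "s x \<noteq> 0" and q: "r x = r e / s e * s x"
        using eq by (auto simp: \<sigma>_def field_simps split: if_splits)
      have "x - (s x / s e) *s e \<in> ?A"
        by (rule lin2[OF subspace_span sx se, of _ 1 "- (s x / s e)"])
          (use False sx0 q in \<open>simp add: algebra_simps\<close>)
      then show ?thesis by blast
    qed
  qed
  have out: "e \<in> E" "e \<notin> ?A" if "e \<in> E - Y" for e using that bad_flat by auto
  have "inj_on \<sigma> (E - Y)"
  proof (rule inj_onI, rule ccontr)
    fix x e assume xe: "x \<in> E - Y" "e \<in> E - Y" "\<sigma> x = \<sigma> e" "x \<noteq> e"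
    then obtain k where "x - k *s e \<in> ?A" using mult[of x e] out span_base by metis
    then have "1 *s x + (- k) *s e \<in> ?A" by simp
    moreover have "indep2 ?A x e" using bad_transversal out xe by blast
    ultimately show False unfolding indep2_def by (metis zero_neq_one)
  qed
  moreover from bad obtain z where z: "z \<in> span E" "z \<notin> ?A" "\<not> pt E ?A z" unfolding bad_def by blast
  have "\<sigma> ` (E - Y) \<subseteq> UNIV - {\<sigma> z}"
  proof
    fix x assume "x \<in> \<sigma> ` (E - Y)"
    then obtain e where e: "e \<in> E - Y" "x = \<sigma> e" by blast
    have "\<sigma> e \<noteq> \<sigma> z"
    proof
      assume eq: "\<sigma> e = \<sigma> z"
      then obtain k where "z - k *s e \<in> ?A" using mult[OF z(1), of e] out[OF e(1)] span_base by metis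
      then have "pt E ?A z" using z e unfolding pt_def by blast
      then show False using z by blast
    qed
    then show "x \<in> UNIV - {\<sigma> z}" using e by simp
  qed
  ultimately have "card (E - Y) \<le> card (UNIV - {\<sigma> z})" by (intro card_inj_on_le) auto
  also have "\<dots> = CARD('f)" by (simp add: card_Diff_singleton card_UNIV_option)
  finally show ?thesis .
qed

lemma bad_card_ge: "3 \<le> card (E - Y)"
proof -
  from bad obtain a b c where t: "a \<in> E" "b \<in> E" "c \<in> E"
    "indep2 (span Y) a b" "indep2 (span Y) a c" "indep2 (span Y) b c" unfolding bad_def by blast
  have irr: "\<not> indep2 (span Y) x x" for x
  proof
    assume "indep2 (span Y) x x"
    moreover have "1 *s x + (- 1) *s x \<in> span Y" by (simp add: span_zero)
    ultimately show False unfolding indep2_def by (metis zero_neq_one)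
  qed
  have "a \<noteq> b" "a \<noteq> c" "b \<noteq> c" using t irr by auto
  then have "card {a, b, c} = 3" by simp
  moreover have "{a, b, c} \<subseteq> E - Y"
    using t indep2_notin[OF t(4)] indep2_notin[OF t(5)] span_superset[of Y] by blast
  ultimately show ?thesis using fin by (metis card_mono finite_Diff)
qed

end

text \<open>The missing point for \<open>Y\<close> does not yield one for the new set directly. The
  number of elements outside is unchanged, however, and at most \<open>q\<close> by
  \<open>bad_card_le\<close>, so \<open>missing_point\<close> supplies a new one. The three points
  are now \<open>b\<close>, \<open>c\<close> and the discarded \<open>y\<close>.\<close>

lemma bad_exchange:
  assumes bad: "bad E Y" and y: "y \<in> Y" and a: "a \<in> E - Y"
  shows "bad E (insert a (Y - {y}))"
proof -
  let ?A = "span Y" and ?B = "span (Y - {y})" and ?Y1 = "insert a (Y - {y})"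
  have aA: "a \<in> E" "a \<notin> ?A" using a bad_flat[OF bad] by auto
  have BA: "?B \<subseteq> ?A" by (rule span_mono) blast
  have yB: "y \<notin> ?B" using bad_delete_notin[OF bad y] .
  have yA: "y \<in> ?A" using y span_base by blast
  obtain b c \<alpha> \<beta> \<gamma> where t: "b \<in> E" "c \<in> E" "indep2 ?A a b" "indep2 ?A a c" "indep2 ?A b c"
    "\<alpha> *s a + \<beta> *s b + \<gamma> *s c \<in> ?A" "\<alpha> \<noteq> 0" "\<beta> \<noteq> 0" "\<gamma> \<noteq> 0" using bad_triple[OF bad aA] .
  let ?w = "\<alpha> *s a + \<beta> *s b + \<gamma> *s c"
  have YE: "Y - {y} \<subseteq> E" "Y \<subseteq> E" using bad_sub[OF bad] by auto
  \<comment> \<open>The relation between \<open>a\<close>, \<open>b\<close> and \<open>c\<close>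
    involves \<open>y\<close>, so contracting \<open>a\<close> in place of \<open>y\<close> does not
    make \<open>b\<close> and \<open>c\<close> parallel.\<close>
  have wB: "?w \<notin> ?B"
    using bad_relation[OF bad aA(1) t(1-5) _ t(9) YE(1) BA] yA yB by blast
  have ind1: "independent ?Y1"
    using aA BA independent_mono[OF bad_indep[OF bad], of "Y - {y}"] by (intro independent_insertI) auto
  have bc: "indep2 (span ?Y1) b c"
    unfolding indep2_def
  proof (intro allI impI)
    fix s r assume "s *s b + r *s c \<in> span ?Y1"
    then obtain m where m: "s *s b + r *s c - m *s a \<in> ?B" using span_breakdown_eq by blast
    have "(- m - r / \<gamma> * \<alpha>) *s a + (s - r / \<gamma> * \<beta>) *s b \<in> ?A"
      by (rule lin2[OF subspace_span subsetD[OF BA m] t(6), of _ 1 "- (r / \<gamma>)"])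
        (use t in \<open>simp add: algebra_simps\<close>)
    then have z: "- m - r / \<gamma> * \<alpha> = 0" "s - r / \<gamma> * \<beta> = 0" using t(3) unfolding indep2_def by blast+
    have ms: "m = - (r / \<gamma> * \<alpha>)" "s = r / \<gamma> * \<beta>" using z by (metis add_0 diff_eq_eq minus_minus)+
    have "(r / \<gamma>) *s ?w \<in> ?B" using m t(9) by (simp add: ms algebra_simps)
    then have "r / \<gamma> = 0" using wB scale_mem_iff[OF subspace_span] by blast
    then show "s = 0 \<and> r = 0" using t(9) ms by simp
  qed
  have xy: "indep2 (span ?Y1) x y" if ax: "indep2 ?A a x" for x
    unfolding indep2_def
  proof (intro allI impI)
    fix s r assume "s *s x + r *s y \<in> span ?Y1"
    then obtain m where m: "s *s x + r *s y - m *s a \<in> ?B" using span_breakdown_eq by blast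
    have "(- m) *s a + s *s x \<in> ?A"
      by (rule lin2[OF subspace_span subsetD[OF BA m] yA, of _ 1 "- r"]) (simp add: algebra_simps)
    then have z: "- m = 0" "s = 0" using ax unfolding indep2_def by blast+
    then have "r *s y \<in> ?B" using m by simp
    then show "s = 0 \<and> r = 0" using z yB scale_mem_iff[OF subspace_span] by blast
  qed
  have sp: "E \<subseteq> span (insert b (insert y ?Y1))"
  proof -
    have "insert b (insert y ?Y1) = insert a (insert b Y)" using y by blast
    then show ?thesis using bad_span[OF bad aA(1) t(1,3)] by simp
  qed
  have "card (E - ?Y1) = card (E - Y)"
  proof -
    have "card ?Y1 = card Y"
      using bad_finite[OF bad] y a card_Suc_Diff1[of Y y] by simp
    then show ?thesis using fin YE a by (simp add: card_Diff_subset finite_subset)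
  qed
  then have "card (E - ?Y1) \<le> CARD('f)" using bad_card_le[OF bad] by simp
  from missing_point[OF fin this t(1,2) bc]
  have "\<exists>z\<in>span E. z \<notin> span ?Y1 \<and> \<not> pt E (span ?Y1) z" .
  moreover have "?Y1 \<subseteq> E" using YE a by blast
  moreover have "indep2 (span ?Y1) b y" "indep2 (span ?Y1) y c" "y \<in> E"
    using xy t y YE indep2_commute by blast+
  ultimately show ?thesis unfolding bad_def using ind1 bc sp t(1,2) by blast
qed

lemma bad_all_sets:
  assumes "bad E Y0" "Y \<subseteq> E" "card Y = card Y0" shows "bad E Y"
  using assms
proof (induction "card (Y - Y0)" arbitrary: Y0 rule: less_induct)
  case less
  have f: "finite Y" "finite Y0" using less.prems fin bad_finite finite_subset by blast+
  show ?case
  proof (cases "Y \<subseteq> Y0")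
    case True
    then show ?thesis using less.prems f by (metis card_subset_eq)
  next
    case False
    then obtain a where a: "a \<in> Y" "a \<notin> Y0" by blast
    have "\<not> Y0 \<subseteq> Y" using f less.prems(3) a by (metis card_subset_eq)
    then obtain y where y: "y \<in> Y0" "y \<notin> Y" by blast
    let ?Y1 = "insert a (Y0 - {y})"
    have "bad E ?Y1" using bad_exchange[OF less.prems(1) y(1)] a less.prems(2) by blast
    moreover have "card ?Y1 = card Y0" using f y a card_Suc_Diff1[of Y0 y] by simp
    moreover have "card (Y - ?Y1) < card (Y - Y0)" using f a y by (intro psubset_card_mono) auto
    ultimately show ?thesis using less.hyps[of ?Y1] less.prems by simp
  qed
qed

text \<open>By exchange every subset of \<open>E\<close> with as many elements as \<open>Y\<close>
  is bad. A set with two more elements consists of such a \<open>Z\<close> and a pair that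
  \<open>bad_flat\<close> puts outside \<open>span Z\<close> and \<open>bad_transversal\<close>
  makes independent modulo it. Thus \<open>r\<close> is \<open>card Y + 2\<close> and
  \<open>k\<close> counts the elements outside \<open>Y\<close>.\<close>

theorem minimal_unclean_uniform:
  assumes "\<not> clean E"
  obtains r k where "3 \<le> k" "k \<le> CARD('f)" "2 \<le> r" "card E = r - 2 + k"
    "\<And>I. I \<subseteq> E \<Longrightarrow> independent I \<longleftrightarrow> card I \<le> r"
proof -
  from bad_exists[OF assms] obtain Y where Y: "bad E Y" by blast
  let ?r = "card Y + 2" and ?k = "card (E - Y)"
  have YE: "Y \<subseteq> E" "finite Y" using bad_sub[OF Y] bad_finite[OF Y] by auto
  have cE: "card E = card Y + ?k" using YE fin by (metis card_Diff_subset card_mono le_add_diff_inverse)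
  have k: "3 \<le> ?k" "?k \<le> CARD('f)" using bad_card_ge[OF Y] bad_card_le[OF Y] by auto
  have "independent I \<longleftrightarrow> card I \<le> ?r" if I: "I \<subseteq> E" for I
  proof
    assume ind: "independent I"
    from Y obtain a b where "E \<subseteq> span (insert a (insert b Y))" unfolding bad_def by blast
    then have "card I \<le> card (insert a (insert b Y))"
      using independent_span_bound[OF _ ind, of "insert a (insert b Y)"] I YE by auto
    also have "\<dots> \<le> ?r" using YE by (simp add: card_insert_if)
    finally show "card I \<le> ?r" .
  next
    assume "card I \<le> ?r"
    then obtain R where R: "I \<subseteq> R" "R \<subseteq> E" "card R = ?r"
      using exists_subset_between[of I ?r E] cE k I fin by auto
    have fR: "finite R" using R fin finite_subset by blast
    have "\<not> card R \<le> 1" using R by simp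
    then obtain a b where ab: "a \<in> R" "b \<in> R" "a \<noteq> b" using fR card_le_Suc0_iff_eq by (metis One_nat_def)
    let ?Z = "R - {a, b}"
    have "card ?Z = card Y" using R ab fR by (simp add: card_Diff_subset)
    moreover have "?Z \<subseteq> E" using R by blast
    ultimately have Z: "bad E ?Z" using bad_all_sets[OF Y] by simp
    have "a \<notin> span ?Z" "b \<notin> span ?Z" using bad_flat[OF Z] ab R by blast+
    then have ind: "indep2 (span ?Z) a b" using bad_transversal[OF Z] ab R by blast
    have "a \<notin> span (insert b ?Z)"
    proof
      assume "a \<in> span (insert b ?Z)"
      then obtain k where "a - k *s b \<in> span ?Z" using span_breakdown_eq by blast
      then have "1 *s a + (- k) *s b \<in> span ?Z" by simp
      then show False using ind unfolding indep2_def by (metis zero_neq_one)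
    qed
    then have "independent (insert a (insert b ?Z))"
      using bad_indep[OF Z] \<open>b \<notin> span ?Z\<close> by (intro independent_insertI)
    moreover have "insert a (insert b ?Z) = R" using ab by blast
    ultimately show "independent I" using R independent_mono by metis
  qed
  then show ?thesis using that[of ?k ?r] k cE by simp
qed

end

end

section \<open>Length of MDS codes over a prime field\<close>

text \<open>The functions \<open>g 0, \<dots>, g (d - 1)\<close> on \<open>S\<close> generate a code of dimension \<open>d\<close> and minimum
  distance \<open>card S - d + 1\<close>.\<close>

definition mds :: "'s set \<Rightarrow> nat \<Rightarrow> (nat \<Rightarrow> 's \<Rightarrow> 'f::field) \<Rightarrow> bool" where
  "mds S d g \<longleftrightarrow> (\<forall>c. (\<exists>i<d. c i \<noteq> 0) \<longrightarrow> card {s \<in> S. (\<Sum>i<d. c i * g i s) = 0} < d)"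

text \<open>The functionals \<open>f C\<close> are determinants with the elements of \<open>C\<close> as remaining rows. The order
  of the rows is arbitrary, so only the squares of the values are symmetric.\<close>

lemma mds_functionals:
  fixes g :: "nat \<Rightarrow> 's \<Rightarrow> 'f::field"
  assumes fin: "finite S" and mds: "mds S d g" and d: "d > 0"
  obtains f :: "'s set \<Rightarrow> 's \<Rightarrow> 'f" where
    "\<And>C. \<exists>c. \<forall>s. f C s = (\<Sum>i<d. c i * g i s)"
    "\<And>C s. C \<subseteq> S \<Longrightarrow> Suc (card C) = d \<Longrightarrow> s \<in> C \<Longrightarrow> f C s = 0"
    "\<And>C s. C \<subseteq> S \<Longrightarrow> Suc (card C) = d \<Longrightarrow> s \<in> S - C \<Longrightarrow> f C s \<noteq> 0"
    "\<And>C D a b. C \<subseteq> S \<Longrightarrow> D \<subseteq> S \<Longrightarrow> Suc (card C) = d \<Longrightarrow> a \<notin> C \<Longrightarrow> b \<notin> D \<Longrightarrow> insert a C = insert b D \<Longrightarrow>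
       (f C a)\<^sup>2 = (f D b)\<^sup>2"
proof -
  define L where "L C = (SOME xs. distinct xs \<and> set xs = C)" for C :: "'s set"
  have L: "distinct (L C)" "set (L C) = C" if "C \<subseteq> S" for C
  proof -
    have "\<exists>xs. distinct xs \<and> set xs = C"
      using finite_distinct_list[OF finite_subset[OF that fin]] by blast
    from someI_ex[OF this] show "distinct (L C)" "set (L C) = C" unfolding L_def by auto
  qed
  define M where "M xs = mat d d (\<lambda>(i, j). g j (xs ! i))" for xs
  have M: "M xs \<in> carrier_mat d d" for xs by (simp add: M_def)
  define f where "f C s = det (M (s # L C))" for C s
  have len: "length (L C) = card C" if "C \<subseteq> S" for C
    using L[OF that] distinct_card[of "L C"] by simp
  show ?thesis
  proof (rule that)
    fix C
    have "f C s = (\<Sum>i<d. cofactor (M (undefined # L C)) 0 i * g i s)" for s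
    proof -
      \<comment> \<open>The cofactors along the first row do not see that row, so
        \<open>undefined\<close> can stand in for \<open>s\<close>; this makes the coefficients
        independent of \<open>s\<close>.\<close>
      have "cofactor (M (s # L C)) 0 i = cofactor (M (undefined # L C)) 0 i" for i
        unfolding cofactor_def
        by (rule arg_cong[of _ _ "\<lambda>A. _ * det A"]) (auto simp: mat_delete_def M_def intro!: eq_matI)
      then show ?thesis unfolding f_def laplace_expansion_row[OF M d]
        by (simp add: M_def d mult.commute)
    qed
    then show "\<exists>c. \<forall>s. f C s = (\<Sum>i<d. c i * g i s)" by blast
  next
    fix C s assume C: "C \<subseteq> S" "Suc (card C) = d" and s: "s \<in> C"
    then obtain j where j: "j < card C" "L C ! j = s" using L[OF C(1)] len[OF C(1)] by (metis in_set_conv_nth)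
    show "f C s = 0" unfolding f_def
    proof (rule det_identical_rows[OF M])
      show "0 \<noteq> Suc j" "0 < d" "Suc j < d" using j C by auto
      show "row (M (s # L C)) 0 = row (M (s # L C)) (Suc j)"
        using j C by (intro eq_vecI) (auto simp: M_def)
    qed
  next
    fix C s assume C: "C \<subseteq> S" "Suc (card C) = d" and s: "s \<in> S - C"
    show "f C s \<noteq> 0"
    proof
      let ?xs = "s # L C"
      assume "f C s = 0"
      then obtain v where v: "v \<in> carrier_vec d" "v \<noteq> 0\<^sub>v d" "M ?xs *\<^sub>v v = 0\<^sub>v d"
        unfolding f_def using det_0_iff_vec_prod_zero_field[OF M] by blast
      have "\<exists>i<d. v $ i \<noteq> 0"
      proof (rule ccontr)
        assume "\<not> ?thesis"
        then have "v = 0\<^sub>v d" using v(1) by (intro eq_vecI) auto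
        then show False using v by blast
      qed
      then have lt: "card {t \<in> S. (\<Sum>i<d. v $ i * g i t) = 0} < d" using mds unfolding mds_def by blast
      have "set ?xs \<subseteq> {t \<in> S. (\<Sum>i<d. v $ i * g i t) = 0}"
      proof
        fix t assume t: "t \<in> set ?xs"
        then obtain i where i: "i < d" "?xs ! i = t" using len[OF C(1)] C by (metis in_set_conv_nth length_Cons)
        have "(M ?xs *\<^sub>v v) $ i = 0" using v i by simp
        then have "(\<Sum>j<d. g j t * v $ j) = 0"
          using v i by (simp add: M_def scalar_prod_def atLeast0LessThan)
        then show "t \<in> {t \<in> S. (\<Sum>i<d. v $ i * g i t) = 0}"
          using t s C L[OF C(1)] by (auto simp: mult.commute)
      qed
      then have "card (set ?xs) \<le> card {t \<in> S. (\<Sum>i<d. v $ i * g i t) = 0}"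
        using fin by (intro card_mono) auto
      moreover have "card (set ?xs) = d" using L[OF C(1)] s C fin finite_subset[OF C(1) fin] by simp
      ultimately show False using lt by simp
    qed
  next
    fix C D a b assume C: "C \<subseteq> S" "D \<subseteq> S" "Suc (card C) = d" "a \<notin> C" "b \<notin> D" "insert a C = insert b D"
    let ?xs = "a # L C" and ?ys = "b # L D"
    have "distinct ?xs" "distinct ?ys" "set ?xs = set ?ys" using C L by auto
    then have "mset ?xs = mset ?ys" by (metis set_eq_iff_mset_eq_distinct)
    then obtain p where p: "p permutes {..<length ?ys}" "permute_list p ?ys = ?xs"
      by (rule mset_eq_permutation)
    have l: "length ?xs = d" using len C by simp
    have ly: "length ?ys = d" using l p(2) by (metis length_permute_list)
    have perm: "p permutes {0..<d}" using p(1) ly by (simp add: atLeast0LessThan)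
    have nth: "?xs ! i = ?ys ! (p i)" if "i < d" for i
      using permute_list_nth[OF p(1)] p(2) ly that by metis
    have pd: "p i < d" if "i < d" for i using perm that permutes_in_image[OF perm, of i] by simp
    have "M ?xs = mat d d (\<lambda>(i, j). M ?ys $$ (p i, j))"
      unfolding M_def using nth pd by (intro eq_matI) auto
    then have "det (M ?xs) = signof p * det (M ?ys)" using det_permute_rows[OF M perm, of ?ys] by simp
    then show "(f C a)\<^sup>2 = (f D b)\<^sup>2" unfolding f_def by (simp add: power_mult_distrib sign_def)
  qed
qed

text \<open>Up to sign, the sum is the coefficient of degree \<open>card E - 1\<close> in the
  Lagrange interpolant of \<open>T\<close>, which is \<open>T\<close> itself. The sign arises
  because the factors of \<open>q b\<close> have leading coefficient -1.\<close>

lemma lagrange_top_coeff: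
  fixes x :: "'s \<Rightarrow> 'f::field"
  assumes fin: "finite E" and inj: "inj_on x E" and deg: "Suc (degree T) < card E"
  shows "(\<Sum>b\<in>E. poly T (x b) / (\<Prod>z\<in>E - {b}. x z - x b)) = 0"
proof -
  define n where "n = card E - 1"
  define q where "q b = (\<Prod>z\<in>E - {b}. [:x z, -1:])" for b
  define w where "w b = (\<Prod>z\<in>E - {b}. x z - x b)" for b
  have nz: "w b \<noteq> 0" if "b \<in> E" for b
    unfolding w_def using fin inj that by (auto simp: inj_on_def)
  have pq: "poly (q b) (x a) = (if a = b then w b else 0)" if "a \<in> E" "b \<in> E" for a b
    using that fin by (auto simp: q_def w_def poly_prod intro!: prod_zero bexI[of _ a])
  have degq: "degree (q b) = n" and lead: "coeff (q b) n = (-1) ^ n" if "b \<in> E" for b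
  proof -
    have c: "card (E - {b}) = n" using that fin by (simp add: n_def)
    have "degree (q b) = (\<Sum>z\<in>E - {b}. degree [:x z, -1:])"
      unfolding q_def by (rule degree_prod_eq_sum_degree) auto
    then show d: "degree (q b) = n" using c by simp
    have "lead_coeff (q b) = (\<Prod>z\<in>E - {b}. lead_coeff [:x z, -1:])"
      unfolding q_def by (rule lead_coeff_prod)
    then show "coeff (q b) n = (-1) ^ n" using c d by simp
  qed
  define P where "P = (\<Sum>b\<in>E. smult (poly T (x b) / w b) (q b))"
  have "degree P \<le> n" unfolding P_def using degq
    by (intro degree_sum_le) (use fin in \<open>auto intro: order.trans[OF degree_smult_le]\<close>)
  moreover have "degree T \<le> n" using deg by (simp add: n_def)
  ultimately have dPT: "degree (P - T) \<le> n" by (rule degree_diff_le)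
  have "P = T"
  proof (rule ccontr)
    assume "P \<noteq> T"
    then have ne: "P - T \<noteq> 0" by simp
    have "x ` E \<subseteq> {y. poly (P - T) y = 0}"
    proof
      fix y assume "y \<in> x ` E"
      then obtain a where a: "a \<in> E" "y = x a" by blast
      have "poly P (x a) = (\<Sum>b\<in>E. if a = b then poly T (x b) else 0)"
        unfolding P_def poly_sum by (rule sum.cong) (use pq a nz in auto)
      then show "y \<in> {y. poly (P - T) y = 0}" using a fin by simp
    qed
    then have "card (x ` E) \<le> card {y. poly (P - T) y = 0}"
      using poly_roots_finite[OF ne] by (intro card_mono) auto
    also have "\<dots> \<le> n" using card_poly_roots_bound[OF ne] dPT by simp
    finally show False using card_image[OF inj] deg by (simp add: n_def)
  qed
  have "coeff P n = (\<Sum>b\<in>E. poly T (x b) / w b * (-1) ^ n)"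
    unfolding P_def by (simp add: coeff_sum lead)
  moreover have "coeff T n = 0" using deg by (intro coeff_eq_0) (simp add: n_def)
  ultimately have "(\<Sum>b\<in>E. poly T (x b) / w b) * (-1) ^ n = 0" unfolding \<open>P = T\<close> sum_distrib_right by simp
  then show ?thesis by (simp add: w_def)
qed

text \<open>Two passes over the sums of \<open>\<beta>\<close> on the sets of size
  \<open>Suc m\<close> that contain \<open>W\<close> and avoid \<open>V\<close>. In
  \<open>up\<close>, double counting extends the equations to smaller \<open>W\<close>, cancelling
  the factor \<open>Suc m - card W\<close> each time. In \<open>avoid\<close>, elements are traded
  one by one between containing and avoiding, as long as \<open>V\<close> and \<open>W\<close> have
  at most \<open>m\<close> elements together. Avoiding \<open>X - C\<close> leaves \<open>C\<close>
  alone.\<close>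

lemma inclusion_system_trivial:
  fixes \<beta> :: "'s set \<Rightarrow> 'f::field"
  assumes fin: "finite X"
    and sys: "\<And>Y. Y \<subseteq> X \<Longrightarrow> card Y = m \<Longrightarrow> (\<Sum>a\<in>X - Y. \<beta> (insert a Y)) = 0"
    and char: "\<And>j. 0 < j \<Longrightarrow> j \<le> Suc m \<Longrightarrow> (of_nat j :: 'f) \<noteq> 0"
    and C: "C \<subseteq> X" "card C = Suc m" "card (X - C) \<le> m"
  shows "\<beta> C = 0"
proof -
  define F where "F V W = {D. D \<subseteq> X \<and> card D = Suc m \<and> W \<subseteq> D \<and> D \<inter> V = {}}" for V W
  have finF: "finite (F V W)" for V W
    by (rule finite_subset[of _ "Pow X"]) (auto simp: F_def fin)
  have up: "sum \<beta> (F {} W) = 0" if "W \<subseteq> X" "card W + k = m" for k W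
    using that
  proof (induction k arbitrary: W)
    case 0
    have fW: "finite W" using 0 fin finite_subset by blast
    have "F {} W = (\<lambda>a. insert a W) ` (X - W)"
    proof (intro Set.set_eqI iffI)
      fix D assume D: "D \<in> F {} W"
      then have fD: "finite D" "W \<subseteq> D" "card D = Suc (card W)" "D \<subseteq> X"
        using 0 fin finite_subset by (auto simp: F_def)
      then have "card (D - W) = 1" using fW by (simp add: card_Diff_subset)
      then obtain a where "D - W = {a}" by (auto simp: card_1_singleton_iff)
      then have "D = insert a W" "a \<in> X - W" using fD by auto
      then show "D \<in> (\<lambda>a. insert a W) ` (X - W)" by blast
    qed (use 0 fW in \<open>auto simp: F_def\<close>)
    moreover have "inj_on (\<lambda>a. insert a W) (X - W)" by (auto simp: inj_on_def)
    ultimately show ?case using sys[of W] 0 by (simp add: sum.reindex)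
  next
    case (Suc k)
    have fW: "finite W" using Suc.prems fin finite_subset by blast
    have "(\<Sum>a\<in>X - W. sum \<beta> (F {} (insert a W))) = 0"
      using Suc fW by (intro sum.neutral) auto
    moreover have "(\<Sum>a\<in>X - W. sum \<beta> (F {} (insert a W))) = (\<Sum>a\<in>X - W. \<Sum>D\<in>F {} W. if a \<in> D then \<beta> D else 0)"
    proof (rule sum.cong)
      fix a assume a: "a \<in> X - W"
      have "F {} (insert a W) = F {} W \<inter> {D. a \<in> D}" by (auto simp: F_def)
      then show "sum \<beta> (F {} (insert a W)) = (\<Sum>D\<in>F {} W. if a \<in> D then \<beta> D else 0)"
        using finF by (simp add: sum.inter_restrict)
    qed simp
    moreover have "\<dots> = (\<Sum>D\<in>F {} W. \<Sum>a\<in>X - W. if a \<in> D then \<beta> D else 0)" by (rule sum.swap)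
    moreover have "\<dots> = (\<Sum>D\<in>F {} W. of_nat (Suc m - card W) * \<beta> D)"
    proof (rule sum.cong)
      fix D assume D: "D \<in> F {} W"
      then have "(X - W) \<inter> D = D - W" by (auto simp: F_def)
      moreover have "card (D - W) = Suc m - card W" using D fW by (simp add: F_def card_Diff_subset)
      ultimately show "(\<Sum>a\<in>X - W. if a \<in> D then \<beta> D else 0) = of_nat (Suc m - card W) * \<beta> D"
        using fin by (simp add: sum.If_cases Int_def)
    qed simp
    ultimately have "of_nat (Suc m - card W) * sum \<beta> (F {} W) = 0" by (simp add: sum_distrib_left)
    moreover have "(of_nat (Suc m - card W) :: 'f) \<noteq> 0" using Suc.prems by (intro char) auto
    ultimately show ?case by simp
  qed
  have avoid: "sum \<beta> (F V W) = 0" if "finite V" "W \<subseteq> X" "V \<subseteq> X" "V \<inter> W = {}" "card V + card W \<le> m" for V W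
    using that
  proof (induction V arbitrary: W rule: finite_induct)
    case empty
    then show ?case using up[of W "m - card W"] by simp
  next
    case (insert v V)
    have fW: "finite W" using insert.prems fin finite_subset by blast
    have "F V W = F (insert v V) W \<union> F V (insert v W)" by (auto simp: F_def)
    moreover have "F (insert v V) W \<inter> F V (insert v W) = {}" by (auto simp: F_def)
    ultimately have "sum \<beta> (F V W) = sum \<beta> (F (insert v V) W) + sum \<beta> (F V (insert v W))"
      using finF by (simp add: sum.union_disjoint)
    moreover have "sum \<beta> (F V W) = 0" using insert by auto
    moreover have "sum \<beta> (F V (insert v W)) = 0" using insert fW by (intro insert.IH) auto
    ultimately show ?case by simp
  qed
  have "F (X - C) {} = {C}"
  proof (intro Set.set_eqI iffI)
    fix D assume D: "D \<in> F (X - C) {}"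
    then have "D \<subseteq> C" "card D = card C" using C by (auto simp: F_def)
    then show "D \<in> {C}" using C fin by (metis card_subset_eq finite_subset singletonI)
  qed (use C in \<open>auto simp: F_def\<close>)
  then show ?thesis using avoid[of "X - C" "{}"] fin C by simp
qed

lemma prod_nonzero_shift:
  fixes b :: "'f::{finite,field}"
  shows "(\<Prod>t\<in>UNIV - {b}. t - b) = (\<Prod>t\<in>UNIV - {0}. t)"
  by (rule prod.reindex_bij_witness[of _ "\<lambda>t. t + b" "\<lambda>t. t - b"]) auto

lemma power_card_minus_1:
  fixes u :: "'f::{finite,field}"
  assumes "u \<noteq> 0" shows "u ^ (CARD('f) - 1) = 1"
proof -
  have "(\<Prod>t\<in>UNIV - {0}. u * t) = (\<Prod>t\<in>UNIV - {0}. t)"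
    by (rule prod.reindex_bij_witness[of _ "\<lambda>t. t / u" "\<lambda>t. u * t"]) (use assms in auto)
  then have "u ^ (CARD('f) - 1) * (\<Prod>t\<in>UNIV - {0}. t) = (\<Prod>t\<in>UNIV - {0 :: 'f}. t)"
    by (simp add: prod.distrib card_Diff_singleton)
  then show ?thesis by simp
qed

lemma mds_zeros:
  fixes g :: "nat \<Rightarrow> 's \<Rightarrow> 'f::field"
  assumes "mds S d g" "finite S" "\<exists>c. \<forall>s. h s = (\<Sum>i<d. c i * g i s)"
    and "Z \<subseteq> S" "card Z \<ge> d" "\<And>s. s \<in> Z \<Longrightarrow> h s = 0"
  shows "h s = 0"
proof -
  from assms(3) obtain c where c: "\<And>s. h s = (\<Sum>i<d. c i * g i s)" by blast
  have "Z \<subseteq> {s \<in> S. (\<Sum>i<d. c i * g i s) = 0}" using assms(4,6) c by auto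
  then have "card Z \<le> card {s \<in> S. (\<Sum>i<d. c i * g i s) = 0}"
    using assms(2) by (intro card_mono) auto
  then have "d \<le> card {s \<in> S. (\<Sum>i<d. c i * g i s) = 0}" using assms(5) by simp
  then have "\<not> (\<exists>i<d. c i \<noteq> 0)" using assms(1)[unfolded mds_def, rule_format, of c] by auto
  then have "\<forall>i<d. c i = 0" by blast
  then show ?thesis unfolding c by simp
qed

text \<open>The functionals vanishing on \<open>Y\<close> form a projective line, on which the elements of \<open>S - Y\<close> have
  distinct slopes. By \<open>prod_nonzero_shift\<close> the inverse of the product over \<open>S\<close> is, up to a constant, the
  value of a polynomial of degree \<open>d - 3\<close> at the slope of \<open>a\<close>, so Lagrange interpolation applies. The two
  products together have \<open>q + 1\<close> factors, an even number, whence the signs of the functionals cancel.\<close>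

lemma mds_interpolation:
  fixes g :: "nat \<Rightarrow> 's \<Rightarrow> 'f::{finite,field}" and f :: "'s set \<Rightarrow> 's \<Rightarrow> 'f"
  assumes odd: "odd CARD('f)" and fin: "finite S" and card: "card S = CARD('f) + 2"
    and mds: "mds S d g" and d: "3 \<le> d" "2 * d \<le> CARD('f) + 2"
    and lin: "\<And>C. \<exists>c. \<forall>s. f C s = (\<Sum>i<d. c i * g i s)"
    and zero: "\<And>C s. C \<subseteq> S \<Longrightarrow> Suc (card C) = d \<Longrightarrow> s \<in> C \<Longrightarrow> f C s = 0"
    and nonzero: "\<And>C s. C \<subseteq> S \<Longrightarrow> Suc (card C) = d \<Longrightarrow> s \<in> S - C \<Longrightarrow> f C s \<noteq> 0"
    and sq: "\<And>C D a b. C \<subseteq> S \<Longrightarrow> D \<subseteq> S \<Longrightarrow> Suc (card C) = d \<Longrightarrow> a \<notin> C \<Longrightarrow> b \<notin> D \<Longrightarrow>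
       insert a C = insert b D \<Longrightarrow> (f C a)\<^sup>2 = (f D b)\<^sup>2"
    and X: "X \<subseteq> S" "card X = 2 * d - 3" and s0: "s0 \<in> S - X"
    and Y: "Y \<subseteq> X" "card Y = d - 2"
  shows "(\<Sum>a\<in>X - Y. inverse ((\<Prod>s\<in>S - insert a Y. f (insert a Y) s) * (\<Prod>z\<in>X - insert a Y. f (insert a Y) z))) = 0"
proof -
  let ?p = "CARD('f)"
  let ?E = "X - Y"
  have finX: "finite X" "finite Y"
    using finite_subset[OF X(1) fin] finite_subset[OF Y(1)] by simp_all
  have cE: "card ?E = d - 1" using X Y finX d by (simp add: card_Diff_subset)
  then have "card ?E \<noteq> 0" using d by simp
  then have "?E \<noteq> {}" by (metis card.empty)
  then obtain s1 where s1: "s1 \<in> ?E" by blast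
  have YS: "Y \<subseteq> S" "s0 \<notin> Y" "s0 \<in> S" "s1 \<in> S" "s1 \<notin> Y" "s1 \<noteq> s0" using s0 s1 X Y by auto
  have cY: "Suc (card (insert a Y)) = d" if "a \<notin> Y" for a using that finX Y d by simp
  \<comment> \<open>Two members of the pencil of functionals vanishing on \<open>Y\<close>. As
    \<open>u\<close> also vanishes at \<open>s0\<close>, that element gets the slope at infinity,
    and the elements of \<open>R\<close> below get the finite slopes \<open>w / u\<close>.\<close>
  define u w where "u = f (insert s0 Y)" and "w = f (insert s1 Y)"
  have u0: "u s0 = 0" "u y = 0" if "y \<in> Y" for y using zero[of "insert s0 Y"] cY YS that by (auto simp: u_def)
  have us0: "u s0 = 0" using zero[of "insert s0 Y"] cY YS by (auto simp: u_def)
  have unz: "u a \<noteq> 0" if "a \<in> S" "a \<notin> Y" "a \<noteq> s0" for a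
    using nonzero[of "insert s0 Y" a] cY YS that by (auto simp: u_def)
  have wY: "w y = 0" if "y \<in> Y" for y using zero[of "insert s1 Y"] cY YS that by (auto simp: w_def)
  have ws0: "w s0 \<noteq> 0" using nonzero[of "insert s1 Y" s0] cY YS by (auto simp: w_def)
  \<comment> \<open>The member of the pencil that vanishes at \<open>b\<close>, hence proportional
    to \<open>f (insert b Y)\<close>; the latter is a determinant with rows in an arbitrary order,
    while \<open>F b\<close> depends on \<open>b\<close> in an explicit way.\<close>
  define F where "F b a = u b * w a - w b * u a" for a b
  have lin2: "\<exists>c. \<forall>s. \<alpha> * h1 s + \<beta> * h2 s = (\<Sum>i<d. c i * g i s)"
    if h: "\<exists>c. \<forall>s. h1 s = (\<Sum>i<d. c i * g i s)" "\<exists>c. \<forall>s. h2 s = (\<Sum>i<d. c i * g i s)" for h1 h2 \<alpha> \<beta>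
  proof -
    from h obtain c1 c2 where c: "\<And>s. h1 s = (\<Sum>i<d. c1 i * g i s)" "\<And>s. h2 s = (\<Sum>i<d. c2 i * g i s)" by metis
    have "\<alpha> * h1 s + \<beta> * h2 s = (\<Sum>i<d. (\<alpha> * c1 i + \<beta> * c2 i) * g i s)" for s
      unfolding c by (simp add: sum_distrib_left sum.distrib algebra_simps)
    then show ?thesis by (intro exI[of _ "\<lambda>i. \<alpha> * c1 i + \<beta> * c2 i"]) blast
  qed
  have Flin: "\<exists>c. \<forall>s. F b s = (\<Sum>i<d. c i * g i s)" for b
    using lin2[of w u "u b" "- w b"] lin unfolding F_def u_def w_def by simp
  have FY: "F b y = 0" if "y \<in> insert b Y" for b y using that u0 wY by (auto simp: F_def)
  have Fs0: "F b s0 = u b * w s0" for b by (simp add: F_def us0)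
  define R where "R = S - Y - {s0}"
  have cR: "card R + d = ?p + 3"
    using fin finX YS card Y d by (simp add: R_def card_Diff_subset)
  have finR: "finite R" by (simp add: R_def fin)
  have ER: "?E \<subseteq> R" using X s0 by (auto simp: R_def)
  define x where "x a = w a / u a" for a
  have Fx: "F b a = u b * u a * (x a - x b)" if "a \<in> R" "b \<in> R" for a b
    using that unz[of a] unz[of b] by (simp add: F_def x_def R_def field_simps)
  have injx: "inj_on x R"
  proof (rule inj_onI, rule ccontr)
    fix a b assume ab: "a \<in> R" "b \<in> R" "x a = x b" "a \<noteq> b"
    have "F b s0 = 0"
    proof (rule mds_zeros[OF mds fin Flin])
      show "insert a (insert b Y) \<subseteq> S" "d \<le> card (insert a (insert b Y))"
        using ab YS finX Y d by (auto simp: R_def)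
      show "F b s = 0" if "s \<in> insert a (insert b Y)" for s using that FY Fx ab by auto
    qed
    then show False using Fs0 ws0 unz ab by (auto simp: R_def)
  qed
  \<comment> \<open>The zeros are the slopes that no element of \<open>R\<close> takes,
    \<open>q - (q + 3 - d) = d - 3\<close> in number. Multiplication by \<open>T\<close> completes a
    product over the slopes taken to the product of all nonzero field elements.\<close>
  define T where "T = (\<Prod>t\<in>UNIV - x ` R. [:t, -1:])"
  define \<kappa> where "\<kappa> = (\<Prod>t\<in>UNIV - {0 :: 'f}. t)"
  have kap: "\<kappa> \<noteq> 0" by (simp add: \<kappa>_def)
  have cxR: "card (x ` R) + d = ?p + 3" using cR card_image[OF injx] by simp
  have "degree T \<le> (\<Sum>t\<in>UNIV - x ` R. 1)"
    unfolding T_def by (rule order.trans[OF degree_prod_sum_le]) auto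
  also have "\<dots> = d - 3" using cxR by (simp add: card_Diff_subset)
  finally have "degree T \<le> d - 3" .
  then have degT: "Suc (degree T) < card ?E" using cE d by simp
  have Tval: "(\<Prod>s\<in>R - {b}. x s - x b) * poly T (x b) = \<kappa>" if b: "b \<in> R" for b
  proof -
    have "(\<Prod>s\<in>R - {b}. x s - x b) = (\<Prod>t\<in>x ` (R - {b}). t - x b)"
      using injx by (subst prod.reindex) (auto intro: inj_on_subset)
    moreover have "x ` (R - {b}) = x ` R - {x b}"
      using injx b by (auto simp: inj_on_def)
    moreover have "poly T (x b) = (\<Prod>t\<in>UNIV - x ` R. t - x b)" by (simp add: T_def poly_prod)
    moreover have "(\<Prod>t\<in>x ` R - {x b}. t - x b) * (\<Prod>t\<in>UNIV - x ` R. t - x b) =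
      (\<Prod>t\<in>(x ` R - {x b}) \<union> (UNIV - x ` R). t - x b)"
      by (rule prod.union_disjoint[symmetric]) auto
    moreover have "(x ` R - {x b}) \<union> (UNIV - x ` R) = UNIV - {x b}" using b by auto
    ultimately show ?thesis using prod_nonzero_shift[of "x b"] by (simp add: \<kappa>_def)
  qed
  define K where "K = (\<Prod>s\<in>R. u s) * (\<Prod>s\<in>?E. u s) / w s0 ^ ?p"
  have Q: "(\<Prod>s\<in>S - insert b Y. f (insert b Y) s) * (\<Prod>z\<in>X - insert b Y. f (insert b Y) z) =
     K * ((\<Prod>s\<in>R - {b}. x s - x b) * (\<Prod>z\<in>?E - {b}. x z - x b))" if b: "b \<in> ?E" for b
  proof -
    let ?C = "insert b Y"
    let ?q = "f ?C"
    have bR: "b \<in> R" using b ER by blast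
    have bS: "b \<in> S" "b \<notin> Y" "b \<noteq> s0" using bR by (auto simp: R_def)
    have CS: "?C \<subseteq> S" "Suc (card ?C) = d" "s0 \<notin> ?C" using bS YS cY by auto
    have "F b s * ?q s0 + (- F b s0) * ?q s = 0" for s
    proof (rule mds_zeros[OF mds fin])
      show "\<exists>c. \<forall>s. F b s * ?q s0 + (- F b s0) * ?q s = (\<Sum>i<d. c i * g i s)"
        using lin2[OF Flin lin, of "?q s0" b "- F b s0" ?C] by (simp add: mult.commute)
      show "insert s0 ?C \<subseteq> S" "d \<le> card (insert s0 ?C)" using CS YS finX by auto
      show "F b s * ?q s0 + (- F b s0) * ?q s = 0" if "s \<in> insert s0 ?C" for s
        using that FY zero[OF CS(1,2)] by auto
    qed
    then have rel: "F b s * ?q s0 = u b * w s0 * ?q s" for s using Fs0 by simp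
    \<comment> \<open>The symmetry of the squares fixes the scaling of \<open>?q\<close> relative to
      \<open>F b\<close> up to this sign.\<close>
    define e where "e = ?q s0 / u b"
    have ub: "u b \<noteq> 0" using unz bS by blast
    have "(?q s0)\<^sup>2 = (u b)\<^sup>2" unfolding u_def
      using sq[of ?C "insert s0 Y" s0 b] CS bS YS by auto
    then have e2: "e\<^sup>2 = 1" using ub by (simp add: e_def power_divide)
    have qs0: "?q s0 = e * u b" using ub by (simp add: e_def)
    have qs: "?q s = (e * u b / w s0) * u s * (x s - x b)" if "s \<in> R" for s
    proof -
      have "u b * (w s0 * ?q s) = u b * (e * u b * u s * (x s - x b))"
        using rel[of s] Fx[OF that bR] qs0 by (simp only: ac_simps)
      then have "?q s * w s0 = e * u b * u s * (x s - x b)" using ub by (simp add: mult.commute)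
      then have "?q s = e * u b * u s * (x s - x b) / w s0" using ws0 by (simp add: eq_divide_eq)
      then show ?thesis by simp
    qed
    have "S - ?C = insert s0 (R - {b})" using bS YS by (auto simp: R_def)
    then have "(\<Prod>s\<in>S - ?C. ?q s) = e * u b * (\<Prod>s\<in>R - {b}. ?q s)"
      using finR by (simp add: R_def qs0)
    also have "(\<Prod>s\<in>R - {b}. ?q s) = (\<Prod>s\<in>R - {b}. (e * u b / w s0) * u s * (x s - x b))"
      by (rule prod.cong) (auto simp: qs)
    also have "\<dots> = (e * u b / w s0) ^ card (R - {b}) * (\<Prod>s\<in>R - {b}. u s) * (\<Prod>s\<in>R - {b}. x s - x b)"
      by (simp only: prod.distrib prod_constant)
    finally have P1: "(\<Prod>s\<in>S - ?C. ?q s) = e * u b * ((e * u b / w s0) ^ card (R - {b}) *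
      (\<Prod>s\<in>R - {b}. u s) * (\<Prod>s\<in>R - {b}. x s - x b))" .
    have "X - ?C = ?E - {b}" by auto
    then have "(\<Prod>z\<in>X - ?C. ?q z) = (\<Prod>z\<in>?E - {b}. (e * u b / w s0) * u z * (x z - x b))"
      using ER qs by (intro prod.cong) auto
    also have "\<dots> = (e * u b / w s0) ^ card (?E - {b}) * (\<Prod>z\<in>?E - {b}. u z) * (\<Prod>z\<in>?E - {b}. x z - x b)"
      by (simp only: prod.distrib prod_constant)
    finally have P2: "(\<Prod>z\<in>X - ?C. ?q z) = (e * u b / w s0) ^ card (?E - {b}) *
      (\<Prod>z\<in>?E - {b}. u z) * (\<Prod>z\<in>?E - {b}. x z - x b)" .
    \<comment> \<open>With the factor for \<open>s0\<close> in \<open>P1\<close>, both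
      \<open>e\<close> and \<open>u b\<close> occur to the power \<open>q + 1\<close>. The sign
      disappears as \<open>q + 1\<close> is even; two factors \<open>u b\<close> cancel against
      \<open>UR\<close> and \<open>UE\<close>, and the other \<open>q - 1\<close> multiply to 1. So
      \<open>K\<close> does not depend on \<open>b\<close>.\<close>
    have cards: "card (R - {b}) + card (?E - {b}) = ?p"
      using cR cE d b bR finR finX by (simp add: card_Diff_singleton)
    have UR: "(\<Prod>s\<in>R - {b}. u s) = (\<Prod>s\<in>R. u s) / u b"
      using finR bR ub by (simp add: prod.remove)
    have UE: "(\<Prod>s\<in>?E - {b}. u s) = (\<Prod>s\<in>?E. u s) / u b"
      using finX b ub by (simp add: prod.remove)
    have pp: "?p > 0" by simp
    obtain m where m: "?p = Suc (2 * m)" using odd by (elim oddE) auto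
    have "e * e ^ ?p = e\<^sup>2 * (e\<^sup>2) ^ m" unfolding m power_mult[symmetric] by (simp add: power2_eq_square)
    then have epow: "e * e ^ ?p = 1" using e2 by simp
    have upow: "u b ^ ?p = u b" using power_card_minus_1[OF ub] pp power_minus_mult[of ?p "u b"] by simp
    let ?A = "\<Prod>s\<in>R - {b}. x s - x b" and ?B = "\<Prod>z\<in>?E - {b}. x z - x b"
    have "(\<Prod>s\<in>S - ?C. ?q s) * (\<Prod>z\<in>X - ?C. ?q z) =
      e * u b * ((e * u b / w s0) ^ card (R - {b}) * (e * u b / w s0) ^ card (?E - {b})) *
      ((\<Prod>s\<in>R. u s) / u b) * ((\<Prod>s\<in>?E. u s) / u b) * (?A * ?B)"
      unfolding P1 P2 UR UE by (simp only: ac_simps)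
    also have "(e * u b / w s0) ^ card (R - {b}) * (e * u b / w s0) ^ card (?E - {b}) = (e * u b / w s0) ^ ?p"
      using cards by (simp flip: power_add)
    also have "\<dots> = e ^ ?p * u b / w s0 ^ ?p" using upow by (simp add: power_mult_distrib power_divide)
    also have "e * u b * (e ^ ?p * u b / w s0 ^ ?p) * ((\<Prod>s\<in>R. u s) / u b) * ((\<Prod>s\<in>?E. u s) / u b) * (?A * ?B) =
      (e * e ^ ?p) * K * (?A * ?B)" unfolding K_def using ub by (simp add: field_simps)
    finally show ?thesis using epow by simp
  qed
  have "(\<Sum>a\<in>?E. inverse ((\<Prod>s\<in>S - insert a Y. f (insert a Y) s) * (\<Prod>z\<in>X - insert a Y. f (insert a Y) z))) =
    (\<Sum>a\<in>?E. inverse (K * \<kappa>) * (poly T (x a) / (\<Prod>z\<in>?E - {a}. x z - x a)))"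
  proof (rule sum.cong)
    fix a assume a: "a \<in> ?E"
    let ?A = "\<Prod>s\<in>R - {a}. x s - x a"
    have "?A * poly T (x a) = \<kappa>" using Tval ER a by blast
    then have "inverse ?A = poly T (x a) / \<kappa>" using kap by (auto simp: field_simps)
    then have "inverse (K * (?A * (\<Prod>z\<in>?E - {a}. x z - x a))) =
      inverse K * (poly T (x a) / \<kappa>) * inverse (\<Prod>z\<in>?E - {a}. x z - x a)"
      by (simp add: inverse_mult_distrib)
    then show "inverse ((\<Prod>s\<in>S - insert a Y. f (insert a Y) s) * (\<Prod>z\<in>X - insert a Y. f (insert a Y) z)) =
       inverse (K * \<kappa>) * (poly T (x a) / (\<Prod>z\<in>?E - {a}. x z - x a))"
      unfolding Q[OF a] by (simp add: inverse_mult_distrib divide_inverse mult.commute)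
  qed simp
  also have "\<dots> = inverse (K * \<kappa>) * (\<Sum>a\<in>?E. poly T (x a) / (\<Prod>z\<in>?E - {a}. x z - x a))"
    by (simp only: sum_distrib_left)
  also have "\<dots> = 0"
    using lagrange_top_coeff[OF _ inj_on_subset[OF injx ER] degT] finX by simp
  finally show ?thesis .
qed

text \<open>The polynomial of degree \<open>d - 3\<close> makes sense from \<open>d = 3\<close> on,
  so dimension two is handled by pigeonhole: among \<open>q + 2\<close> elements two have the same
  slope in a projective line of \<open>q + 1\<close> points, and a nonzero word vanishes at
  both.\<close>

lemma mds_length_dim2:
  fixes g :: "nat \<Rightarrow> 's \<Rightarrow> 'f::{finite,field}"
  assumes fin: "finite S" and card: "card S = CARD('f) + 2" and mds: "mds S 2 g"
  shows False
proof -
  define \<sigma> where "\<sigma> s = (if g 0 s = 0 then None else Some (g 1 s / g 0 s))" for s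
  have "\<not> inj_on \<sigma> S"
  proof
    assume "inj_on \<sigma> S"
    then have "card S \<le> CARD('f option)" by (intro card_inj_on_le[of \<sigma>]) auto
    then show False using card by (simp add: card_UNIV_option)
  qed
  then obtain s t where st: "s \<in> S" "t \<in> S" "s \<noteq> t" "\<sigma> s = \<sigma> t" unfolding inj_on_def by blast
  define c where "c i = (if g 0 s = 0 then (if i = 0 then 1 else 0) else if i = 0 then g 1 s else - g 0 s)" for i :: nat
  have "\<exists>i<2. c i \<noteq> 0" by (cases "g 0 s = 0") (auto simp: c_def intro: exI[of _ 0] exI[of _ 1])
  then have "card {s \<in> S. (\<Sum>i<2. c i * g i s) = 0} < 2" using mds unfolding mds_def by blast
  moreover have "{s, t} \<subseteq> {s \<in> S. (\<Sum>i<2. c i * g i s) = 0}"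
    using st by (auto simp: numeral_2_eq_2 c_def \<sigma>_def field_simps split: if_splits)
  then have "card {s, t} \<le> card {s \<in> S. (\<Sum>i<2. c i * g i s) = 0}" using fin by (intro card_mono) auto
  ultimately show False using st by simp
qed

text \<open>Translation by 1 permutes the field, so summing all elements shows that \<open>q\<close>
  is zero in it. If a smaller positive \<open>j\<close> were zero too, Bezout would give
  \<open>1 = 0\<close>.\<close>

lemma of_nat_nonzero_below_prime_card:
  assumes "prime CARD('f::{finite,field})" "0 < j" "j < CARD('f)"
  shows "(of_nat j :: 'f) \<noteq> 0"
proof
  assume j: "(of_nat j :: 'f) = 0"
  have "(\<Sum>x\<in>UNIV. x + 1 :: 'f) = (\<Sum>x\<in>UNIV. x)"
    by (rule sum.reindex_bij_witness[of _ "\<lambda>x. x - 1" "\<lambda>x. x + 1"]) auto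
  then have p: "(of_nat CARD('f) :: 'f) = 0" by (simp add: sum.distrib)
  have "coprime j CARD('f)" using assms
    by (metis coprime_commute dvd_imp_le not_le prime_imp_coprime_nat)
  then obtain a b where "int j * a + int CARD('f) * b = 1"
    by (metis bezout_int coprime_iff_gcd_eq_1 gcd_int_int_eq of_nat_1 mult.commute)
  then have "of_int (int j * a + int CARD('f) * b) = (1 :: 'f)" by simp
  then show False using j p by simp
qed

text \<open>The numbers \<open>\<beta> C\<close> for sets of size \<open>d - 1\<close> solve a
  linear system with only the trivial solution, although they are inverses of nonzero products. The
  system is trivial because the integers up to \<open>d - 1\<close> are invertible in a prime
  field.\<close>

theorem mds_length_bound:
  fixes g :: "nat \<Rightarrow> 's \<Rightarrow> 'f::{finite,field}"
  assumes prime: "prime CARD('f)" and odd: "odd CARD('f)" and fin: "finite S"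
    and card: "card S = CARD('f) + 2" and mds: "mds S d g" and d: "2 \<le> d" "2 * d \<le> CARD('f) + 2"
  shows False
proof (cases "d = 2")
  case True
  then show False using mds_length_dim2 fin card mds by blast
next
  case False
  then have d3: "3 \<le> d" using d by simp
  obtain f where f: "\<And>C. \<exists>c. \<forall>s. f C s = (\<Sum>i<d. c i * g i s)"
    "\<And>C s. C \<subseteq> S \<Longrightarrow> Suc (card C) = d \<Longrightarrow> s \<in> C \<Longrightarrow> f C s = 0"
    "\<And>C s. C \<subseteq> S \<Longrightarrow> Suc (card C) = d \<Longrightarrow> s \<in> S - C \<Longrightarrow> f C s \<noteq> 0"
    "\<And>C D a b. C \<subseteq> S \<Longrightarrow> D \<subseteq> S \<Longrightarrow> Suc (card C) = d \<Longrightarrow> a \<notin> C \<Longrightarrow> b \<notin> D \<Longrightarrow> insert a C = insert b D \<Longrightarrow>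
       (f C a)\<^sup>2 = (f D b)\<^sup>2"
  proof (rule mds_functionals[OF fin mds])
    show "0 < d" using d3 by simp
  qed blast
  have "2 * d - 3 \<le> card S" using card d by simp
  \<comment> \<open>The size \<open>2 * d - 3\<close> is forced from both sides: interpolation at
    \<open>X - Y\<close> requires its size to exceed the degree \<open>d - 3\<close> by two, and
    \<open>inclusion_system_trivial\<close> allows at most \<open>d - 2\<close> elements in
    \<open>X - C\<close>.\<close>
  then obtain X where X: "X \<subseteq> S" "card X = 2 * d - 3" by (rule obtain_subset_with_card_n)
  have finX: "finite X" using X fin finite_subset by blast
  have "X \<noteq> S" using X card d by auto
  then obtain s0 where s0: "s0 \<in> S - X" using X by blast
  define \<beta> where "\<beta> C = inverse ((\<Prod>s\<in>S - C. f C s) * (\<Prod>z\<in>X - C. f C z))" for C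
  have "d - 1 \<le> card X" using X d3 by simp
  then obtain C where C: "C \<subseteq> X" "card C = d - 1" by (rule obtain_subset_with_card_n)
  have finC: "finite C" using C finX finite_subset by blast
  have "\<beta> C = 0"
  proof (rule inclusion_system_trivial[OF finX, of "d - 2"])
    show "(\<Sum>a\<in>X - Y. \<beta> (insert a Y)) = 0" if "Y \<subseteq> X" "card Y = d - 2" for Y
      unfolding \<beta>_def by (rule mds_interpolation[OF odd fin card mds d3 d(2) f X s0 that])
    show "(of_nat j :: 'f) \<noteq> 0" if "0 < j" "j \<le> Suc (d - 2)" for j
      using that d d3 by (intro of_nat_nonzero_below_prime_card[OF prime]) auto
    show "C \<subseteq> X" "card C = Suc (d - 2)" "card (X - C) \<le> d - 2"
      using C X finC d3 by (auto simp: card_Diff_subset)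
  qed
  moreover have "f C s \<noteq> 0" if "s \<in> S - C" for s using f(3)[of C s] C X d3 that by auto
  then have "\<beta> C \<noteq> 0" unfolding \<beta>_def using fin finX X by (auto simp: prod_zero_iff)
  ultimately show False by simp
qed

section \<open>Uniform matroids as MDS codes\<close>

context finite_field_space
begin

text \<open>For small \<open>k\<close> the code of linear relations among the elements is used, for large \<open>k\<close> the code of
  coordinates after contracting down to \<open>q + 2\<close> elements.\<close>

theorem uniform_length_bound:
  assumes prime: "prime CARD('f)" and odd: "odd CARD('f)" and fin: "finite E"
    and uni: "\<And>I. I \<subseteq> E \<Longrightarrow> independent I \<longleftrightarrow> card I \<le> r"
    and card: "card E = r - 2 + k" and r: "2 \<le> r" and k: "4 \<le> k" "k \<le> CARD('f)"
  shows "r - 2 + k \<le> CARD('f) + 1"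
proof (rule ccontr)
  let ?p = "CARD('f)"
  assume "\<not> ?thesis"
  then have big: "?p + 2 \<le> card E" using card by simp
  have spans: "E \<subseteq> span R" if R: "R \<subseteq> E" "card R = r" for R
  proof
    fix e assume e: "e \<in> E"
    show "e \<in> span R"
    proof (rule ccontr)
      assume n: "e \<notin> span R"
      then have "e \<notin> R" using span_base by blast
      moreover have "finite R" using R fin finite_subset by blast
      ultimately have "card (insert e R) = Suc r" using R by simp
      moreover have "independent (insert e R)" using independent_insertI[OF n] uni[OF R(1)] R by simp
      ultimately show False using uni[of "insert e R"] e R by simp
    qed
  qed
  have "r \<le> card E" using card k r by simp
  then obtain E0 where E0: "E0 \<subseteq> E" "card E0 = r" "finite E0" by (rule obtain_subset_with_card_n)
  have ind: "independent E0" using uni[OF E0(1)] E0 by simp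
  note sp = spans[OF E0(1,2)]
  let ?rep = "representation E0"
  have rep0: "?rep v b = 0" if "b \<notin> E0" for v b using representation_ne_zero that by blast
  show False
  \<comment> \<open>The two codes of length \<open>q + 2\<close> have dimensions
    \<open>k - 2\<close> and \<open>q + 4 - k\<close>, which add up to the length. So one of them is
    at most half of it, as \<open>mds_length_bound\<close> demands; dimension two or more is ensured
    by \<open>4 \<le> k\<close> and \<open>k \<le> q\<close> respectively.\<close>
  proof (cases "2 * (k - 2) \<le> ?p + 2")
    case True
    obtain S where S: "S \<subseteq> E" "card S = ?p + 2" "finite S" using big by (rule obtain_subset_with_card_n)
    let ?d = "k - 2"
    have "card (E - E0) = ?d" using E0 fin card r k by (simp add: card_Diff_subset)
    then obtain h where h: "bij_betw h {0..<?d} (E - E0)"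
      using ex_bij_betw_nat_finite[of "E - E0"] fin by auto
    \<comment> \<open>Coefficients of the fundamental relation of \<open>h i\<close> over the basis
      \<open>E0\<close>.\<close>
    define g where "g i s = (if s = h i then 1 else 0) - ?rep (h i) s" for i s
    have hE: "h i \<in> E" "h i \<notin> E0" if "i < ?d" for i using bij_betwE[OF h] that by auto
    have g_rel: "(\<Sum>s\<in>E. g i s *s s) = 0" if i: "i < ?d" for i
    proof -
      have "(\<Sum>s\<in>E. ?rep (h i) s *s s) = (\<Sum>s\<in>E0. ?rep (h i) s *s s)"
        by (rule sum.mono_neutral_right) (use fin E0 rep0 in auto)
      also have "\<dots> = h i"
        using sum_representation_eq[OF ind _ E0(3) subset_refl] sp hE[OF i] by blast
      finally have "(\<Sum>s\<in>E. ?rep (h i) s *s s) = h i" .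
      moreover have "(\<Sum>s\<in>E. (if s = h i then 1 else 0) *s s) = (\<Sum>s\<in>E. if s = h i then s else 0)"
        by (rule sum.cong) auto
      moreover have "\<dots> = h i" using hE[OF i] fin by simp
      ultimately show ?thesis by (simp add: g_def scale_left_diff_distrib sum_subtractf)
    qed
    have "mds S ?d g"
      unfolding mds_def
    proof (intro allI impI, rule ccontr)
      fix c assume "\<exists>i<?d. c i \<noteq> 0" and "\<not> card {s \<in> S. (\<Sum>i<?d. c i * g i s) = 0} < ?d"
      then obtain i0 where i0: "i0 < ?d" "c i0 \<noteq> 0" and ge: "?d \<le> card {s \<in> S. (\<Sum>i<?d. c i * g i s) = 0}" by auto
      define \<phi> where "\<phi> s = (\<Sum>i<?d. c i * g i s)" for s
      let ?Z = "{s \<in> S. \<phi> s = 0}"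
      let ?T = "{s \<in> E. \<phi> s \<noteq> 0}"
      have "\<phi> (h i0) = (\<Sum>i<?d. if i = i0 then c i else 0)"
        unfolding \<phi>_def
      proof (rule sum.cong)
        fix i assume i: "i \<in> {..<?d}"
        have "h i0 = h i \<longleftrightarrow> i = i0" using bij_betw_imp_inj_on[OF h] i i0(1) by (auto simp: inj_on_def)
        then show "c i * g i (h i0) = (if i = i0 then c i else 0)"
          using rep0[OF hE(2)[OF i0(1)]] by (auto simp: g_def)
      qed simp
      then have phi0: "\<phi> (h i0) \<noteq> 0" using i0 by simp
      have "card ?Z \<le> card E" using S fin by (intro card_mono) auto
      have "card ?T \<le> card (E - ?Z)" using fin by (intro card_mono) auto
      also have "\<dots> = card E - card ?Z" using S fin by (intro card_Diff_subset) auto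
      \<comment> \<open>With \<open>k - 2\<close> zeros the support has at most \<open>r\<close>
        elements; it is independent and cannot carry a nontrivial relation.\<close>
      finally have "card ?T \<le> r" using ge card r k unfolding \<phi>_def by simp
      then have indT: "independent ?T" using uni[of ?T] by simp
      have "(\<Sum>s\<in>E. \<phi> s *s s) = (\<Sum>s\<in>E. \<Sum>i<?d. c i *s g i s *s s)"
        unfolding \<phi>_def by (simp add: scale_sum_left)
      also have "\<dots> = (\<Sum>i<?d. \<Sum>s\<in>E. c i *s g i s *s s)" by (rule sum.swap)
      also have "\<dots> = (\<Sum>i<?d. c i *s (\<Sum>s\<in>E. g i s *s s))" by (simp only: scale_sum_right)
      also have "\<dots> = 0" using g_rel by simp
      finally have "(\<Sum>s\<in>E. \<phi> s *s s) = 0" .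
      moreover have "(\<Sum>s\<in>E. \<phi> s *s s) = (\<Sum>s\<in>?T. \<phi> s *s s)"
        by (rule sum.mono_neutral_right) (use fin in auto)
      ultimately have "(\<Sum>s\<in>?T. \<phi> s *s s) = 0" by simp
      from independentD[OF indT _ subset_refl this, of "h i0"] show False
        using fin hE[OF i0(1)] phi0 by simp
    qed
    moreover have "2 \<le> k - 2" using k by linarith
    ultimately show False using mds_length_bound[OF prime odd S(3,2) _ _ True] by blast
  next
    case False
    \<comment> \<open>Contracting \<open>m\<close> basis elements leaves \<open>q + 2\<close>
      elements of rank \<open>?d\<close>. The code consists of the functionals in the coordinates at
      the other basis elements.\<close>
    define m where "m = card E - (?p + 2)"
    let ?d = "?p + 4 - k"
    have rm: "r = m + ?d" using card big k r unfolding m_def by simp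
    then have "m \<le> card E0" using E0 by simp
    then obtain K where K: "K \<subseteq> E0" "card K = m" "finite K" by (rule obtain_subset_with_card_n)
    let ?S = "E - K"
    have cS: "card ?S = ?p + 2" using K E0 fin big by (simp add: card_Diff_subset m_def)
    have "card (E0 - K) = ?d" using K E0 rm by (simp add: card_Diff_subset)
    then obtain h where h: "bij_betw h {0..<?d} (E0 - K)"
      using ex_bij_betw_nat_finite[of "E0 - K"] E0 by auto
    have hE: "h i \<in> E0" "h i \<notin> K" if "i < ?d" for i using bij_betwE[OF h] that by auto
    define g where "g i s = ?rep s (h i)" for i s
    have "mds ?S ?d g"
      unfolding mds_def
    proof (intro allI impI, rule ccontr)
      fix c assume "\<exists>i<?d. c i \<noteq> 0" and "\<not> card {s \<in> ?S. (\<Sum>i<?d. c i * g i s) = 0} < ?d"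
      then obtain i0 where i0: "i0 < ?d" "c i0 \<noteq> 0" and ge: "?d \<le> card {s \<in> ?S. (\<Sum>i<?d. c i * g i s) = 0}" by auto
      define \<phi> where "\<phi> s = (\<Sum>i<?d. c i * g i s)" for s
      let ?Z = "{s \<in> ?S. \<phi> s = 0}"
      have "\<phi> (h i0) = (\<Sum>i<?d. if i = i0 then c i else 0)"
        unfolding \<phi>_def
      proof (rule sum.cong)
        fix i assume i: "i \<in> {..<?d}"
        have "h i = h i0 \<longleftrightarrow> i = i0" using bij_betw_imp_inj_on[OF h] i i0(1) by (auto simp: inj_on_def)
        then show "c i * g i (h i0) = (if i = i0 then c i else 0)"
          using representation_basis[OF ind hE(1)[OF i0(1)]] by (auto simp: g_def)
      qed simp
      then have phi0: "\<phi> (h i0) \<noteq> 0" using i0 by simp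
      have phiK: "\<phi> s = 0" if s: "s \<in> K" for s
      proof -
        have "g i s = 0" if "i < ?d" for i
          using representation_basis[OF ind, of s] s K hE(2)[OF that] by (auto simp: g_def)
        then show ?thesis by (simp add: \<phi>_def)
      qed
      have "card (?Z \<union> K) = card ?Z + card K"
        using fin K by (intro card_Un_disjoint) auto
      \<comment> \<open>Together with \<open>K\<close> the zeros include \<open>r\<close> elements,
        and these span \<open>E\<close>; so \<open>\<phi>\<close> would vanish at
        \<open>h i0\<close> as well.\<close>
      then have "r \<le> card (?Z \<union> K)" using ge K rm unfolding \<phi>_def by simp
      then obtain R where R: "R \<subseteq> ?Z \<union> K" "card R = r" by (rule obtain_subset_with_card_n)
      have RE: "R \<subseteq> E" using R K E0 by blast
      have "v \<in> span E0 \<and> \<phi> v = 0" if "v \<in> span R" for v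
        using that
      proof (induction rule: span_induct_alt)
        case base
        show ?case by (simp add: \<phi>_def g_def representation_zero span_zero)
      next
        case (step c' x y)
        have x: "x \<in> span E0" "\<phi> x = 0" using step(1) R RE sp phiK by auto
        have "?rep (c' *s x + y) b = c' * ?rep x b + ?rep y b" for b
          using x step ind by (simp add: representation_add representation_scale span_scale)
        then have "\<phi> (c' *s x + y) = c' * \<phi> x + \<phi> y"
          by (simp add: \<phi>_def g_def sum_distrib_left algebra_simps sum.distrib)
        then show ?case using x step by (simp add: span_add span_scale)
      qed
      moreover have "h i0 \<in> span R" using spans[OF RE R(2)] hE[OF i0(1)] E0 by blast
      ultimately show False using phi0 by blast
    qed
    moreover have "2 \<le> ?d" "2 * ?d \<le> ?p + 2" using False k by linarith+
    ultimately show False using mds_length_bound[OF prime odd _ cS] fin by blast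
  qed
qed

end

section \<open>Matroids and vector matroids\<close>

lemma is_matroidD:
  assumes "is_matroid M"
  shows matroid_finite: "finite (ground M)"
    and matroid_sub: "\<And>I. I \<in> indeps M \<Longrightarrow> I \<subseteq> ground M"
    and matroid_empty: "{} \<in> indeps M"
    and matroid_down: "\<And>I J. I \<in> indeps M \<Longrightarrow> J \<subseteq> I \<Longrightarrow> J \<in> indeps M"
    and matroid_augment: "\<And>I J. I \<in> indeps M \<Longrightarrow> J \<in> indeps M \<Longrightarrow> card I < card J \<Longrightarrow>
      \<exists>e\<in>J - I. insert e I \<in> indeps M"
  using assms unfolding is_matroid_def by blast+

lemma indep_finite: "is_matroid M \<Longrightarrow> I \<in> indeps M \<Longrightarrow> finite I"
  using matroid_sub matroid_finite finite_subset by blast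

lemma finite_indep_subsets: "is_matroid M \<Longrightarrow> finite {I \<in> indeps M. I \<subseteq> X}"
  by (rule finite_subset[of _ "Pow (ground M)"]) (auto dest: matroid_sub matroid_finite)

lemma rk_ge: "is_matroid M \<Longrightarrow> I \<in> indeps M \<Longrightarrow> I \<subseteq> X \<Longrightarrow> card I \<le> rk M X"
  unfolding rk_def using finite_indep_subsets[of M X] by (intro Max_ge) auto

lemma rk_witness:
  assumes "is_matroid M" obtains I where "I \<in> indeps M" "I \<subseteq> X" "card I = rk M X"
proof -
  have "rk M X \<in> card ` {I \<in> indeps M. I \<subseteq> X}"
    unfolding rk_def using finite_indep_subsets[OF assms, of X] matroid_empty[OF assms]
    by (intro Max_in) auto
  then show ?thesis using that by auto
qed

lemma rk_eqI:
  assumes "is_matroid M" "I \<in> indeps M" "I \<subseteq> X" "\<And>x. x \<in> X - I \<Longrightarrow> insert x I \<notin> indeps M"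
  shows "rk M X = card I"
proof (rule antisym)
  obtain J where J: "J \<in> indeps M" "J \<subseteq> X" "card J = rk M X" using rk_witness[OF assms(1)] .
  show "rk M X \<le> card I"
  proof (rule ccontr)
    assume "\<not> ?thesis"
    then obtain e where "e \<in> J - I" "insert e I \<in> indeps M"
      using matroid_augment[OF assms(1,2) J(1)] J(3) by auto
    then show False using assms(4) J(2) by blast
  qed
qed (use rk_ge assms in blast)

lemma indep_extend:
  assumes M: "is_matroid M" and I: "I \<in> indeps M" and J: "J \<in> indeps M" and le: "card I \<le> card J"
  obtains K where "I \<subseteq> K" "K \<subseteq> I \<union> J" "K \<in> indeps M" "card K = card J"
  using I le
proof (induction "card J - card I" arbitrary: I thesis)
  case 0
  then show ?case by (metis diff_is_0_eq le_antisym subset_refl sup_ge1)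
next
  case (Suc n)
  then have "card I < card J" by simp
  then obtain e where e: "e \<in> J - I" "insert e I \<in> indeps M" using matroid_augment[OF M Suc.prems(2) J] by blast
  have c: "card (insert e I) = Suc (card I)" using e indep_finite[OF M Suc.prems(2)] by simp
  obtain K where "insert e I \<subseteq> K" "K \<subseteq> insert e I \<union> J" "K \<in> indeps M" "card K = card J"
    using Suc.hyps(1)[of "insert e I"] Suc.hyps(2) e c Suc.prems by force
  then show ?case using Suc.prems(1)[of K] e by blast
qed

lemma basis_of_iff:
  assumes "is_matroid M"
  shows "basis_of M X B \<longleftrightarrow> B \<in> indeps M \<and> B \<subseteq> X \<and> card B = rk M X"
proof
  assume B: "basis_of M X B"
  then have "insert x B \<notin> indeps M" if "x \<in> X - B" for x
    using that unfolding basis_of_def by blast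
  then show "B \<in> indeps M \<and> B \<subseteq> X \<and> card B = rk M X"
    using rk_eqI[OF assms] B unfolding basis_of_def by metis
next
  assume B: "B \<in> indeps M \<and> B \<subseteq> X \<and> card B = rk M X"
  have "I = B" if I: "I \<in> indeps M" "B \<subseteq> I" "I \<subseteq> X" for I
    using rk_ge[OF assms I(1,3)] B I indep_finite[OF assms I(1)] by (metis card_seteq)
  then show "basis_of M X B" unfolding basis_of_def using B by blast
qed

lemma cl_iff:
  assumes M: "is_matroid M" and I: "I \<in> indeps M" "I \<subseteq> X" "card I = rk M X" and e: "e \<in> ground M"
  shows "e \<in> cl M X \<longleftrightarrow> e \<in> I \<or> insert e I \<notin> indeps M"
proof
  assume h: "e \<in> cl M X"
  show "e \<in> I \<or> insert e I \<notin> indeps M"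
  proof (rule ccontr)
    assume "\<not> ?thesis"
    then have n: "e \<notin> I" "insert e I \<in> indeps M" by auto
    have "insert e I \<subseteq> insert e X" using I(2) by blast
    then have "card (insert e I) \<le> rk M (insert e X)" using rk_ge[OF M n(2)] by blast
    then show False using h I(3) n indep_finite[OF M I(1)] unfolding cl_def by simp
  qed
next
  assume h: "e \<in> I \<or> insert e I \<notin> indeps M"
  have "rk M (insert e X) = card I"
  proof (rule rk_eqI[OF M I(1)])
    show "insert x I \<notin> indeps M" if x: "x \<in> insert e X - I" for x
    proof
      assume xi: "insert x I \<in> indeps M"
      then have "x \<noteq> e" using h x by auto
      then have "insert x I \<subseteq> X" using x I(2) by blast
      then show False using rk_ge[OF M xi] I(3) x indep_finite[OF M I(1)] by fastforce
    qed
  qed (use I(2) in blast)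
  then show "e \<in> cl M X" unfolding cl_def using e I(3) by simp
qed

lemma cl_superset: "X \<subseteq> ground M \<Longrightarrow> X \<subseteq> cl M X"
  unfolding cl_def by (auto simp: insert_absorb)

lemma cl_subset: "cl M X \<subseteq> ground M"
  unfolding cl_def by blast

lemma cl_ground: "e \<in> cl M X \<Longrightarrow> e \<in> ground M"
  unfolding cl_def by blast

lemma cl_mono: assumes M: "is_matroid M" and "X \<subseteq> Y" shows "cl M X \<subseteq> cl M Y"
proof
  fix e assume e: "e \<in> cl M X"
  then have eg: "e \<in> ground M" by (rule cl_ground)
  obtain I where I: "I \<in> indeps M" "I \<subseteq> X" "card I = rk M X" using rk_witness[OF M] .
  obtain J where J: "J \<in> indeps M" "J \<subseteq> Y" "card J = rk M Y" using rk_witness[OF M] .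
  have "card I \<le> card J" using rk_ge[OF M I(1), of Y] I(2) assms(2) J(3) by auto
  then obtain K where K: "I \<subseteq> K" "K \<subseteq> I \<union> J" "K \<in> indeps M" "card K = card J"
    using indep_extend[OF M I(1) J(1)] by blast
  have KY: "K \<subseteq> Y" using K(2) I(2) J(2) assms(2) by blast
  have "e \<in> I \<or> insert e I \<notin> indeps M" using cl_iff[OF M I eg] e by blast
  then have "e \<in> K \<or> insert e K \<notin> indeps M"
    using K(1) matroid_down[OF M, of "insert e K" "insert e I"] by blast
  then show "e \<in> cl M Y" using cl_iff[OF M K(3) KY _ eg] K(4) J(3) by simp
qed

lemma cl_idem: assumes M: "is_matroid M" and X: "X \<subseteq> ground M" shows "cl M (cl M X) = cl M X"
proof -
  obtain I where I: "I \<in> indeps M" "I \<subseteq> X" "card I = rk M X" using rk_witness[OF M] .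
  have Ic: "I \<subseteq> cl M X" using I(2) cl_superset[OF X] by blast
  have max: "insert x I \<notin> indeps M" if "x \<in> cl M X - I" for x
    using cl_iff[OF M I cl_ground[of x M X]] that by blast
  have r: "card I = rk M (cl M X)" using rk_eqI[OF M I(1) Ic max] by simp
  have "e \<in> cl M (cl M X) \<longleftrightarrow> e \<in> cl M X" if "e \<in> ground M" for e
    by (rule trans[OF cl_iff[OF M I(1) Ic r that] cl_iff[OF M I that, symmetric]])
  then show ?thesis by (intro Set.set_eqI) (metis cl_ground)
qed

lemma flat_cl: "is_matroid M \<Longrightarrow> X \<subseteq> ground M \<Longrightarrow> flat M (cl M X)"
  unfolding flat_def by (simp add: cl_idem cl_subset)

lemma cl_eq_Inter_flats:
  assumes M: "is_matroid M" and X: "X \<subseteq> ground M"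
  shows "cl M X = \<Inter>{F. F \<subseteq> ground M \<and> flat M F \<and> X \<subseteq> F}"
proof
  show "cl M X \<subseteq> \<Inter>{F. F \<subseteq> ground M \<and> flat M F \<and> X \<subseteq> F}"
    using cl_mono[OF M, of X] unfolding flat_def by blast
  show "\<Inter>{F. F \<subseteq> ground M \<and> flat M F \<and> X \<subseteq> F} \<subseteq> cl M X"
    using flat_cl[OF M X] cl_superset[OF X] cl_subset[of M X] by (intro Inter_lower) simp
qed

lemma indep_iff_cl:
  assumes M: "is_matroid M"
  shows "I \<in> indeps M \<longleftrightarrow> I \<subseteq> ground M \<and> (\<forall>x\<in>I. x \<notin> cl M (I - {x}))"
proof (intro iffI conjI ballI)
  assume I: "I \<in> indeps M"
  then show sub: "I \<subseteq> ground M" using matroid_sub[OF M] by blast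
  fix x assume x: "x \<in> I"
  have J: "I - {x} \<in> indeps M" using matroid_down[OF M I] by blast
  have "rk M (I - {x}) = card (I - {x})" by (rule rk_eqI[OF M J]) auto
  then show "x \<notin> cl M (I - {x})"
    using cl_iff[OF M J subset_refl _ subsetD[OF sub x]] I x by (simp add: insert_absorb)
next
  assume h: "I \<subseteq> ground M \<and> (\<forall>x\<in>I. x \<notin> cl M (I - {x}))"
  obtain B where B: "B \<in> indeps M" "B \<subseteq> I" "card B = rk M I" using rk_witness[OF M] .
  show "I \<in> indeps M"
  proof (rule ccontr)
    assume "I \<notin> indeps M"
    then have "B \<noteq> I" using B(1) by blast
    then obtain x where x: "x \<in> I" "x \<notin> B" using B(2) by blast
    have nin: "insert y B \<notin> indeps M" if "y \<in> I - B" for y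
      using rk_ge[OF M, of "insert y B" I] that B indep_finite[OF M B(1)] by fastforce
    have Bx: "B \<subseteq> I - {x}" using B(2) x(2) by blast
    have "rk M (I - {x}) = card B" using nin by (intro rk_eqI[OF M B(1) Bx]) blast
    moreover have "x \<in> ground M" using h x by blast
    ultimately have "x \<in> cl M (I - {x})" using cl_iff[OF M B(1) Bx] nin x by auto
    then show False using h x by blast
  qed
qed

text \<open>The closure of a set is the intersection of the flats above it, and
  \<open>indep_iff_cl\<close> recovers independence from closure. This is what allows
  \<open>gen_par_conn\<close> to prescribe flats.\<close>

lemma matroid_eqI_flats:
  assumes M: "is_matroid M" and N: "is_matroid N" and g: "ground M = ground N"
    and fl: "\<And>F. F \<subseteq> ground M \<Longrightarrow> flat M F \<longleftrightarrow> flat N F"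
  shows "M = N"
proof -
  have "{F. F \<subseteq> ground M \<and> flat M F \<and> X \<subseteq> F} = {F. F \<subseteq> ground N \<and> flat N F \<and> X \<subseteq> F}" for X
    using fl g by auto
  then have "cl M X = cl N X" if "X \<subseteq> ground M" for X
    using cl_eq_Inter_flats[OF M that] cl_eq_Inter_flats[OF N] that g by simp
  then have "I \<in> indeps M \<longleftrightarrow> I \<in> indeps N" for I
    unfolding indep_iff_cl[OF M] indep_iff_cl[OF N] g[symmetric] by (metis Diff_subset order_trans)
  then have "indeps M = indeps N" by blast
  then show ?thesis using g by (cases M; cases N) simp
qed

section \<open>Restrictions and vector matroids\<close>

lemma ground_restr [simp]: "ground (restr M X) = X"
  by (simp add: restr_def)

lemma indeps_restr [simp]: "indeps (restr M X) = {I \<in> indeps M. I \<subseteq> X}"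
  by (simp add: restr_def)

lemma is_matroid_restr:
  assumes M: "is_matroid M" and X: "X \<subseteq> ground M" shows "is_matroid (restr M X)"
  unfolding is_matroid_def
proof (intro conjI ballI allI impI)
  show "finite (ground (restr M X))" using finite_subset[OF X matroid_finite[OF M]] by simp
  show "indeps (restr M X) \<subseteq> Pow (ground (restr M X))" by auto
  show "{} \<in> indeps (restr M X)" using matroid_empty[OF M] by simp
  show "J \<in> indeps (restr M X)" if "I \<in> indeps (restr M X)" "J \<subseteq> I" for I J
    using that matroid_down[OF M] by auto
  show "\<exists>e\<in>J - I. insert e I \<in> indeps (restr M X)"
    if h: "I \<in> indeps (restr M X)" "J \<in> indeps (restr M X)" "card I < card J" for I J
  proof -
    from h obtain e where "e \<in> J - I" "insert e I \<in> indeps M"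
      using matroid_augment[OF M, of I J] by auto
    then show ?thesis using h by auto
  qed
qed

lemma rk_restr: "Y \<subseteq> X \<Longrightarrow> rk (restr M X) Y = rk M Y"
  unfolding rk_def by (rule arg_cong[of _ _ "\<lambda>S. Max (card ` S)"]) auto

lemma ground_vector_matroid [simp]: "ground (vector_matroid E \<phi>) = E"
  by (simp add: vector_matroid_def)

lemma indeps_vector_matroid:
  "I \<in> indeps (vector_matroid E \<phi>) \<longleftrightarrow> I \<subseteq> E \<and> inj_on \<phi> I \<and> fvec.independent (\<phi> ` I)"
  by (simp add: vector_matroid_def)

lemma restr_vector_matroid: "X \<subseteq> E \<Longrightarrow> restr (vector_matroid E \<phi>) X = vector_matroid X \<phi>"
  by (auto simp: restr_def vector_matroid_def)

lemma vector_matroid_insert_indep: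
  assumes I: "I \<in> indeps (vector_matroid E \<phi>)" and e: "e \<in> E"
  shows "e \<in> I \<or> insert e I \<notin> indeps (vector_matroid E \<phi>) \<longleftrightarrow> \<phi> e \<in> fvec.span (\<phi> ` I)"
proof (cases "e \<in> I")
  case True
  then show ?thesis by (auto intro: fvec.span_base)
next
  case False
  have I': "I \<subseteq> E" "inj_on \<phi> I" "fvec.independent (\<phi> ` I)" using I by (auto simp: indeps_vector_matroid)
  show ?thesis
  proof (cases "\<phi> e \<in> \<phi> ` I")
    case True
    then have "\<not> inj_on \<phi> (insert e I)" using False by (auto simp: inj_on_insert)
    then show ?thesis using True by (auto simp: indeps_vector_matroid intro: fvec.span_base)
  next
    case n: False
    then have "inj_on \<phi> (insert e I)" using I'(2) False by (simp add: inj_on_insert)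
    moreover have "fvec.independent (insert (\<phi> e) (\<phi> ` I)) \<longleftrightarrow> \<phi> e \<notin> fvec.span (\<phi> ` I)"
      using fvec.independent_insert[of "\<phi> e" "\<phi> ` I"] n I'(3) by simp
    ultimately show ?thesis using False I' e by (simp add: indeps_vector_matroid)
  qed
qed

lemma span_basis_vector_matroid:
  assumes I: "I \<in> indeps (vector_matroid E \<phi>)" "I \<subseteq> X" "X \<subseteq> E"
    and max: "\<And>x. x \<in> X - I \<Longrightarrow> insert x I \<notin> indeps (vector_matroid E \<phi>)"
  shows "fvec.span (\<phi> ` I) = fvec.span (\<phi> ` X)"
proof
  show "fvec.span (\<phi> ` I) \<subseteq> fvec.span (\<phi> ` X)" using I by (intro fvec.span_mono) auto
  have "\<phi> x \<in> fvec.span (\<phi> ` I)" if "x \<in> X" for x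
    using vector_matroid_insert_indep[OF I(1), of x] max[of x] that I by blast
  then show "fvec.span (\<phi> ` X) \<subseteq> fvec.span (\<phi> ` I)"
    by (intro fvec.span_minimal) auto
qed

lemma cl_vector_matroid:
  assumes M: "is_matroid (vector_matroid E \<phi>)" and X: "X \<subseteq> E"
  shows "cl (vector_matroid E \<phi>) X = {e \<in> E. \<phi> e \<in> fvec.span (\<phi> ` X)}"
proof -
  let ?M = "vector_matroid E \<phi>"
  obtain I where I: "I \<in> indeps ?M" "I \<subseteq> X" "card I = rk ?M X" using rk_witness[OF M] .
  have max: "insert x I \<notin> indeps ?M" if "x \<in> X - I" for x
    using rk_ge[OF M, of "insert x I" X] that I indep_finite[OF M I(1)] by fastforce
  have "e \<in> cl ?M X \<longleftrightarrow> \<phi> e \<in> fvec.span (\<phi> ` X)" if "e \<in> E" for e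
    using cl_iff[OF M I, of e] vector_matroid_insert_indep[OF I(1) that] that
      span_basis_vector_matroid[OF I(1,2) X max] by simp
  then show ?thesis using cl_subset[of ?M X] by auto
qed

lemma flat_vector_matroid:
  assumes M: "is_matroid (vector_matroid E \<phi>)"
  shows "flat (vector_matroid E \<phi>) F \<longleftrightarrow> F \<subseteq> E \<and> (\<forall>e\<in>E. \<phi> e \<in> fvec.span (\<phi> ` F) \<longrightarrow> e \<in> F)"
proof (cases "F \<subseteq> E")
  case True
  then show ?thesis using cl_superset[of F "vector_matroid E \<phi>"]
    unfolding flat_def cl_vector_matroid[OF M True] by auto
qed (auto simp: flat_def)

lemma simple_vector_matroid:
  assumes "is_simple (vector_matroid E \<phi>)"
  shows "inj_on \<phi> E" and "\<And>x y. x \<in> \<phi> ` E \<Longrightarrow> y \<in> \<phi> ` E \<Longrightarrow> fvec.independent {x, y}"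
proof -
  have h: "inj_on \<phi> {x, y}" "fvec.independent (\<phi> ` {x, y})" if "x \<in> E" "y \<in> E" for x y
    using assms that unfolding is_simple_def indeps_vector_matroid by auto
  show "inj_on \<phi> E"
  proof (rule inj_onI)
    fix x y assume "x \<in> E" "y \<in> E" "\<phi> x = \<phi> y"
    then show "x = y" using inj_onD[OF h(1)[of x y], of x y] by simp
  qed
  show "fvec.independent {x, y}" if "x \<in> \<phi> ` E" "y \<in> \<phi> ` E" for x y
    using that h(2) by auto
qed

lemma simple_multiple:
  assumes simple: "is_simple (vector_matroid E \<phi>)" and e: "e \<in> E" "t \<in> E" "\<phi> e = (\<lambda>i. c * \<phi> t i)"
  shows "e = t"
proof -
  note sm = simple_vector_matroid[OF simple]
  have sp: "\<phi> e \<in> fvec.span {\<phi> t}"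
    by (subst e(3), rule fvec.span_scale, rule fvec.span_base, simp)
  have "\<phi> e = \<phi> t"
  proof (rule ccontr)
    assume "\<phi> e \<noteq> \<phi> t"
    then show False
      using sm(2)[of "\<phi> e" "\<phi> t"] e(1,2) sp fvec.independent_insert[of "\<phi> e" "{\<phi> t}"] by simp
  qed
  then show ?thesis using inj_onD[OF sm(1)] e by blast
qed

lemma simple_restr: "is_simple M \<Longrightarrow> X \<subseteq> ground M \<Longrightarrow> is_simple (restr M X)"
  unfolding is_simple_def by auto

section \<open>Projective geometries\<close>

global_interpretation ffs: finite_field_space "\<lambda>(c :: 'f::{finite,field}) (v :: nat \<Rightarrow> 'f) i. c * v i"
  by unfold_locales

global_interpretation fvp: vector_space_pair
  "\<lambda>(c :: 'f::field) (v :: nat \<Rightarrow> 'f) i. c * v i" "\<lambda>(c :: 'f::field) (v :: nat \<Rightarrow> 'f) i. c * v i"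
  by unfold_locales

context finite_field_space
begin

lemma card_span_independent:
  assumes "finite B" "independent B" shows "finite (span B) \<and> card (span B) = CARD('f) ^ card B"
  using assms
proof (induction B rule: finite_induct)
  case (insert b B)
  have b: "b \<notin> span B" and ind: "independent B"
    using insert.prems insert.hyps by (simp_all add: independent_insert)
  let ?h = "\<lambda>(c, v). c *s b + v"
  have "inj_on ?h (UNIV \<times> span B)"
  proof (rule inj_onI, clarify)
    fix c v c' v' assume h: "v \<in> span B" "v' \<in> span B" "c *s b + v = c' *s b + v'"
    have "(c - c') *s b = v' - v" using h(3) by (simp add: algebra_simps)
    then have "(c - c') *s b \<in> span B" using h by (simp add: span_diff)
    then have "c = c'" using b scale_mem_iff[OF subspace_span, of "c - c'" b B] by auto
    then show "c = c' \<and> v = v'" using h by simp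
  qed
  moreover have "?h ` (UNIV \<times> span B) = span (insert b B)"
  proof (intro Set.set_eqI iffI)
    fix x assume "x \<in> span (insert b B)"
    then obtain k where "x - k *s b \<in> span B" using span_breakdown_eq by blast
    then have "x = ?h (k, x - k *s b)" "(k, x - k *s b) \<in> UNIV \<times> span B" by auto
    then show "x \<in> ?h ` (UNIV \<times> span B)" by (rule image_eqI)
  next
    fix x assume "x \<in> ?h ` (UNIV \<times> span B)"
    then obtain c v where cv: "x = c *s b + v" "v \<in> span B" by auto
    then have "x - c *s b \<in> span B" by simp
    then show "x \<in> span (insert b B)" using span_breakdown_eq by blast
  qed
  moreover have "finite (span B)" "card (span B) = CARD('f) ^ card B" using insert.IH[OF ind] by auto
  ultimately have "finite (span (insert b B))" "card (span (insert b B)) = CARD('f) * CARD('f) ^ card B"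
    by (metis finite_SigmaI finite finite_imageI, metis card_image card_cartesian_product)
  then show ?case using insert.hyps by simp
qed simp

lemma not_independent_pair:
  assumes "\<not> independent {x, y}" "x \<noteq> y" "y \<noteq> 0"
  obtains c where "x = c *s y"
proof -
  have "x \<in> span {y}" using assms by (simp add: independent_insert split: if_splits)
  then show ?thesis using that by (auto simp: span_singleton)
qed

lemma pt_0_iff: "pt E {0} z \<longleftrightarrow> z \<noteq> 0 \<and> (\<exists>e\<in>E. \<exists>c. z = c *s e)"
  by (auto simp: pt_def)

end

definition unit_seq :: "nat \<Rightarrow> nat \<Rightarrow> 'f::field" where
  "unit_seq i = (\<lambda>j. if j = i then 1 else 0)"

lemma inj_unit_seq: "inj unit_seq"
  by (rule injI) (metis unit_seq_def zero_neq_one)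

lemma span_unit_seq: "fvec.span (unit_seq ` {..<r}) = (coord_space r :: (nat \<Rightarrow> 'f::field) set)"
proof
  show "fvec.span (unit_seq ` {..<r}) \<subseteq> (coord_space r :: (nat \<Rightarrow> 'f) set)"
  proof (rule fvec.span_minimal)
    show "fvec.subspace (coord_space r)" by (auto simp: fvec.subspace_def coord_space_def)
  qed (auto simp: coord_space_def unit_seq_def)
  show "coord_space r \<subseteq> fvec.span (unit_seq ` {..<r} :: (nat \<Rightarrow> 'f) set)"
  proof
    fix v :: "nat \<Rightarrow> 'f" assume v: "v \<in> coord_space r"
    have "v = (\<Sum>i<r. (\<lambda>j. v i * unit_seq i j))"
    proof
      fix j
      have "(\<Sum>i<r. (\<lambda>j. v i * unit_seq i j)) j = (\<Sum>i<r. v i * unit_seq i j)"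
        by (induction r) auto
      also have "\<dots> = (\<Sum>i<r. if i = j then v i else 0)" by (rule sum.cong) (auto simp: unit_seq_def)
      also have "\<dots> = v j" using v by (simp add: coord_space_def)
      finally show "v j = (\<Sum>i<r. (\<lambda>j. v i * unit_seq i j)) j" by simp
    qed
    also have "\<dots> \<in> fvec.span (unit_seq ` {..<r})"
      by (intro fvec.span_sum fvec.span_scale fvec.span_base) auto
    finally show "v \<in> fvec.span (unit_seq ` {..<r})" .
  qed
qed

lemma independent_unit_seq: "fvec.independent (unit_seq ` {..<r} :: (nat \<Rightarrow> 'f::field) set)"
proof (induction r)
  case (Suc r)
  have "unit_seq r \<notin> (coord_space r :: (nat \<Rightarrow> 'f) set)" by (auto simp: coord_space_def unit_seq_def)
  then show ?case using Suc unfolding lessThan_Suc image_insert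
    by (intro fvec.independent_insertI) (simp_all add: span_unit_seq)
qed (simp add: fvec.independent_empty)

lemma card_coord_space:
  "finite (coord_space r :: (nat \<Rightarrow> 'f::{finite,field}) set) \<and> card (coord_space r :: (nat \<Rightarrow> 'f) set) = CARD('f) ^ r"
  using ffs.card_span_independent[OF _ independent_unit_seq[of r]]
  by (simp add: span_unit_seq card_image[OF inj_on_subset[OF inj_unit_seq]])

lemma indep_singleton: "{x} \<in> indeps (vector_matroid E \<phi>) \<longleftrightarrow> x \<in> E \<and> \<phi> x \<noteq> 0"
  by (simp add: indeps_vector_matroid)

text \<open>The isomorphism need not come from a linear map, so the proof counts. Isomorphism bounds
  the rank by \<open>r\<close>, hence the span by \<open>q ^ r\<close> vectors. There are at least
  \<open>(q ^ r - 1) / (q - 1)\<close> elements, and their nonzero multiples are distinct, so these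
  multiples exhaust the nonzero vectors of the span.\<close>

lemma projective_geometry_full:
  fixes \<phi> :: "'a \<Rightarrow> nat \<Rightarrow> 'f::{finite,field}"
  assumes M: "is_matroid (vector_matroid T \<phi>)" and simple: "is_simple (vector_matroid T \<phi>)"
    and pg: "projective_geometry TYPE('f) (vector_matroid T \<phi>)"
    and z: "z \<in> fvec.span (\<phi> ` T)" "z \<noteq> 0"
  shows "ffs.pt (\<phi> ` T) {0} z"
proof -
  let ?N = "vector_matroid T \<phi>"
  from pg obtain r P where P: "simplification (vector_matroid (coord_space r :: (nat \<Rightarrow> 'f) set) id) P" "isomorphic ?N P"
    unfolding projective_geometry_def by blast
  let ?V = "vector_matroid (coord_space r :: (nat \<Rightarrow> 'f) set) id"
  from P(1)[unfolded simplification_def] obtain S where S': "S \<subseteq> {x \<in> ground ?V. {x} \<in> indeps ?V}"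
    and S2: "P = restr ?V S"
    and uniq: "\<forall>x\<in>ground ?V. {x} \<in> indeps ?V \<longrightarrow> (\<exists>!s. s \<in> S \<and> parallel ?V x s)"
    by (elim exE conjE)
  have S: "S \<subseteq> coord_space r" "P = restr ?V S" using S' S2 by auto
  have rep: "\<exists>s\<in>S. parallel ?V x s" if "x \<in> coord_space r" "x \<noteq> 0" for x
  proof -
    have "\<exists>!s. s \<in> S \<and> parallel ?V x s" using uniq that by (simp add: indep_singleton)
    then show ?thesis by (auto elim: ex1E)
  qed
  from P(2) obtain f where f: "bij_betw f T S"
    "\<And>X. X \<subseteq> T \<Longrightarrow> X \<in> indeps ?N \<longleftrightarrow> f ` X \<in> indeps P"
    unfolding isomorphic_def S(2) by auto
  have finT: "finite T" using matroid_finite[OF M] by simp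
  have cTS: "card T = card S" using f(1) by (rule bij_betw_same_card)
  have finS: "finite S" using f(1) finT bij_betw_finite by blast
  let ?U = "UNIV - {0 :: 'f}"
  let ?h = "\<lambda>(c :: 'f, s :: nat \<Rightarrow> 'f) i. c * s i"
  have "coord_space r - {0} \<subseteq> ?h ` (?U \<times> S)"
  proof
    fix x :: "nat \<Rightarrow> 'f" assume x: "x \<in> coord_space r - {0}"
    then obtain s where s: "s \<in> S" "parallel ?V x s" using rep by blast
    have "\<exists>c. x = (\<lambda>i. c * s i)"
    proof (cases "x = s")
      case True
      then show ?thesis by (intro exI[of _ 1]) simp
    next
      case False
      then have "{x, s} \<notin> indeps ?V" "s \<noteq> 0" using s(2) unfolding parallel_def by (auto simp: indep_singleton)
      then have "\<not> fvec.independent {x, s}" using x s S by (auto simp: indeps_vector_matroid)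
      from ffs.not_independent_pair[OF this False \<open>s \<noteq> 0\<close>] show ?thesis by blast
    qed
    then obtain c where c: "x = (\<lambda>i. c * s i)" by blast
    then have "c \<noteq> 0" using x by auto
    then show "x \<in> ?h ` (?U \<times> S)" using c s by (intro image_eqI[of _ _ "(c, s)"]) auto
  qed
  then have "card (coord_space r - {0 :: nat \<Rightarrow> 'f}) \<le> card (?U \<times> S)"
    using finS card_image_le[of "?U \<times> S" ?h] card_mono[of "?h ` (?U \<times> S)" "coord_space r - {0}"] by simp
  moreover have "0 \<in> (coord_space r :: (nat \<Rightarrow> 'f) set)" by (simp add: coord_space_def)
  ultimately have lower: "CARD('f) ^ r - 1 \<le> card (?U \<times> T)"
    using card_coord_space[where ?'f = 'f, of r] cTS by (simp add: card_cartesian_product)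
  obtain I where I: "I \<in> indeps ?N" "I \<subseteq> T" "card I = rk ?N T" using rk_witness[OF M] .
  have "insert x I \<notin> indeps ?N" if "x \<in> T - I" for x
    using rk_ge[OF M, of "insert x I" T] that I indep_finite[OF M I(1)] by fastforce
  then have spI: "fvec.span (\<phi> ` I) = fvec.span (\<phi> ` T)"
    using span_basis_vector_matroid[OF I(1,2)] by blast
  have I': "inj_on \<phi> I" "fvec.independent (\<phi> ` I)" "finite I"
    using I(1) indep_finite[OF M] by (auto simp: indeps_vector_matroid)
  have "f ` I \<in> indeps P" using f(2)[OF I(2)] I(1) by blast
  then have fI: "f ` I \<subseteq> coord_space r" "fvec.independent (f ` I)" unfolding S(2) by (auto simp: indeps_vector_matroid)
  have "card (f ` I) \<le> card (unit_seq ` {..<r} :: (nat \<Rightarrow> 'f) set)"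
    using fvec.independent_span_bound[OF _ fI(2), of "unit_seq ` {..<r}"] fI(1) by (simp add: span_unit_seq)
  also have "\<dots> \<le> r" using card_image_le[of "{..<r}" unit_seq] by simp
  also have "card (f ` I) = card I" using f(1) I(2) by (meson bij_betw_def card_image inj_on_subset)
  finally have "card I \<le> r" .
  moreover have cs: "finite (fvec.span (\<phi> ` I))" "card (fvec.span (\<phi> ` I)) = CARD('f) ^ card I"
    using ffs.card_span_independent[OF _ I'(2)] I' by (auto simp: card_image)
  moreover have "CARD('f) > 0" by simp
  ultimately have "card (fvec.span (\<phi> ` T)) \<le> CARD('f) ^ r" using spI by (simp add: power_increasing)
  then have upper: "card (fvec.span (\<phi> ` T) - {0}) \<le> card (?U \<times> T)"
    using lower by (simp add: card_Diff_singleton fvec.span_zero)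
  let ?k = "\<lambda>(c :: 'f, t) i. c * \<phi> t i"
  note sm = simple_vector_matroid[OF simple]
  have nz: "\<phi> t \<noteq> 0" if "t \<in> T" for t using sm(2)[of "\<phi> t" "\<phi> t"] that by simp
  have inj: "inj_on ?k (?U \<times> T)"
  proof (rule inj_onI)
    fix x y assume xy: "x \<in> ?U \<times> T" "y \<in> ?U \<times> T" "?k x = ?k y"
    obtain c t c' t' where e: "x = (c, t)" "y = (c', t')" by (cases x, cases y) blast
    then have h: "c \<noteq> 0" "t \<in> T" "c' \<noteq> 0" "t' \<in> T" "(\<lambda>i. c * \<phi> t i) = (\<lambda>i. c' * \<phi> t' i)"
      using xy by auto
    have "\<phi> t = (\<lambda>i. (c' / c) * \<phi> t' i)"
    proof
      fix i show "\<phi> t i = (c' / c) * \<phi> t' i" using fun_cong[OF h(5), of i] h(1) by (simp add: field_simps)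
    qed
    then have "t = t'" using simple_multiple[OF simple] h by blast
    moreover have "c = c'"
    proof -
      from nz[OF h(2)] obtain i where "\<phi> t i \<noteq> 0" by (auto simp: fun_eq_iff)
      then show ?thesis using fun_cong[OF h(5), of i] \<open>t = t'\<close> by simp
    qed
    ultimately show "x = y" using e by simp
  qed
  have sub: "?k ` (?U \<times> T) \<subseteq> fvec.span (\<phi> ` T) - {0}"
  proof
    fix x assume "x \<in> ?k ` (?U \<times> T)"
    then obtain c t where h: "t \<in> T" "(c :: 'f) \<noteq> 0" "x = (\<lambda>i. c * \<phi> t i)" by auto
    have "x \<noteq> 0" unfolding h(3) using nz[OF h(1)] h(2) fvec.scale_eq_0_iff[of c "\<phi> t"] by simp
    moreover have "x \<in> fvec.span (\<phi> ` T)"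
      unfolding h(3) using h(1) by (intro fvec.span_scale fvec.span_base) auto
    ultimately show "x \<in> fvec.span (\<phi> ` T) - {0}" by simp
  qed
  have "?k ` (?U \<times> T) = fvec.span (\<phi> ` T) - {0}"
    using card_seteq[OF _ sub] upper cs(1) spI card_image[OF inj] by simp
  then have "z \<in> ?k ` (?U \<times> T)" using z by simp
  then show ?thesis using z(2) by (auto simp: ffs.pt_0_iff)
qed

text \<open>A linear map \<open>\<psi>\<close> taking a basis of the span to unit vectors carries
  the elements to exactly one representative of each point of \<open>coord_space r\<close>, which is
  a choice that \<open>simplification\<close> admits.\<close>

lemma full_projective_geometry:
  fixes \<phi> :: "'a \<Rightarrow> nat \<Rightarrow> 'f::{finite,field}"
  assumes M: "is_matroid (vector_matroid T \<phi>)" and simple: "is_simple (vector_matroid T \<phi>)"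
    and full: "\<And>z. z \<in> fvec.span (\<phi> ` T) \<Longrightarrow> z \<noteq> 0 \<Longrightarrow> ffs.pt (\<phi> ` T) {0} z"
  shows "projective_geometry TYPE('f) (vector_matroid T \<phi>)"
proof -
  let ?N = "vector_matroid T \<phi>"
  note sm = simple_vector_matroid[OF simple]
  have nz: "\<phi> t \<noteq> 0" if "t \<in> T" for t using sm(2)[of "\<phi> t" "\<phi> t"] that by simp
  obtain I where I: "I \<in> indeps ?N" "I \<subseteq> T" "card I = rk ?N T" using rk_witness[OF M] .
  have "insert x I \<notin> indeps ?N" if "x \<in> T - I" for x
    using rk_ge[OF M, of "insert x I" T] that I indep_finite[OF M I(1)] by fastforce
  then have spI: "fvec.span (\<phi> ` I) = fvec.span (\<phi> ` T)"
    using span_basis_vector_matroid[OF I(1,2)] by blast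
  let ?B = "\<phi> ` I" and ?U = "fvec.span (\<phi> ` T)"
  have B: "fvec.independent ?B" "finite ?B"
    using I(1) indep_finite[OF M] by (auto simp: indeps_vector_matroid)
  define r where "r = card ?B"
  obtain h where h: "bij_betw h ?B {0..<r}" using ex_bij_betw_finite_nat[OF B(2)] unfolding r_def by blast
  obtain \<psi> where \<psi>: "Vector_Spaces.linear (\<lambda>(c :: 'f) (v :: nat \<Rightarrow> 'f) i. c * v i) (\<lambda>c v i. c * v i) \<psi>"
    "\<And>b. b \<in> ?B \<Longrightarrow> \<psi> b = unit_seq (h b)"
    using fvp.linear_independent_extend[OF B(1), of "\<lambda>b. unit_seq (h b)"] by blast
  interpret \<psi>: Vector_Spaces.linear "\<lambda>(c :: 'f) (v :: nat \<Rightarrow> 'f) i. c * v i" "\<lambda>c v i. c * v i" \<psi> by fact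
  have im: "\<psi> ` ?B = unit_seq ` {..<r}"
  proof -
    have "\<psi> ` ?B = unit_seq ` h ` ?B" using \<psi>(2) by (auto simp: image_image)
    then show ?thesis using h by (simp add: bij_betw_def atLeast0LessThan)
  qed
  have "inj_on \<psi> ?B"
  proof (rule inj_onI)
    fix b b' assume b: "b \<in> ?B" "b' \<in> ?B" "\<psi> b = \<psi> b'"
    then have "h b = h b'" using \<psi>(2) injD[OF inj_unit_seq] by metis
    then show "b = b'" using inj_onD[OF bij_betw_imp_inj_on[OF h]] b by blast
  qed
  then have inj: "inj_on \<psi> ?U"
    using \<psi>.inj_on_span_iff_independent_image[of ?B] im independent_unit_seq[where ?'f = 'f, of r] spI by simp
  have surj: "\<psi> ` ?U = coord_space r"
    using \<psi>.span_image[of ?B] im span_unit_seq[of r] spI by metis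
  have ker: "\<psi> v = 0 \<longleftrightarrow> v = 0" if "v \<in> ?U" for v
    using inj_onD[OF inj, of v 0] that fvec.span_zero \<psi>.zero by metis
  let ?f = "\<lambda>t. \<psi> (\<phi> t)"
  let ?V = "vector_matroid (coord_space r :: (nat \<Rightarrow> 'f) set) id"
  define S where "S = ?f ` T"
  have TU: "\<phi> ` T \<subseteq> ?U" by (rule fvec.span_superset)
  then have SV: "S \<subseteq> coord_space r" using surj unfolding S_def by blast
  have Snz: "s \<noteq> 0" if "s \<in> S" for s
  proof -
    from that obtain t where t: "t \<in> T" "s = \<psi> (\<phi> t)" unfolding S_def by blast
    then show ?thesis using ker[of "\<phi> t"] nz[OF t(1)] TU by auto
  qed
  have ind_iff: "fvec.independent (\<psi> ` Y) \<longleftrightarrow> fvec.independent Y" if Y: "Y \<subseteq> ?U" for Y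
  proof (rule iffI)
    assume ind: "fvec.independent (\<psi> ` Y)"
    show "fvec.independent Y"
    proof (rule notI)
      assume "fvec.dependent Y"
      then obtain y where y: "y \<in> Y" "y \<in> fvec.span (Y - {y})" unfolding fvec.dependent_def by blast
      have "\<psi> y \<in> fvec.span (\<psi> ` (Y - {y}))" using y(2) \<psi>.span_image[of "Y - {y}"] by blast
      moreover have "\<psi> ` (Y - {y}) = \<psi> ` Y - {\<psi> y}"
        using inj_on_image_set_diff[OF inj, of Y "{y}"] Y y(1) by auto
      ultimately show False using ind y(1) unfolding fvec.dependent_def by auto
    qed
  next
    assume "fvec.independent Y"
    moreover have "fvec.span Y \<subseteq> ?U" using Y by (simp add: fvec.span_minimal)
    ultimately show "fvec.independent (\<psi> ` Y)"
      using \<psi>.independent_injective_image inj inj_on_subset by blast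
  qed
  have parallel: "parallel ?V x s \<longleftrightarrow> (\<exists>c. c \<noteq> 0 \<and> x = (\<lambda>i. c * s i))"
    if xs: "x \<in> coord_space r" "x \<noteq> 0" "s \<in> coord_space r" "s \<noteq> 0" for x s
  proof
    assume p: "parallel ?V x s"
    show "\<exists>c. c \<noteq> 0 \<and> x = (\<lambda>i. c * s i)"
    proof (cases "x = s")
      case False
      then have "{x, s} \<notin> indeps ?V" using p unfolding parallel_def by auto
      then have "\<not> fvec.independent {x, s}" using xs by (auto simp: indeps_vector_matroid)
      from ffs.not_independent_pair[OF this False xs(4)] obtain c where c: "x = (\<lambda>i. c * s i)" by blast
      then have "c \<noteq> 0" using xs by auto
      then show ?thesis using c by blast
    qed (auto intro!: exI[of _ 1])
  next
    assume "\<exists>c. c \<noteq> 0 \<and> x = (\<lambda>i. c * s i)"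
    then have "x \<in> fvec.span {s}" by (auto simp: fvec.span_singleton)
    then have "x = s \<or> \<not> fvec.independent {x, s}" by (auto simp: fvec.independent_insert)
    then show "parallel ?V x s" using xs unfolding parallel_def by (auto simp: indeps_vector_matroid)
  qed
  have finj: "inj_on ?f T" using comp_inj_on[OF sm(1) inj_on_subset[OF inj TU]] by (simp add: comp_def)
  have simplif: "simplification ?V (restr ?V S)"
    unfolding simplification_def
  proof (intro exI[of _ S] conjI ballI impI refl)
    show "S \<subseteq> {x \<in> ground ?V. {x} \<in> indeps ?V}" using SV Snz by (auto simp: indep_singleton)
    fix x :: "nat \<Rightarrow> 'f" assume "x \<in> ground ?V" "{x} \<in> indeps ?V"
    then have x: "x \<in> coord_space r" "x \<noteq> 0" by (auto simp: indep_singleton)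
    then obtain v where v: "v \<in> ?U" "x = \<psi> v" using surj by blast
    then have "v \<noteq> 0" using x ker by blast
    then obtain t c where t: "t \<in> T" "v = (\<lambda>i. c * \<phi> t i)" using full[OF v(1)] by (auto simp: ffs.pt_0_iff)
    then have "x = (\<lambda>i. c * ?f t i)" using v(2) \<psi>.scale by simp
    moreover have "c \<noteq> 0" using t \<open>v \<noteq> 0\<close> by auto
    moreover have "?f t \<in> S" using t by (simp add: S_def)
    ultimately have "\<exists>s. s \<in> S \<and> parallel ?V x s" using parallel x SV Snz by blast
    then show "\<exists>!s. s \<in> S \<and> parallel ?V x s"
    proof (rule ex_ex1I)
      fix s s' assume ss: "s \<in> S \<and> parallel ?V x s" "s' \<in> S \<and> parallel ?V x s'"
      have mult: "\<exists>c t. c \<noteq> 0 \<and> t \<in> T \<and> s = ?f t \<and> x = (\<lambda>i. c * s i)"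
        if h: "s \<in> S \<and> parallel ?V x s" for s
      proof -
        have "s \<in> coord_space r" "s \<noteq> 0" using h SV Snz by auto
        then have "\<exists>c. c \<noteq> 0 \<and> x = (\<lambda>i. c * s i)" using parallel[OF x] h by simp
        moreover have "\<exists>t\<in>T. s = ?f t" using h unfolding S_def by blast
        ultimately show ?thesis by metis
      qed
      from mult[OF ss(1)] mult[OF ss(2)] obtain c c' t t' where h: "c \<noteq> 0" "x = (\<lambda>i. c * s i)"
        "c' \<noteq> 0" "x = (\<lambda>i. c' * s' i)" "t \<in> T" "s = ?f t" "t' \<in> T" "s' = ?f t'" by metis
      have "\<psi> (\<lambda>i. c * \<phi> t i) = \<psi> (\<lambda>i. c' * \<phi> t' i)" using h \<psi>.scale by metis
      moreover have "(\<lambda>i. c * \<phi> t i) \<in> ?U" "(\<lambda>i. c' * \<phi> t' i) \<in> ?U"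
        using h TU by (auto intro!: fvec.span_scale)
      ultimately have eq: "(\<lambda>i. c * \<phi> t i) = (\<lambda>i. c' * \<phi> t' i)" using inj by (auto dest: inj_onD)
      have "\<phi> t = (\<lambda>i. (c' / c) * \<phi> t' i)"
      proof
        fix i show "\<phi> t i = (c' / c) * \<phi> t' i" using fun_cong[OF eq, of i] h(1) by (simp add: field_simps)
      qed
      then have "t = t'" using simple_multiple[OF simple] h by blast
      then show "s = s'" using h by simp
    qed
  qed
  have "isomorphic ?N (restr ?V S)"
    unfolding isomorphic_def
  proof (intro exI[of _ ?f] conjI allI impI)
    show "bij_betw ?f (ground ?N) (ground (restr ?V S))" using finj by (simp add: bij_betw_def S_def)
    fix X assume X: "X \<subseteq> ground ?N"
    then have "\<phi> ` X \<subseteq> ?U" "inj_on \<phi> X" "?f ` X \<subseteq> S" using TU sm(1) by (auto simp: S_def intro: inj_on_subset)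
    then show "X \<in> indeps ?N \<longleftrightarrow> ?f ` X \<in> indeps (restr ?V S)"
      using ind_iff[of "\<phi> ` X"] X SV by (auto simp: indeps_vector_matroid image_image)
  qed
  then show ?thesis unfolding projective_geometry_def using simplif by blast
qed

section \<open>Chordal matroids\<close>

context finite_field_space
begin

lemma full_imp_clean:
  assumes full: "\<And>z. z \<in> span E \<Longrightarrow> z \<noteq> 0 \<Longrightarrow> pt E {0} z" shows "clean E"
  unfolding clean_def
proof (intro allI impI)
  fix X u v d
  assume X: "X \<subseteq> E" and p: "pt E (span X) u" "pt E (span X) v" and out: "u + d *s v \<notin> span X"
  have "span X \<subseteq> span E" using X by (rule span_mono)
  then have "u \<in> span E" "v \<in> span E" using p pt_in[OF subspace_span _ span_superset] by blast+
  then have "u + d *s v \<in> span E" by (simp add: span_add span_scale)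
  moreover have "u + d *s v \<noteq> 0" using out span_zero by metis
  ultimately have "pt E {0} (u + d *s v)" by (rule full)
  then show "pt E (span X) (u + d *s v)" using pt_mono[OF _ _ out, of E "{0}" E] by (simp add: span_zero)
qed

text \<open>For a line spanned by two elements of \<open>E1\<close>, contraction by \<open>X\<close>
  can be traded for contraction by the elements of \<open>E1\<close> in \<open>span X\<close>. What
  the other side contributes lies in both spans, and there, by \<open>full\<close>, it is a multiple
  of a common element.\<close>

lemma clean_Un_line:
  assumes cl: "clean E1" and full: "\<forall>z. z \<in> span E1 \<longrightarrow> z \<in> span E2 \<longrightarrow> z \<noteq> 0 \<longrightarrow> pt (E1 \<inter> E2) {0} z"
    and X: "X \<subseteq> E1 \<union> E2" and a: "a \<in> E1" "a \<notin> span X" and b: "b \<in> E1" "b \<notin> span X"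
    and nz: "\<alpha> \<noteq> 0" "\<beta> \<noteq> 0" and p: "pt (E1 \<union> E2) (span X) (\<alpha> *s a + \<beta> *s b)"
    and out: "s *s a + t *s b \<notin> span X"
  shows "pt (E1 \<union> E2) (span X) (s *s a + t *s b)"
proof -
  let ?A = "span X" and ?w = "\<alpha> *s a + \<beta> *s b"
  let ?X1 = "E1 \<inter> ?A" and ?X2 = "E2 \<inter> ?A"
  have A1: "span ?X1 \<subseteq> ?A" "span ?X2 \<subseteq> ?A" using span_minimal[OF Int_lower2 subspace_span] by blast+
  have wE: "?w \<in> span E1" using a b by (auto intro: span_add span_scale span_base)
  have split: "\<exists>a1 a2. a1 \<in> span ?X1 \<and> a2 \<in> span ?X2 \<and> v = a1 + a2" if "v \<in> ?A" for v
  proof -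
    have "X \<subseteq> ?X1 \<union> ?X2" using X span_superset[of X] by blast
    then have "v \<in> span (?X1 \<union> ?X2)" using that span_mono by blast
    then show ?thesis by (simp add: in_span_Un)
  qed
  have X1E: "span ?X1 \<subseteq> span E1" "span ?X2 \<subseteq> span E2" by (auto intro!: span_mono)
  have in1: "v \<in> span ?X1" if v: "v \<in> span E1" "v \<in> span E2" "v \<in> ?A" for v
  proof (cases "v = 0")
    case False
    then obtain c e where e: "v = c *s e" "e \<in> E1 \<inter> E2" using full v(1,2) by (auto simp: pt_0_iff)
    then have "c \<noteq> 0" using False by auto
    then have "e \<in> ?A" using v(3) e(1) scale_mem_iff[OF subspace_span] by blast
    then show ?thesis using e by (auto intro: span_scale span_base)
  qed (simp add: span_zero)
  from ptE[OF p subspace_span] obtain e k where e: "e \<in> E1 \<union> E2" "?w - k *s e \<in> ?A" "?w \<notin> ?A" by metis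
  from split[OF e(2)] obtain a1 a2 where a12: "a1 \<in> span ?X1" "a2 \<in> span ?X2" "?w - k *s e = a1 + a2" by blast
  have nA: "?w \<notin> span ?X1" using e(3) A1 by blast
  have "pt E1 (span ?X1) ?w"
  proof (cases "e \<in> E1")
    case True
    have "a2 = ?w - k *s e - a1" using a12(3) by (simp add: algebra_simps)
    moreover have "?w - k *s e - a1 \<in> span E1"
      using wE True a12(1) X1E(1) by (intro span_diff span_scale) (auto intro: span_base)
    ultimately have "a2 \<in> span E1" by simp
    moreover have "a2 \<in> span E2" "a2 \<in> ?A" using a12(2) X1E A1 by blast+
    ultimately have "a2 \<in> span ?X1" by (rule in1)
    then have "?w - k *s e \<in> span ?X1" unfolding a12(3) using a12(1) by (simp add: span_add)
    then show ?thesis using True nA unfolding pt_def by blast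
  next
    case False
    then have eE: "e \<in> E2" using e by blast
    have eq: "?w - a1 = k *s e + a2" using a12(3) by (simp add: algebra_simps)
    have "?w - a1 \<in> span E1" using wE a12(1) X1E(1) by (intro span_diff) auto
    moreover have "?w - a1 \<in> span E2" unfolding eq
      using eE a12(2) X1E(2) by (intro span_add span_scale) (auto intro: span_base)
    moreover have "?w - a1 \<noteq> 0" using nA a12(1) by auto
    ultimately obtain c f where f: "?w - a1 = c *s f" "f \<in> E1" using full by (fastforce simp: pt_0_iff)
    have "?w - c *s f = a1" unfolding f(1)[symmetric] by simp
    then have "?w - c *s f \<in> span ?X1" using a12(1) by (simp only:)
    then show ?thesis using f(2) nA unfolding pt_def by blast
  qed
  moreover have "pt E1 (span ?X1) a" "pt E1 (span ?X1) b" using a b A1 by (auto intro!: pt_mem)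
  moreover have "s *s a + t *s b \<notin> span ?X1" using out A1 by blast
  ultimately have "pt E1 (span ?X1) (s *s a + t *s b)"
    using clean_line[OF cl, of ?X1 a b \<alpha> \<beta> s t] nz by blast
  then show ?thesis using pt_mono[OF _ A1(1) out] by blast
qed

text \<open>Of three points on a line, two are represented by elements of the same side, and
  \<open>clean_Un_line\<close> applies to them. The cases rewrite \<open>u + d *s v\<close> in terms
  of the pair found.\<close>

lemma clean_Un:
  assumes cl: "clean E1" "clean E2"
    and full: "\<And>z. z \<in> span E1 \<Longrightarrow> z \<in> span E2 \<Longrightarrow> z \<noteq> 0 \<Longrightarrow> pt (E1 \<inter> E2) {0} z"
  shows "clean (E1 \<union> E2)"
  unfolding clean_def
proof (intro allI impI)
  fix X u v d
  let ?A = "span X" and ?E = "E1 \<union> E2"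
  assume X: "X \<subseteq> ?E" and p: "pt ?E ?A u" "pt ?E ?A v" "pt ?E ?A (u + v)" and out: "u + d *s v \<notin> ?A"
  have sA: "subspace ?A" by simp
  have full1: "\<forall>z. z \<in> span E1 \<longrightarrow> z \<in> span E2 \<longrightarrow> z \<noteq> 0 \<longrightarrow> pt (E1 \<inter> E2) {0} z" using full by blast
  have full2: "\<forall>z. z \<in> span E2 \<longrightarrow> z \<in> span E1 \<longrightarrow> z \<noteq> 0 \<longrightarrow> pt (E2 \<inter> E1) {0} z"
    using full by (simp add: Int_commute)
  note line1 = clean_Un_line[OF cl(1) full1 X]
  note line2 = clean_Un_line[OF cl(2) full2, unfolded Un_commute[of E2], OF X]
  have line: "pt ?E ?A (s *s P + t *s R)"
    if h: "P - k *s a \<in> ?A" "R - l *s b \<in> ?A" "k \<noteq> 0" "l \<noteq> 0" "a \<notin> ?A" "b \<notin> ?A"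
      "a \<in> E1 \<and> b \<in> E1 \<or> a \<in> E2 \<and> b \<in> E2" "\<alpha> \<noteq> 0" "\<beta> \<noteq> 0"
      "pt ?E ?A (\<alpha> *s P + \<beta> *s R)" "s *s P + t *s R \<notin> ?A" for P R a b k l \<alpha> \<beta> s t
  proof -
    have c1: "(\<alpha> *s P + \<beta> *s R) - ((\<alpha> * k) *s a + (\<beta> * l) *s b) \<in> ?A"
      by (rule lin2[OF sA h(1,2), of _ \<alpha> \<beta>]) (simp add: algebra_simps)
    have c2: "(s *s P + t *s R) - ((s * k) *s a + (t * l) *s b) \<in> ?A"
      by (rule lin2[OF sA h(1,2), of _ s t]) (simp add: algebra_simps)
    have c2': "((s * k) *s a + (t * l) *s b) - (s *s P + t *s R) \<in> ?A"
      by (rule lin1[OF sA c2, of _ "-1"]) simp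
    have out': "(s * k) *s a + (t * l) *s b \<notin> ?A" using h(11) diff_mem_cong[OF sA c2] by blast
    have p': "pt ?E ?A ((\<alpha> * k) *s a + (\<beta> * l) *s b)" using pt_cong[OF sA h(10) c1] .
    have nz: "\<alpha> * k \<noteq> 0" "\<beta> * l \<noteq> 0" using h by auto
    have "pt ?E ?A ((s * k) *s a + (t * l) *s b)"
      using h(7) line1[OF _ h(5) _ h(6) nz p' out'] line2[OF _ h(5) _ h(6) nz p' out'] by blast
    then show ?thesis using pt_cong[OF sA _ c2'] by blast
  qed
  obtain a k where a: "a \<in> ?E" "k \<noteq> 0" "u - k *s a \<in> ?A" "a \<notin> ?A" using ptE[OF p(1) sA] by metis
  obtain b l where b: "b \<in> ?E" "l \<noteq> 0" "v - l *s b \<in> ?A" "b \<notin> ?A" using ptE[OF p(2) sA] by metis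
  obtain c m where c: "c \<in> ?E" "m \<noteq> 0" "u + v - m *s c \<in> ?A" "c \<notin> ?A" using ptE[OF p(3) sA] by metis
  consider "a \<in> E1 \<and> b \<in> E1 \<or> a \<in> E2 \<and> b \<in> E2" | "a \<in> E1 \<and> c \<in> E1 \<or> a \<in> E2 \<and> c \<in> E2"
    | "b \<in> E1 \<and> c \<in> E1 \<or> b \<in> E2 \<and> c \<in> E2" using a(1) b(1) c(1) by blast
  then show "pt ?E ?A (u + d *s v)"
  proof cases
    case 1
    have "pt ?E ?A (1 *s u + d *s v)"
      by (rule line[OF a(3) b(3) a(2) b(2) a(4) b(4) 1, of 1 1]) (use p out in simp_all)
    then show ?thesis by simp
  next
    case 2
    have eq: "(1 - d) *s u + d *s (u + v) = u + d *s v" by (simp add: algebra_simps)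
    have "pt ?E ?A ((1 - d) *s u + d *s (u + v))"
      by (rule line[OF a(3) c(3) a(2) c(2) a(4) c(4) 2, of "-1" 1]) (use p out in \<open>simp_all add: eq\<close>)
    then show ?thesis unfolding eq .
  next
    case 3
    have eq: "(d - 1) *s v + 1 *s (u + v) = u + d *s v" by (simp add: algebra_simps)
    have "pt ?E ?A ((d - 1) *s v + 1 *s (u + v))"
      by (rule line[OF b(3) c(3) b(2) c(2) b(4) c(4) 3, of "-1" 1]) (use p out in \<open>simp_all only: eq, simp_all\<close>)
    then show ?thesis unfolding eq .
  qed
qed

end

section \<open>Flats of restrictions and of generalized parallel connections\<close>

lemma flat_restr_Int:
  assumes M: "is_matroid M" and X: "X \<subseteq> ground M" and F: "flat M F"
  shows "flat (restr M X) (F \<inter> X)"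
proof -
  have "cl (restr M X) (F \<inter> X) \<subseteq> F \<inter> X"
  proof
    fix e assume e: "e \<in> cl (restr M X) (F \<inter> X)"
    then have eX: "e \<in> X" and "rk (restr M X) (insert e (F \<inter> X)) = rk (restr M X) (F \<inter> X)"
      unfolding cl_def by auto
    then have "rk M (insert e (F \<inter> X)) = rk M (F \<inter> X)" by (simp add: rk_restr)
    then have "e \<in> cl M (F \<inter> X)" using eX X unfolding cl_def by auto
    then show "e \<in> F \<inter> X" using cl_mono[OF M, of "F \<inter> X" F] F eX unfolding flat_def by auto
  qed
  then show ?thesis unfolding flat_def using cl_superset[of "F \<inter> X" "restr M X"] by auto
qed

lemma flat_of_flat:
  assumes M: "is_matroid M" and T: "flat M T" and F: "flat (restr M T) F"
  shows "flat M F"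
proof -
  have FT: "F \<subseteq> T" "T \<subseteq> ground M" using F T unfolding flat_def by auto
  have "cl M F \<subseteq> F"
  proof
    fix e assume e: "e \<in> cl M F"
    then have eT: "e \<in> T" using cl_mono[OF M FT(1)] T unfolding flat_def by auto
    have "rk M (insert e F) = rk M F" using e unfolding cl_def by auto
    then have "e \<in> cl (restr M T) F" using eT FT unfolding cl_def by (simp add: rk_restr)
    then show "e \<in> F" using F unfolding flat_def by simp
  qed
  then show ?thesis unfolding flat_def using FT cl_superset[of F M] by auto
qed

lemma flat_restr_iff:
  assumes "is_matroid M" "flat M T" "F \<subseteq> T"
  shows "flat (restr M T) F \<longleftrightarrow> flat M F"
  using flat_of_flat[OF assms(1,2)] flat_restr_Int[OF assms(1), of T F] assms(2,3)
  unfolding flat_def by (metis inf.absorb1)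

text \<open>A flat of \<open>M2\<close> meets \<open>ground M1\<close> in a flat of the common
  restriction, which is a flat of \<open>M1\<close> because the common ground set is one. So the
  flats of \<open>M2\<close> are exactly the flats of \<open>M\<close> inside
  \<open>ground M2\<close>.\<close>

lemma gen_par_conn_part:
  assumes M: "is_matroid M" and M1: "is_matroid M1" and M2: "is_matroid M2"
    and eq: "restr M1 (ground M1 \<inter> ground M2) = restr M2 (ground M1 \<inter> ground M2)"
    and T: "flat M1 (ground M1 \<inter> ground M2)" and g: "ground M = ground M1 \<union> ground M2"
    and fl: "\<And>F. F \<subseteq> ground M \<Longrightarrow> flat M F \<longleftrightarrow> flat M1 (F \<inter> ground M1) \<and> flat M2 (F \<inter> ground M2)"
  shows "flat M (ground M2)" "M2 = restr M (ground M2)"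
proof -
  let ?T = "ground M1 \<inter> ground M2"
  have full: "flat M2 (ground M2)"
    using cl_superset[of "ground M2" M2] cl_subset[of M2 "ground M2"] unfolding flat_def by auto
  have same: "flat M2 F \<longleftrightarrow> flat M F" if F: "F \<subseteq> ground M2" for F
  proof -
    have FE: "F \<inter> ground M2 = F" "F \<inter> ground M1 = F \<inter> ?T" using F by auto
    have "flat M1 (F \<inter> ground M1)" if "flat M2 F"
    proof -
      have "flat (restr M2 ?T) (F \<inter> ?T)" using flat_restr_Int[OF M2 _ that] by simp
      then have "flat (restr M1 ?T) (F \<inter> ?T)" by (simp add: eq)
      then show ?thesis using flat_of_flat[OF M1 T] FE(2) by simp
    qed
    then show ?thesis using fl[of F] F g FE(1) by auto
  qed
  then show E2: "flat M (ground M2)" using full by simp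
  have sub: "ground M2 \<subseteq> ground M" using g by blast
  show "M2 = restr M (ground M2)"
  proof (rule matroid_eqI_flats[OF M2 is_matroid_restr[OF M sub]])
    show "flat M2 F \<longleftrightarrow> flat (restr M (ground M2)) F" if "F \<subseteq> ground M2" for F
      using same[OF that] flat_restr_iff[OF M E2 that] by simp
  qed simp
qed

lemma chordal_is_matroid: "chordal k M \<Longrightarrow> is_matroid M"
  by (induction rule: chordal.induct) (auto simp: gen_par_conn_def)

text \<open>\<open>gen_par_conn\<close> speaks of flats, so \<open>\<phi>\<close> must first be
  shown to represent both parts. For \<open>M2\<close> this follows from the flatness of the common
  part in \<open>M1\<close>. For \<open>M1\<close> the common part must also be a flat of
  \<open>M2\<close>; it is one because its elements already fill their span and \<open>M\<close> is
  simple.\<close>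

lemma chordal_imp_clean:
  fixes \<phi> :: "'a \<Rightarrow> nat \<Rightarrow> 'f::{finite,field}"
  assumes "chordal TYPE('f) M" "is_simple M" "M = vector_matroid (ground M) \<phi>"
  shows "ffs.clean (\<phi> ` ground M)"
  using assms
proof (induction rule: chordal.induct)
  case (geometry M)
  then show ?case
    using projective_geometry_full[of "ground M" \<phi>] by (intro ffs.full_imp_clean) metis
next
  case (connection M1 M2 N M)
  let ?E = "ground M" and ?E1 = "ground M1" and ?E2 = "ground M2"
  let ?T = "?E1 \<inter> ?E2"
  have M1: "is_matroid M1" and M2: "is_matroid M2"
    using connection.hyps(1,2) chordal_is_matroid by blast+
  from connection.hyps(4) have gp: "restr M1 ?T = N" "restr M2 ?T = N" "flat M1 ?T" "is_matroid M"
    "?E = ?E1 \<union> ?E2"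
    and fl: "\<And>F. F \<subseteq> ?E \<Longrightarrow> flat M F \<longleftrightarrow> flat M1 (F \<inter> ?E1) \<and> flat M2 (F \<inter> ?E2)"
    unfolding gen_par_conn_def modular_flat_def by blast+
  note Mv = connection.prems(2) and simple = connection.prems(1)
  have M: "is_matroid (vector_matroid ?E \<phi>)" using gp(4) Mv by simp
  note p2 = gen_par_conn_part[OF gp(4) M1 M2 _ gp(3,5) fl]
  have M2r: "M2 = restr M ?E2" using p2 gp by simp
  have sub: "?E1 \<subseteq> ?E" "?E2 \<subseteq> ?E" "?T \<subseteq> ?E2" "?T \<subseteq> ?E1" "?T \<subseteq> ?E" using gp(5) by auto
  have M2v: "M2 = vector_matroid ?E2 \<phi>" using M2r Mv restr_vector_matroid[OF sub(2)] by metis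
  have Nv: "N = vector_matroid ?T \<phi>" using gp(2) M2v restr_vector_matroid[OF sub(3)] by metis
  have sN: "is_simple N" using simple_restr[OF simple sub(5)] Mv restr_vector_matroid[OF sub(5)] Nv by metis
  have mN: "is_matroid N" using is_matroid_restr[OF M2 sub(3)] gp(2) by simp
  have full: "ffs.pt (\<phi> ` ?T) {0} z" if "z \<in> fvec.span (\<phi> ` ?T)" "z \<noteq> 0" for z
    using projective_geometry_full[of ?T \<phi>] mN sN connection.hyps(3) that unfolding Nv by blast
  have simple': "is_simple (vector_matroid ?E \<phi>)" using simple Mv by simp
  note sm = simple_vector_matroid[OF simple']
  have "flat M2 ?T"
    unfolding M2v[THEN arg_cong[of _ _ "\<lambda>M. flat M ?T"]]
  proof (subst flat_vector_matroid)
    show "is_matroid (vector_matroid ?E2 \<phi>)" using M2 M2v by simp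
    show "?T \<subseteq> ?E2 \<and> (\<forall>e\<in>?E2. \<phi> e \<in> fvec.span (\<phi> ` ?T) \<longrightarrow> e \<in> ?T)"
    proof (intro conjI ballI impI)
      fix e assume e: "e \<in> ?E2" "\<phi> e \<in> fvec.span (\<phi> ` ?T)"
      have "\<phi> e \<noteq> 0" using sm(2)[of "\<phi> e" "\<phi> e"] e(1) sub by auto
      then obtain t c where t: "t \<in> ?T" "\<phi> e = (\<lambda>i. c * \<phi> t i)" using full[OF e(2)] by (auto simp: ffs.pt_0_iff)
      then have "e = t" using simple_multiple[OF simple'] e(1) t(1) sub by blast
      then show "e \<in> ?T" using t by simp
    qed (use sub in blast)
  qed
  then have T2: "flat M2 (?E2 \<inter> ?E1)" by (simp add: Int_commute)
  have eq2: "restr M2 (?E2 \<inter> ?E1) = restr M1 (?E2 \<inter> ?E1)" using gp(1,2) by (simp add: Int_commute)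
  have g2: "?E = ?E2 \<union> ?E1" using gp(5) by blast
  note p1 = gen_par_conn_part[OF gp(4) M2 M1 eq2 T2 g2]
  have fl2: "\<And>F. F \<subseteq> ?E \<Longrightarrow> flat M F \<longleftrightarrow> flat M2 (F \<inter> ?E2) \<and> flat M1 (F \<inter> ?E1)" using fl by blast
  have M1v: "M1 = vector_matroid ?E1 \<phi>" using p1(2)[OF fl2] Mv restr_vector_matroid[OF sub(1)] by metis
  have s1: "is_simple M1" "is_simple M2"
    using simple_restr[OF simple sub(1)] simple_restr[OF simple sub(2)] p1(2)[OF fl2] M2r by metis+
  have c1: "ffs.clean (\<phi> ` ?E1)" using connection.IH(1)[OF s1(1) M1v] .
  have c2: "ffs.clean (\<phi> ` ?E2)" using connection.IH(2)[OF s1(2) M2v] .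
  have flM: "flat M F \<longleftrightarrow> F \<subseteq> ?E \<and> (\<forall>e\<in>?E. \<phi> e \<in> fvec.span (\<phi> ` F) \<longrightarrow> e \<in> F)" for F
    using flat_vector_matroid[OF M] Mv by simp
  \<comment> \<open>Suppose \<open>z\<close> lies in both spans but not in that of
    \<open>?T\<close>, and take a flat \<open>X\<close> of \<open>M1\<close> above \<open>?T\<close>
    maximal with \<open>z\<close> outside its span. Adding some \<open>e\<close> to \<open>X\<close>
    catches \<open>z\<close>, so by exchange \<open>e\<close> depends on
    \<open>X \<union> ?E2\<close>; but that set is a flat of \<open>M\<close>.\<close>
  have meet: "z \<in> fvec.span (\<phi> ` ?T)" if z: "z \<in> fvec.span (\<phi> ` ?E1)" "z \<in> fvec.span (\<phi> ` ?E2)" for z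
  proof (rule ccontr)
    assume nz: "z \<notin> fvec.span (\<phi> ` ?T)"
    let ?P = "\<lambda>X. flat M1 X \<and> z \<notin> fvec.span (\<phi> ` X)"
    have "finite ?E1" using matroid_finite[OF M1] .
    moreover have "?P ?T" using gp(3) nz by blast
    ultimately obtain X where X0: "?T \<subseteq> X" "X \<subseteq> ?E1" "?P X"
      and max: "\<And>Z. X \<subseteq> Z \<Longrightarrow> Z \<subseteq> ?E1 \<Longrightarrow> ?P Z \<Longrightarrow> Z = X"
      using exists_maximal_between[where P = ?P, OF _ sub(4)] by metis
    have X: "?T \<subseteq> X" "X \<subseteq> ?E1" "flat M1 X" "z \<notin> fvec.span (\<phi> ` X)" using X0 by auto
    have "X \<noteq> ?E1" using X(4) z(1) by blast
    then obtain e where e: "e \<in> ?E1" "e \<notin> X" using X(2) by blast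
    let ?Y = "cl M1 (insert e X)"
    have eX: "insert e X \<subseteq> ?E1" using e X by blast
    have "z \<in> fvec.span (\<phi> ` ?Y)"
    proof (rule ccontr)
      assume "z \<notin> fvec.span (\<phi> ` ?Y)"
      moreover have "X \<subseteq> ?Y" using cl_superset[OF eX] by blast
      ultimately have "?Y = X" using max[of ?Y] cl_subset[of M1] flat_cl[OF M1 eX] by simp
      then show False using cl_superset[OF eX] e by blast
    qed
    moreover have "?Y = {a \<in> ?E1. \<phi> a \<in> fvec.span (\<phi> ` insert e X)}"
      using cl_vector_matroid[of ?E1 \<phi> "insert e X"] M1 M1v eX by simp
    then have "\<phi> ` ?Y \<subseteq> fvec.span (\<phi> ` insert e X)" by blast
    then have "fvec.span (\<phi> ` ?Y) \<subseteq> fvec.span (\<phi> ` insert e X)" by (simp add: fvec.span_minimal)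
    ultimately have ze: "z \<in> fvec.span (insert (\<phi> e) (\<phi> ` X))" by auto
    from fvec.in_span_insert[OF ze X(4)] have "\<phi> e \<in> fvec.span (insert z (\<phi> ` X))" .
    moreover have "insert z (\<phi> ` X) \<subseteq> fvec.span (\<phi> ` (X \<union> ?E2))"
    proof -
      have "fvec.span (\<phi> ` ?E2) \<subseteq> fvec.span (\<phi> ` (X \<union> ?E2))" by (rule fvec.span_mono) blast
      then show ?thesis using z(2) fvec.span_superset[of "\<phi> ` (X \<union> ?E2)"] by blast
    qed
    ultimately have "\<phi> e \<in> fvec.span (\<phi> ` (X \<union> ?E2))" using fvec.span_minimal by blast
    moreover have "flat M (X \<union> ?E2)"
    proof -
      have "(X \<union> ?E2) \<inter> ?E1 = X" "(X \<union> ?E2) \<inter> ?E2 = ?E2" using X by auto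
      moreover have "flat M2 ?E2"
        using cl_superset[of ?E2 M2] cl_subset[of M2 ?E2] unfolding flat_def by auto
      ultimately show ?thesis using fl[of "X \<union> ?E2"] X sub by auto
    qed
    ultimately have "e \<in> X \<union> ?E2" using flM e sub by blast
    then show False using e X by blast
  qed
  have imT: "\<phi> ` ?E1 \<inter> \<phi> ` ?E2 = \<phi> ` ?T" using inj_on_image_Int[OF sm(1) sub(1,2)] by simp
  have "ffs.clean (\<phi> ` ?E1 \<union> \<phi> ` ?E2)"
    by (rule ffs.clean_Un[OF c1 c2]) (use meet full imT in simp)
  then show ?case using gp(5) by (simp add: image_Un)
qed

text \<open>Bases \<open>I\<close> of \<open>T \<inter> F\<close>, \<open>K\<close> of
  \<open>T\<close> and \<open>L\<close> of \<open>T \<union> F\<close> are chosen nested. Fullness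
  makes the spans of \<open>T\<close> and \<open>F\<close> meet in the span of
  \<open>T \<inter> F\<close>, so that \<open>I \<union> (L - K)\<close> is a basis of
  \<open>F\<close>; the rank identity is then a count.\<close>

lemma modular_if_full:
  fixes \<phi> :: "'a \<Rightarrow> nat \<Rightarrow> 'f::{finite,field}"
  assumes M: "is_matroid (vector_matroid E \<phi>)" and T: "flat (vector_matroid E \<phi>) T"
    and full: "\<And>z. z \<in> fvec.span (\<phi> ` T) \<Longrightarrow> z \<noteq> 0 \<Longrightarrow> ffs.pt (\<phi> ` T) {0} z"
  shows "modular_flat (vector_matroid E \<phi>) T"
  unfolding modular_flat_def
proof (intro conjI allI impI T)
  let ?M = "vector_matroid E \<phi>"
  fix F assume F: "flat ?M F"
  have sub: "T \<subseteq> E" "F \<subseteq> E" using T F unfolding flat_def by auto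
  obtain I where I: "I \<in> indeps ?M" "I \<subseteq> T \<inter> F" "card I = rk ?M (T \<inter> F)" using rk_witness[OF M] .
  obtain J where J: "J \<in> indeps ?M" "J \<subseteq> T" "card J = rk ?M T" using rk_witness[OF M] .
  have IT: "I \<subseteq> T" using I by blast
  then have "card I \<le> card J" using rk_ge[OF M I(1) IT] J(3) by simp
  then obtain K where K: "I \<subseteq> K" "K \<subseteq> I \<union> J" "K \<in> indeps ?M" "card K = card J"
    using indep_extend[OF M I(1) J(1)] by blast
  have KT: "K \<subseteq> T" using K(2) IT J(2) by blast
  obtain H where H: "H \<in> indeps ?M" "H \<subseteq> T \<union> F" "card H = rk ?M (T \<union> F)" using rk_witness[OF M] .
  have "card K \<le> card H" using rk_ge[OF M K(3), of "T \<union> F"] KT H(3) by auto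
  then obtain L where L: "K \<subseteq> L" "L \<subseteq> K \<union> H" "L \<in> indeps ?M" "card L = card H"
    using indep_extend[OF M K(3) H(1)] by blast
  have finL: "finite L" using indep_finite[OF M L(3)] .
  have LTF: "L \<subseteq> T \<union> F" using L(2) KT H(2) by blast
  have LKF: "x \<in> F" if x: "x \<in> L - K" for x
  proof (rule ccontr)
    assume "x \<notin> F"
    then have "insert x K \<subseteq> T" using x LTF KT by blast
    moreover have "insert x K \<in> indeps ?M" using matroid_down[OF M L(3)] L(1) x by blast
    ultimately have "card (insert x K) \<le> rk ?M T" using rk_ge[OF M] by blast
    then show False using K(4) J(3) x finite_subset[OF L(1) finL] by simp
  qed
  let ?G = "I \<union> (L - K)"
  have GF: "?G \<subseteq> F" using I(2) LKF by blast
  have Gi: "?G \<in> indeps ?M" using matroid_down[OF M L(3), of ?G] K(1) L(1) by blast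
  have maxI: "insert x X \<notin> indeps ?M" if "card X = rk ?M Z" "X \<subseteq> Z" "x \<in> Z - X" "X \<in> indeps ?M" for x X Z
    using rk_ge[OF M, of "insert x X" Z] that indep_finite[OF M that(4)] by fastforce
  have spI: "fvec.span (\<phi> ` I) = fvec.span (\<phi> ` (T \<inter> F))"
    by (rule span_basis_vector_matroid[OF I(1,2)]) (use sub maxI I in blast)+
  have spL: "fvec.span (\<phi> ` L) = fvec.span (\<phi> ` (T \<union> F))"
  proof (rule span_basis_vector_matroid[OF L(3) LTF])
    show "T \<union> F \<subseteq> E" using sub by blast
    show "insert x L \<notin> indeps ?M" if "x \<in> T \<union> F - L" for x
      using maxI[OF _ LTF that L(3)] L(4) H(3) by simp
  qed
  have meet: "z \<in> fvec.span (\<phi> ` (T \<inter> F))" if z: "z \<in> fvec.span (\<phi> ` T)" "z \<in> fvec.span (\<phi> ` F)" for z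
  proof (cases "z = 0")
    case False
    then obtain t c where t: "t \<in> T" "z = (\<lambda>i. c * \<phi> t i)" using full[OF z(1)] by (auto simp: ffs.pt_0_iff)
    then have "c \<noteq> 0" using False by auto
    then have "\<phi> t \<in> fvec.span (\<phi> ` F)" using z(2) t(2) ffs.scale_mem_iff[OF fvec.subspace_span] by blast
    then have "t \<in> F" using F flat_vector_matroid[OF M] t(1) sub by blast
    then show ?thesis unfolding t(2) using t(1) by (intro fvec.span_scale fvec.span_base) auto
  qed (simp add: fvec.span_zero)
  have "rk ?M F = card ?G"
  proof (rule rk_eqI[OF M Gi GF])
    fix x assume x: "x \<in> F - ?G"
    have "\<phi> x \<in> fvec.span (\<phi> ` (T \<union> F))" using x by (intro fvec.span_base) auto
    then have "\<phi> x \<in> fvec.span (\<phi> ` K \<union> \<phi> ` (L - K))" unfolding spL[symmetric] using L(1)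
      by (metis Un_Diff_cancel image_Un sup.absorb2)
    then obtain k l where kl: "k \<in> fvec.span (\<phi> ` K)" "l \<in> fvec.span (\<phi> ` (L - K))" "\<phi> x = k + l"
      unfolding ffs.in_span_Un by blast
    have "k \<in> fvec.span (\<phi> ` T)" using kl(1) fvec.span_mono[OF image_mono[OF KT]] by blast
    moreover have "k \<in> fvec.span (\<phi> ` F)"
    proof -
      have "l \<in> fvec.span (\<phi> ` F)" using kl(2) LKF fvec.span_mono[of "\<phi> ` (L - K)" "\<phi> ` F"] by blast
      moreover have "\<phi> x \<in> fvec.span (\<phi> ` F)" using x by (intro fvec.span_base) auto
      moreover have "k = \<phi> x - l" using kl(3) by simp
      ultimately show ?thesis using fvec.span_diff by blast
    qed
    ultimately have "k \<in> fvec.span (\<phi> ` I)" using meet spI by blast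
    then have "\<phi> x \<in> fvec.span (\<phi> ` I \<union> \<phi> ` (L - K))" unfolding ffs.in_span_Un using kl by blast
    then have "\<phi> x \<in> fvec.span (\<phi> ` ?G)" by (simp add: image_Un)
    then show "insert x ?G \<notin> indeps ?M"
      using vector_matroid_insert_indep[OF Gi, of x] x sub by blast
  qed
  moreover have "card ?G = card I + card (L - K)"
    using I indep_finite[OF M I(1)] finL K(1) by (intro card_Un_disjoint) auto
  moreover have "card L = card K + card (L - K)"
    using card_Un_disjoint[of K "L - K"] finL L(1) finite_subset[OF L(1) finL] by (simp add: Un_absorb1)
  ultimately show "rk ?M T + rk ?M F = rk ?M (T \<union> F) + rk ?M (T \<inter> F)"
    using I(3) K(4) J(3) L(4) H(3) by simp
qed

lemma clean_imp_chordal: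
  fixes \<phi> :: "'a \<Rightarrow> nat \<Rightarrow> 'f::{finite,field}"
  assumes odd: "odd CARD('f)" and two: "CARD('f) > 2"
    and "is_matroid (vector_matroid E \<phi>)" "is_simple (vector_matroid E \<phi>)" "ffs.clean (\<phi> ` E)"
  shows "chordal TYPE('f) (vector_matroid E \<phi>)"
  using assms(3-)
proof (induction "card E" arbitrary: E rule: less_induct)
  case less
  note M = less.prems(1) and simple = less.prems(2) and cl = less.prems(3)
  let ?M = "vector_matroid E \<phi>"
  have fin: "finite E" using matroid_finite[OF M] by simp
  note sm = simple_vector_matroid[OF simple]
  consider "\<forall>z\<in>fvec.span (\<phi> ` E). z \<noteq> 0 \<longrightarrow> ffs.pt (\<phi> ` E) {0} z"
    | W1 W2 where "ffs.cover (\<phi> ` E) W1 W2" "\<forall>z\<in>W1 \<inter> W2. z \<noteq> 0 \<longrightarrow> ffs.pt (\<phi> ` E) {0} z"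
    using ffs.clean_decomposition[OF odd two cl] fin by blast
  then show ?case
  proof cases
    case 1
    then show ?thesis using chordal.geometry[OF M] full_projective_geometry[OF M simple] by blast
  next
    case (2 W1 W2)
    note W = 2(1)[unfolded ffs.cover_def]
    define part where "part W = {e \<in> E. \<phi> e \<in> W}" for W
    have im: "\<phi> ` part W = \<phi> ` E \<inter> W" for W unfolding part_def by blast
    have partE: "part W \<subseteq> E" for W unfolding part_def by blast
    let ?E1 = "part W1" and ?E2 = "part W2"
    let ?T = "?E1 \<inter> ?E2"
    have Teq: "?T = part (W1 \<inter> W2)" unfolding part_def by blast
    have sp: "fvec.span (\<phi> ` ?E1) = W1" "fvec.span (\<phi> ` ?E2) = W2" "fvec.span (\<phi> ` ?T) = W1 \<inter> W2"
      unfolding Teq im using W by blast+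
    have sub: "fvec.subspace W1" "fvec.subspace W2" "fvec.subspace (W1 \<inter> W2)"
      using sp fvec.subspace_span by metis+
    have Mp: "is_matroid (vector_matroid (part W) \<phi>)" "is_simple (vector_matroid (part W) \<phi>)" for W
      using is_matroid_restr[OF M, of "part W"] simple_restr[OF simple, of "part W"]
        restr_vector_matroid[OF partE[of W], of \<phi>] partE[of W] by auto
    have step: "chordal TYPE('f) (vector_matroid (part W) \<phi>)" if sW: "fvec.subspace W" and "\<not> \<phi> ` E \<subseteq> W" for W
    proof (rule less.hyps[OF _ Mp])
      show "card (part W) < card E"
        using that(2) fin by (intro psubset_card_mono) (auto simp: part_def)
      show "ffs.clean (\<phi> ` part W)" unfolding im using ffs.clean_restrict[OF cl sW] .
    qed
    have c1: "chordal TYPE('f) (vector_matroid ?E1 \<phi>)" using step sub(1) W by blast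
    have c2: "chordal TYPE('f) (vector_matroid ?E2 \<phi>)" using step sub(2) W by blast
    have fullT: "ffs.pt (\<phi> ` ?T) {0} z" if z: "z \<in> fvec.span (\<phi> ` ?T)" "z \<noteq> 0" for z
    proof -
      have zU: "z \<in> W1 \<inter> W2" using z sp by blast
      then have "ffs.pt (\<phi> ` E) {0} z" using 2(2) z(2) by blast
      then have "ffs.pt (\<phi> ` E \<inter> (W1 \<inter> W2)) {0} z"
        using ffs.pt_restrict[OF sub(3) fvec.subspace_single_0 _ zU] fvec.subspace_0[OF sub(3)] by blast
      then show ?thesis unfolding Teq im .
    qed
    have pg: "projective_geometry TYPE('f) (vector_matroid ?T \<phi>)"
      using full_projective_geometry[OF _ _ fullT] Mp[of "W1 \<inter> W2"] unfolding Teq[symmetric] by blast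
    have flat_part: "flat (vector_matroid (part W) \<phi>) F \<longleftrightarrow>
        F \<subseteq> part W \<and> (\<forall>e\<in>part W. \<phi> e \<in> fvec.span (\<phi> ` F) \<longrightarrow> e \<in> F)" for W F
      using flat_vector_matroid[OF Mp(1)] .
    have flT: "flat (vector_matroid ?E1 \<phi>) ?T"
      unfolding flat_part sp using part_def by auto
    have EW: "?E1 \<union> ?E2 = E" using W unfolding part_def by blast
    \<comment> \<open>The summand \<open>f2\<close> from side \<open>B\<close> also lies in
      \<open>A\<close>, hence in the span of \<open>?T\<close>. It is a multiple of some element
      \<open>t\<close> of \<open>?T\<close>, and flatness on side \<open>B\<close> puts
      \<open>t\<close> into \<open>F\<close>. The letters \<open>A\<close> and \<open>B\<close> let
      the argument serve both sides.\<close>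
    have closed: "e \<in> F" if A: "fvec.span (\<phi> ` part A) = A" "fvec.span (\<phi> ` part B) = B" "fvec.subspace A"
        "A \<inter> B = W1 \<inter> W2" "part A \<union> part B = E" and F: "F \<subseteq> E"
        and FA: "flat (vector_matroid (part A) \<phi>) (F \<inter> part A)"
        and FB: "flat (vector_matroid (part B) \<phi>) (F \<inter> part B)"
        and e: "e \<in> part A" "\<phi> e \<in> fvec.span (\<phi> ` F)" for A B F e
    proof -
      have "\<phi> ` F = \<phi> ` (F \<inter> part A) \<union> \<phi> ` (F \<inter> part B)" using F A(5) by blast
      then obtain f1 f2 where f: "f1 \<in> fvec.span (\<phi> ` (F \<inter> part A))" "f2 \<in> fvec.span (\<phi> ` (F \<inter> part B))"
        "\<phi> e = f1 + f2" using e(2) ffs.in_span_Un by metis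
      have "f1 \<in> A" using f(1) fvec.span_mono[of "\<phi> ` (F \<inter> part A)" "\<phi> ` part A"] A(1) by blast
      moreover have "\<phi> e \<in> A" using e(1) by (simp add: part_def)
      moreover have "f2 = \<phi> e - f1" using f(3) by simp
      ultimately have "f2 \<in> A" using fvec.subspace_diff[OF A(3)] by blast
      moreover have "f2 \<in> B" using f(2) fvec.span_mono[of "\<phi> ` (F \<inter> part B)" "\<phi> ` part B"] A(2) by blast
      ultimately have fU: "f2 \<in> fvec.span (\<phi> ` ?T)" using A(4) sp by blast
      have "f2 \<in> fvec.span (\<phi> ` (F \<inter> part A))"
      proof (cases "f2 = 0")
        case False
        then obtain t c where t: "t \<in> ?T" "f2 = (\<lambda>i. c * \<phi> t i)" using fullT[OF fU] by (auto simp: ffs.pt_0_iff)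
        then have "c \<noteq> 0" using False by auto
        then have "\<phi> t \<in> fvec.span (\<phi> ` (F \<inter> part B))"
          using f(2) t(2) ffs.scale_mem_iff[OF fvec.subspace_span] by blast
        moreover have tAB: "t \<in> part A" "t \<in> part B" using t(1) A(4) unfolding part_def by blast+
        ultimately have "t \<in> F" using FB unfolding flat_part by blast
        then show ?thesis unfolding t(2) using tAB by (intro fvec.span_scale fvec.span_base) auto
      qed (simp add: fvec.span_zero)
      then have "\<phi> e \<in> fvec.span (\<phi> ` (F \<inter> part A))" unfolding f(3) using f(1) by (intro fvec.span_add)
      then show ?thesis using FA e(1) unfolding flat_part by blast
    qed
    have "gen_par_conn (vector_matroid ?T \<phi>) (vector_matroid ?E1 \<phi>) (vector_matroid ?E2 \<phi>) ?M"
      unfolding gen_par_conn_def ground_vector_matroid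
    proof (intro conjI allI impI M)
      show "restr (vector_matroid ?E1 \<phi>) ?T = vector_matroid ?T \<phi>"
        "restr (vector_matroid ?E2 \<phi>) ?T = vector_matroid ?T \<phi>"
        by (intro restr_vector_matroid Int_lower1 Int_lower2)+
      show "modular_flat (vector_matroid ?E1 \<phi>) ?T" using modular_if_full[OF Mp(1) flT fullT] .
      show "E = ?E1 \<union> ?E2" using EW by simp
      fix F assume F: "F \<subseteq> E"
      show "flat ?M F \<longleftrightarrow> flat (vector_matroid ?E1 \<phi>) (F \<inter> ?E1) \<and> flat (vector_matroid ?E2 \<phi>) (F \<inter> ?E2)"
      proof
        assume fl: "flat ?M F"
        have "flat (vector_matroid (part W) \<phi>) (F \<inter> part W)" for W
          unfolding flat_part
        proof (intro conjI ballI impI)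
          fix e assume e: "e \<in> part W" "\<phi> e \<in> fvec.span (\<phi> ` (F \<inter> part W))"
          have "\<phi> e \<in> fvec.span (\<phi> ` F)" using e(2) fvec.span_mono[of "\<phi> ` (F \<inter> part W)" "\<phi> ` F"] by blast
          then show "e \<in> F \<inter> part W" using fl e(1) partE unfolding flat_vector_matroid[OF M] by blast
        qed simp
        then show "flat (vector_matroid ?E1 \<phi>) (F \<inter> ?E1) \<and> flat (vector_matroid ?E2 \<phi>) (F \<inter> ?E2)" by blast
      next
        assume fl: "flat (vector_matroid ?E1 \<phi>) (F \<inter> ?E1) \<and> flat (vector_matroid ?E2 \<phi>) (F \<inter> ?E2)"
        show "flat ?M F"
          unfolding flat_vector_matroid[OF M]
        proof (intro conjI ballI impI F)
          fix e assume e: "e \<in> E" "\<phi> e \<in> fvec.span (\<phi> ` F)"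
          then consider "e \<in> ?E1" | "e \<in> ?E2" using EW by blast
          then show "e \<in> F"
          proof cases
            case 1
            show ?thesis by (rule closed[OF sp(1,2) sub(1) refl EW F _ _ 1 e(2)]) (use fl in auto)
          next
            case 2
            show ?thesis by (rule closed[OF sp(2,1) sub(2) Int_commute _ F _ _ 2 e(2)]) (use fl EW in auto)
          qed
        qed
      qed
    qed
    then show ?thesis using chordal.connection[OF c1 c2 pg] by blast
  qed
qed

section \<open>Induced minors and uniform flats\<close>

lemma isomorphic_uniform_iff:
  "isomorphic N (uniform r n) \<longleftrightarrow>
     finite (ground N) \<and> card (ground N) = n \<and> (\<forall>X\<subseteq>ground N. X \<in> indeps N \<longleftrightarrow> card X \<le> r)"
proof
  assume "isomorphic N (uniform r n)"
  then obtain f where f: "bij_betw f (ground N) {..<n}"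
    "\<And>X. X \<subseteq> ground N \<Longrightarrow> X \<in> indeps N \<longleftrightarrow> f ` X \<subseteq> {..<n} \<and> card (f ` X) \<le> r"
    unfolding isomorphic_def uniform_def by auto
  have "finite (ground N)" using bij_betw_finite[OF f(1)] by simp
  moreover have "card (ground N) = n" using bij_betw_same_card[OF f(1)] by simp
  moreover have "X \<in> indeps N \<longleftrightarrow> card X \<le> r" if X: "X \<subseteq> ground N" for X
  proof -
    have "card (f ` X) = card X"
      using inj_on_subset[OF bij_betw_imp_inj_on[OF f(1)] X] by (rule card_image)
    moreover have "f ` X \<subseteq> {..<n}" using f(1) X unfolding bij_betw_def by blast
    ultimately show ?thesis using f(2)[OF X] by simp
  qed
  ultimately show "finite (ground N) \<and> card (ground N) = n \<and> (\<forall>X\<subseteq>ground N. X \<in> indeps N \<longleftrightarrow> card X \<le> r)"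
    by blast
next
  assume h: "finite (ground N) \<and> card (ground N) = n \<and> (\<forall>X\<subseteq>ground N. X \<in> indeps N \<longleftrightarrow> card X \<le> r)"
  then obtain f where f: "bij_betw f (ground N) {0..<n}" using ex_bij_betw_finite_nat by blast
  then have f': "bij_betw f (ground N) {..<n}" by (simp add: atLeast0LessThan)
  show "isomorphic N (uniform r n)"
    unfolding isomorphic_def
  proof (intro exI[of _ f] conjI allI impI)
    show "bij_betw f (ground N) (ground (uniform r n))" using f' by (simp add: uniform_def)
    fix X assume X: "X \<subseteq> ground N"
    have "card (f ` X) = card X"
      using inj_on_subset[OF bij_betw_imp_inj_on[OF f'] X] by (rule card_image)
    moreover have "f ` X \<subseteq> {..<n}" using f' X unfolding bij_betw_def by blast
    ultimately show "X \<in> indeps N \<longleftrightarrow> f ` X \<in> indeps (uniform r n)" using h X by (simp add: uniform_def)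
  qed
qed

text \<open>\<open>contract\<close> asks for some basis of \<open>X\<close>; extending one basis
  inside the union with another shows that each single basis gives the same independent
  sets.\<close>

lemma indeps_contract:
  assumes M: "is_matroid M" and X: "X \<subseteq> ground M" and B: "basis_of M X B"
  shows "indeps (contract M X) = {I. I \<subseteq> ground M - X \<and> I \<union> B \<in> indeps M}"
proof -
  have B': "B \<in> indeps M" "B \<subseteq> X" "card B = rk M X" using B basis_of_iff[OF M] by auto
  have "I \<union> B \<in> indeps M" if I: "I \<subseteq> ground M - X" and C: "basis_of M X C" "I \<union> C \<in> indeps M" for I C
  proof -
    have C': "C \<in> indeps M" "C \<subseteq> X" "card C = rk M X" using C(1) basis_of_iff[OF M] by auto
    have fin: "finite I" "finite C" "finite B" using indep_finite[OF M] C(2) C'(1) B'(1) by auto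
    have disj: "I \<inter> C = {}" "I \<inter> B = {}" using I C'(2) B'(2) by auto
    have "card B \<le> card (I \<union> C)" using fin disj B'(3) C'(3) by (simp add: card_Un_disjoint)
    then obtain J where J: "B \<subseteq> J" "J \<subseteq> B \<union> (I \<union> C)" "J \<in> indeps M" "card J = card (I \<union> C)"
      using indep_extend[OF M B'(1) C(2)] by blast
    have "J \<inter> X \<in> indeps M" using matroid_down[OF M J(3)] by blast
    then have "card (J \<inter> X) \<le> card B" using rk_ge[OF M, of "J \<inter> X" X] B'(3) by simp
    moreover have "B \<subseteq> J \<inter> X" using J(1) B'(2) by blast
    moreover have "finite (J \<inter> X)" using indep_finite[OF M J(3)] by blast
    ultimately have "J \<inter> X = B" using card_seteq by metis
    then have sub: "J \<subseteq> I \<union> B" using J(2) C'(2) by blast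
    have "card (I \<union> B) = card J" using J(4) fin disj B'(3) C'(3) by (simp add: card_Un_disjoint)
    then have "J = I \<union> B" using sub fin card_subset_eq[of "I \<union> B" J] by simp
    then show ?thesis using J(3) by simp
  qed
  then show ?thesis unfolding contract_def using B by auto
qed

text \<open>After contracting \<open>t\<close> elements all pairs are still independent, so the
  contraction is its own simplification.\<close>

lemma contract_uniform:
  assumes iso: "isomorphic N (uniform (2 + t) (k + t))"
  obtains X N' where "X \<subseteq> ground N" "simplification (contract N X) N'" "isomorphic N' (uniform 2 k)"
proof -
  have fin: "finite (ground N)" and card: "card (ground N) = k + t"
    and ind: "\<And>X. X \<subseteq> ground N \<Longrightarrow> X \<in> indeps N \<longleftrightarrow> card X \<le> 2 + t"
    using iso unfolding isomorphic_uniform_iff by auto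
  have "t \<le> card (ground N)" using card by simp
  then obtain X where X: "X \<subseteq> ground N" "card X = t" "finite X" by (rule obtain_subset_with_card_n)
  let ?C = "contract N X"
  have basis: "basis_of N X B \<longleftrightarrow> B = X" for B
    unfolding basis_of_def using ind[of X] X ind[of B] by auto
  have gC: "ground ?C = ground N - X" by (simp add: contract_def)
  have card_Un: "card (I \<union> X) = card I + t" if "I \<subseteq> ground N - X" for I
    using that X fin finite_subset[of I "ground N"] by (subst card_Un_disjoint) auto
  have iC: "I \<in> indeps ?C \<longleftrightarrow> I \<subseteq> ground N - X \<and> card I \<le> 2" for I
  proof (cases "I \<subseteq> ground N - X")
    case True
    then have "I \<union> X \<in> indeps N \<longleftrightarrow> card I \<le> 2" using ind[of "I \<union> X"] X card_Un[OF True] by auto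
    then show ?thesis using True by (simp add: contract_def basis)
  qed (simp add: contract_def)
  have pair: "{x, y} \<in> indeps ?C" if "x \<in> ground N - X" "y \<in> ground N - X" for x y
    using that unfolding iC by (cases "x = y") auto
  have single: "{x} \<in> indeps ?C" if "x \<in> ground N - X" for x using pair[OF that that] by simp
  have "simplification ?C ?C"
    unfolding simplification_def gC
  proof (intro exI[of _ "ground N - X"] conjI ballI impI)
    show "ground N - X \<subseteq> {x \<in> ground N - X. {x} \<in> indeps ?C}" using single by blast
    show "\<exists>!s. s \<in> ground N - X \<and> parallel ?C x s" if x: "x \<in> ground N - X" for x
    proof (rule ex1I[of _ x])
      show "x \<in> ground N - X \<and> parallel ?C x x" using x single by (simp add: parallel_def)
      show "s = x" if "s \<in> ground N - X \<and> parallel ?C x s" for s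
        using that pair[OF x, of s] unfolding parallel_def by blast
    qed
    have "{I \<in> indeps ?C. I \<subseteq> ground N - X} = indeps ?C" using iC by blast
    then show "?C = restr ?C (ground N - X)" unfolding restr_def using gC by (metis matroid.collapse)
  qed
  moreover have "isomorphic ?C (uniform 2 k)"
    unfolding isomorphic_uniform_iff gC using fin card X by (auto simp: iC card_Diff_subset)
  ultimately show ?thesis using that X(1) by blast
qed

text \<open>\<open>N\<close> is, up to the choice of representatives, the simplification of the contraction by the independent
  set \<open>Y\<close>, restricted to the subspace \<open>B\<close>.\<close>

definition minor_rep :: "'a set \<Rightarrow> ('a \<Rightarrow> nat \<Rightarrow> 'f::{finite,field}) \<Rightarrow> 'a matroid \<Rightarrow> 'a set \<Rightarrow> (nat \<Rightarrow> 'f) set \<Rightarrow> bool" where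
  "minor_rep E \<phi> N Y B \<longleftrightarrow> Y \<in> indeps (vector_matroid E \<phi>) \<and> fvec.subspace B \<and> \<phi> ` Y \<subseteq> B \<and> ground N \<subseteq> E \<and>
     indeps N = {I. I \<subseteq> ground N \<and> I \<union> Y \<in> indeps (vector_matroid E \<phi>)} \<and>
     (\<forall>n\<in>ground N. \<phi> n \<in> B \<and> \<phi> n \<notin> fvec.span (\<phi> ` Y)) \<and>
     (\<forall>e\<in>E. \<phi> e \<in> B \<longrightarrow> \<phi> e \<notin> fvec.span (\<phi> ` Y) \<longrightarrow> ffs.pt (\<phi> ` ground N) (fvec.span (\<phi> ` Y)) (\<phi> e))"

lemma minor_repD:
  assumes "minor_rep E \<phi> N Y B"
  shows "Y \<in> indeps (vector_matroid E \<phi>)" "fvec.subspace B" "\<phi> ` Y \<subseteq> B" "ground N \<subseteq> E"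
    "\<And>I. I \<in> indeps N \<longleftrightarrow> I \<subseteq> ground N \<and> I \<union> Y \<in> indeps (vector_matroid E \<phi>)"
    "\<And>n. n \<in> ground N \<Longrightarrow> \<phi> n \<in> B" "\<And>n. n \<in> ground N \<Longrightarrow> \<phi> n \<notin> fvec.span (\<phi> ` Y)"
    "\<And>e. e \<in> E \<Longrightarrow> \<phi> e \<in> B \<Longrightarrow> \<phi> e \<notin> fvec.span (\<phi> ` Y) \<Longrightarrow>
      ffs.pt (\<phi> ` ground N) (fvec.span (\<phi> ` Y)) (\<phi> e)"
    "ground N \<inter> Y = {}"
proof -
  note R = assms[unfolded minor_rep_def]
  show *: "\<And>n. n \<in> ground N \<Longrightarrow> \<phi> n \<notin> fvec.span (\<phi> ` Y)" using R by simp
  have "n \<notin> Y" if n: "n \<in> ground N" for n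
  proof
    assume "n \<in> Y"
    then have "\<phi> n \<in> fvec.span (\<phi> ` Y)" by (intro fvec.span_base) simp
    then show False using * n by blast
  qed
  then show "ground N \<inter> Y = {}" by blast
  show "Y \<in> indeps (vector_matroid E \<phi>)" "fvec.subspace B" "\<phi> ` Y \<subseteq> B" "ground N \<subseteq> E"
    "\<And>n. n \<in> ground N \<Longrightarrow> \<phi> n \<in> B" using R by simp_all
  show "I \<in> indeps N \<longleftrightarrow> I \<subseteq> ground N \<and> I \<union> Y \<in> indeps (vector_matroid E \<phi>)" for I using R by simp
  show "ffs.pt (\<phi> ` ground N) (fvec.span (\<phi> ` Y)) (\<phi> e)"
    if "e \<in> E" "\<phi> e \<in> B" "\<phi> e \<notin> fvec.span (\<phi> ` Y)" for e using R that by simp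
qed

lemma minor_rep_is_matroid:
  assumes M: "is_matroid (vector_matroid E \<phi>)" and r: "minor_rep E \<phi> N Y B"
  shows "is_matroid N"
  unfolding is_matroid_def
proof (intro conjI ballI allI impI)
  note R = minor_repD[OF r]
  let ?M = "vector_matroid E \<phi>"
  have "finite E" using matroid_finite[OF M] by simp
  then show fin: "finite (ground N)" using R(4) finite_subset by blast
  show "indeps N \<subseteq> Pow (ground N)" using R(5) by blast
  show "{} \<in> indeps N" using R(1,5) by simp
  show "J \<in> indeps N" if "I \<in> indeps N" "J \<subseteq> I" for I J
    using that R(5) matroid_down[OF M, of "I \<union> Y" "J \<union> Y"] by blast
  show "\<exists>e\<in>J - I. insert e I \<in> indeps N" if h: "I \<in> indeps N" "J \<in> indeps N" "card I < card J" for I J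
  proof -
    have IJ: "I \<subseteq> ground N" "I \<union> Y \<in> indeps ?M" "J \<subseteq> ground N" "J \<union> Y \<in> indeps ?M" using h R(5) by auto
    have finY: "finite Y" using indep_finite[OF M R(1)] .
    have "card (I \<union> Y) = card I + card Y" "card (J \<union> Y) = card J + card Y"
      using IJ R(9) finY fin finite_subset by (auto intro!: card_Un_disjoint)
    then have "card (I \<union> Y) < card (J \<union> Y)" using h(3) by simp
    then obtain e where e: "e \<in> (J \<union> Y) - (I \<union> Y)" "insert e (I \<union> Y) \<in> indeps ?M"
      using matroid_augment[OF M IJ(2,4)] by blast
    then have "insert e I \<in> indeps N" using R(5)[of "insert e I"] IJ by auto
    then show ?thesis using e(1) by blast
  qed
qed

lemma minor_rep_span_basis:
  assumes M: "is_matroid (vector_matroid E \<phi>)" and r: "minor_rep E \<phi> N Y B"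
    and I: "I \<in> indeps N" "I \<subseteq> X" "card I = rk N X" and X: "X \<subseteq> ground N"
  shows "fvec.span (\<phi> ` (I \<union> Y)) = fvec.span (\<phi> ` (X \<union> Y))"
proof (rule span_basis_vector_matroid[where E = E])
  note R = minor_repD[OF r]
  have N: "is_matroid N" using minor_rep_is_matroid[OF M r] .
  show "I \<union> Y \<in> indeps (vector_matroid E \<phi>)" using R(5) I(1) by blast
  show "I \<union> Y \<subseteq> X \<union> Y" using I(2) by blast
  show "X \<union> Y \<subseteq> E" using X R(4) matroid_sub[OF M R(1)] by auto
  show "insert x (I \<union> Y) \<notin> indeps (vector_matroid E \<phi>)" if x: "x \<in> X \<union> Y - (I \<union> Y)" for x
  proof
    assume "insert x (I \<union> Y) \<in> indeps (vector_matroid E \<phi>)"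
    then have "insert x I \<in> indeps N" using R(5)[of "insert x I"] x X matroid_sub[OF N I(1)] by auto
    moreover have "insert x I \<subseteq> X" using x I(2) by blast
    ultimately have "card (insert x I) \<le> rk N X" using rk_ge[OF N] by blast
    then show False using I(3) x indep_finite[OF N I(1)] by simp
  qed
qed

lemma minor_rep_restriction:
  assumes M: "is_matroid (vector_matroid E \<phi>)" and r: "minor_rep E \<phi> N Y B" and F: "flat N F"
  shows "minor_rep E \<phi> (restr N F) Y (fvec.span (\<phi> ` (F \<union> Y)))"
proof -
  note R = minor_repD[OF r]
  let ?A = "fvec.span (\<phi> ` Y)" and ?C = "fvec.span (\<phi> ` (F \<union> Y))"
  have N: "is_matroid N" using minor_rep_is_matroid[OF M r] .
  have FN: "F \<subseteq> ground N" using F unfolding flat_def by blast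
  obtain I where I: "I \<in> indeps N" "I \<subseteq> F" "card I = rk N F" using rk_witness[OF N] .
  note spI = minor_rep_span_basis[OF M r I FN]
  have AC: "?A \<subseteq> ?C" by (rule fvec.span_mono) blast
  have "\<phi> ` (F \<union> Y) \<subseteq> B" using R(3) R(6) FN by blast
  then have CB: "?C \<subseteq> B" using R(2) by (rule fvec.span_minimal)
  have inF: "n \<in> F" if n: "n \<in> ground N" "\<phi> n \<in> ?C" for n
  proof -
    have IY: "I \<union> Y \<in> indeps (vector_matroid E \<phi>)" using R(5) I(1) by blast
    have "\<phi> n \<in> fvec.span (\<phi> ` (I \<union> Y))" using n(2) spI by blast
    then have "n \<in> I \<union> Y \<or> insert n (I \<union> Y) \<notin> indeps (vector_matroid E \<phi>)"
      using vector_matroid_insert_indep[OF IY, of n] n(1) R(4) by blast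
    then have "n \<in> I \<or> insert n I \<notin> indeps N" using n(1) R(5)[of "insert n I"] R(9) by auto
    then have "n \<in> cl N F" using cl_iff[OF N I n(1)] by blast
    then show ?thesis using F unfolding flat_def by simp
  qed
  have "ffs.pt (\<phi> ` F) ?A (\<phi> e)" if e: "e \<in> E" "\<phi> e \<in> ?C" "\<phi> e \<notin> ?A" for e
  proof -
    have "ffs.pt (\<phi> ` ground N) ?A (\<phi> e)" using R(8) e CB by blast
    then have "ffs.pt (\<phi> ` ground N \<inter> ?C) ?A (\<phi> e)"
      using ffs.pt_restrict[OF fvec.subspace_span fvec.subspace_span AC e(2)] by blast
    moreover have "\<phi> ` ground N \<inter> ?C \<subseteq> \<phi> ` F" using inF by blast
    ultimately show ?thesis using ffs.pt_mono[OF _ subset_refl e(3)] by blast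
  qed
  moreover have "\<phi> n \<in> ?C" if "n \<in> F" for n using that by (intro fvec.span_base) auto
  moreover have "\<phi> ` Y \<subseteq> ?C" using AC fvec.span_superset[of "\<phi> ` Y"] by blast
  ultimately show ?thesis unfolding minor_rep_def using R FN by auto
qed

text \<open>\<open>Y\<close> grows by a basis \<open>D\<close> of the contracted set, so that it
  stays independent, and \<open>B\<close> is kept. An element dropped by the simplification is
  parallel to a kept one, which then represents the same point.\<close>

lemma minor_rep_contraction:
  assumes M: "is_matroid (vector_matroid E \<phi>)" and r: "minor_rep E \<phi> N Y B"
    and X: "X \<subseteq> ground N" and s: "simplification (contract N X) N'"
  shows "\<exists>Y'. minor_rep E \<phi> N' Y' B"
proof -
  note R = minor_repD[OF r]
  let ?M = "vector_matroid E \<phi>" and ?C = "contract N X"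
  have N: "is_matroid N" using minor_rep_is_matroid[OF M r] .
  obtain D where D: "D \<in> indeps N" "D \<subseteq> X" "card D = rk N X" using rk_witness[OF N] .
  have DN: "D \<subseteq> ground N" using D(2) X by blast
  have "basis_of N X D" using basis_of_iff[OF N] D by blast
  note iC = indeps_contract[OF N X this]
  have gC: "ground ?C = ground N - X" by (simp add: contract_def)
  let ?Y = "D \<union> Y"
  let ?A = "fvec.span (\<phi> ` Y)" and ?A' = "fvec.span (\<phi> ` ?Y)"
  have Yi: "?Y \<in> indeps ?M" using R(5) D(1) by blast
  have AA: "?A \<subseteq> ?A'" by (rule fvec.span_mono) blast
  have spX: "\<phi> x \<in> ?A'" if "x \<in> X" for x
    using minor_rep_span_basis[OF M r D X] that fvec.span_base[of "\<phi> x" "\<phi> ` (X \<union> Y)"] by blast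
  have indC: "I \<in> indeps ?C \<longleftrightarrow> I \<subseteq> ground N - X \<and> I \<union> ?Y \<in> indeps ?M" for I
    unfolding iC using R(5)[of "I \<union> D"] DN by (auto simp: Un_assoc)
  have single: "{n} \<in> indeps ?C \<longleftrightarrow> n \<in> ground N - X \<and> \<phi> n \<notin> ?A'" for n
  proof (cases "n \<in> ground N - X")
    case True
    then have "n \<notin> ?Y" using D(2) R(9) by blast
    then show ?thesis using True indC[of "{n}"] vector_matroid_insert_indep[OF Yi, of n] R(4) by auto
  qed (use indC in blast)
  from s[unfolded simplification_def] obtain S where S: "S \<subseteq> {x \<in> ground ?C. {x} \<in> indeps ?C}"
    and S2: "N' = restr ?C S"
    and uniq: "\<forall>x\<in>ground ?C. {x} \<in> indeps ?C \<longrightarrow> (\<exists>!s. s \<in> S \<and> parallel ?C x s)"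
    by (elim exE conjE)
  have SN: "S \<subseteq> ground N - X" using S gC by blast
  have ptS: "ffs.pt (\<phi> ` S) ?A' (\<phi> e)" if e: "e \<in> E" "\<phi> e \<in> B" "\<phi> e \<notin> ?A'" for e
  proof -
    have "ffs.pt (\<phi> ` ground N) ?A (\<phi> e)" using R(8) e AA by blast
    then have "ffs.pt (\<phi> ` ground N) ?A' (\<phi> e)" using ffs.pt_mono[OF _ AA e(3) subset_refl] by blast
    from ffs.ptE[OF this fvec.subspace_span] obtain v c where v: "v \<in> \<phi> ` ground N" "c \<noteq> 0"
      "\<phi> e - (\<lambda>i. c * v i) \<in> ?A'" "v \<notin> ?A'" by metis
    then obtain n where "n \<in> ground N" "v = \<phi> n" by blast
    then have n: "n \<in> ground N" "c \<noteq> 0" "\<phi> e - (\<lambda>i. c * \<phi> n i) \<in> ?A'" "\<phi> n \<notin> ?A'" using v by auto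
    have nX: "n \<in> ground N - X" using n spX by blast
    then have nS: "{n} \<in> indeps ?C" using single n(4) by blast
    obtain s where s: "s \<in> S" "parallel ?C n s" using uniq nX nS gC by blast
    have sNX: "s \<in> ground N - X" "\<phi> s \<notin> ?A'" using s(1) S single by blast+
    have sY: "insert s ?Y \<in> indeps ?M" using single[of s] sNX indC[of "{s}"] by simp
    have "\<phi> n \<in> fvec.span (insert (\<phi> s) (\<phi> ` ?Y))"
    proof (cases "n = s")
      case True
      then show ?thesis by (intro fvec.span_base) simp
    next
      case False
      then have "{n, s} \<notin> indeps ?C" using s(2) unfolding parallel_def by blast
      then have "insert n (insert s ?Y) \<notin> indeps ?M" using indC[of "{n, s}"] nX sNX by simp
      then show ?thesis using vector_matroid_insert_indep[OF sY, of n] n(1) R(4) by auto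
    qed
    then obtain m where m: "\<phi> n - (\<lambda>i. m * \<phi> s i) \<in> ?A'" using fvec.span_breakdown_eq by blast
    have eq: "\<phi> e - (\<lambda>i. (c * m) * \<phi> s i) = (\<lambda>i. 1 * (\<phi> e - (\<lambda>i. c * \<phi> n i)) i) +
      (\<lambda>i. c * (\<phi> n - (\<lambda>i. m * \<phi> s i)) i)"
      by (rule ext) (simp add: right_diff_distrib)
    have "\<phi> e - (\<lambda>i. (c * m) * \<phi> s i) \<in> ?A'"
      by (rule ffs.lin2[OF fvec.subspace_span n(3) m eq])
    then show ?thesis using e(3) s(1) unfolding ffs.pt_def by blast
  qed
  have "minor_rep E \<phi> N' ?Y B"
    unfolding minor_rep_def S2 ground_restr indeps_restr
  proof (intro conjI ballI impI Yi R(2))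
    show "\<phi> ` ?Y \<subseteq> B" using R(3,6) DN by blast
    show "S \<subseteq> E" using SN R(4) by blast
    show "{I \<in> indeps ?C. I \<subseteq> S} = {I. I \<subseteq> S \<and> I \<union> ?Y \<in> indeps ?M}" using indC SN by blast
    show "\<phi> n \<in> B" if "n \<in> S" for n using that SN R(6) by blast
    show "\<phi> n \<notin> ?A'" if "n \<in> S" for n using that S single by blast
    show "ffs.pt (\<phi> ` S) ?A' (\<phi> e)" if "e \<in> E" "\<phi> e \<in> B" "\<phi> e \<notin> ?A'" for e
      using ptS that .
  qed
  then show ?thesis by blast
qed

text \<open>Collapses a sequence of contractions and restrictions into one contraction and one
  subspace. Cleanness, which speaks of a single contraction, thereby applies to every induced
  minor.\<close>

lemma induced_minor_representation:
  fixes \<phi> :: "'a \<Rightarrow> nat \<Rightarrow> 'f::{finite,field}"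
  assumes M: "is_matroid (vector_matroid E \<phi>)" and simple: "is_simple (vector_matroid E \<phi>)"
    and N: "induced_minor (vector_matroid E \<phi>) N"
  shows "\<exists>Y B. minor_rep E \<phi> N Y B"
  using N
proof (induction rule: induced_minor.induct)
  case self
  have nz: "\<phi> e \<noteq> 0" if "e \<in> E" for e using simple_vector_matroid(2)[OF simple, of "\<phi> e" "\<phi> e"] that by simp
  have "ffs.pt (\<phi> ` E) {0} (\<phi> e)" if "e \<in> E" for e
    using that nz by (intro ffs.pt_mem) auto
  then have "minor_rep E \<phi> (vector_matroid E \<phi>) {} UNIV"
    unfolding minor_rep_def using nz matroid_sub[OF M] matroid_empty[OF M] by auto
  then show ?case by blast
next
  case (restriction N F)
  then show ?case using minor_rep_restriction[OF M] by blast
next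
  case (contraction N X N')
  then show ?case using minor_rep_contraction[OF M] by blast
qed

text \<open>Three elements of the line make it full in the contraction of the whole configuration.
  The elements that fill it lie in \<open>B\<close>, hence are represented in \<open>N\<close>; but
  \<open>k \<le> q\<close> elements leave some point of the line out.\<close>

lemma clean_no_line_minor:
  fixes \<phi> :: "'a \<Rightarrow> nat \<Rightarrow> 'f::{finite,field}"
  assumes M: "is_matroid (vector_matroid E \<phi>)" and simple: "is_simple (vector_matroid E \<phi>)"
    and cl: "ffs.clean (\<phi> ` E)" and N: "induced_minor (vector_matroid E \<phi>) N"
    and iso: "isomorphic N (uniform 2 k)" and k: "3 \<le> k" "k \<le> CARD('f)"
  shows False
proof -
  let ?M = "vector_matroid E \<phi>"
  obtain Y B where r: "minor_rep E \<phi> N Y B" using induced_minor_representation[OF M simple N] by blast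
  note R = minor_repD[OF r]
  let ?A = "fvec.span (\<phi> ` Y)" and ?G = "\<phi> ` ground N"
  have fin: "finite (ground N)" and card: "card (ground N) = k"
    and ind: "\<And>X. X \<subseteq> ground N \<Longrightarrow> X \<in> indeps N \<longleftrightarrow> card X \<le> 2"
    using iso unfolding isomorphic_uniform_iff by auto
  obtain C where C: "C \<subseteq> ground N" "card C = 3"
    using obtain_subset_with_card_n[of 3 "ground N"] card k by auto
  then obtain a b c where abc: "C = {a, b, c}" "a \<noteq> b" "a \<noteq> c" "b \<noteq> c" by (auto simp: card_3_iff)
  have mem: "a \<in> ground N" "b \<in> ground N" "c \<in> ground N" using C abc by auto
  have pair: "insert x (insert y Y) \<in> indeps ?M" if "x \<in> ground N" "y \<in> ground N" for x y
  proof -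
    have "card {x, y} \<le> 2" by (cases "x = y") auto
    then have "{x, y} \<in> indeps N" using ind[of "{x, y}"] that by simp
    then show ?thesis using R(5) by simp
  qed
  have line: "\<exists>s t. \<phi> z - ((\<lambda>i. s * \<phi> x i) + (\<lambda>i. t * \<phi> y i)) \<in> ?A"
    if z: "z \<in> ground N" and x: "x \<in> ground N" and y: "y \<in> ground N" and xy: "x \<noteq> y" for x y z
  proof -
    have "z \<in> {x, y} \<or> insert z (insert x (insert y Y)) \<notin> indeps ?M"
    proof (rule disjCI)
      assume "\<not> insert z (insert x (insert y Y)) \<notin> indeps ?M"
      then have "{z, x, y} \<in> indeps N" using R(5)[of "{z, x, y}"] that by simp
      then have "card {z, x, y} \<le> 2" using ind[of "{z, x, y}"] that by simp
      then show "z \<in> {x, y}" using xy by (auto simp: card_insert_if split: if_splits)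
    qed
    then have "\<phi> z \<in> fvec.span (\<phi> ` insert x (insert y Y))"
      using vector_matroid_insert_indep[OF pair[OF x y], of z] z R(4) by blast
    then show ?thesis using ffs.in_span_insert2[of "\<phi> z" "\<phi> x" "\<phi> y" "\<phi> ` Y"] by simp
  qed
  have ind2: "ffs.indep2 ?A (\<phi> x) (\<phi> y)" if x: "x \<in> ground N" and y: "y \<in> ground N" and xy: "x \<noteq> y" for x y
  proof (rule ffs.indep2I[OF fvec.subspace_span])
    show "\<phi> y \<notin> ?A" using R(7) y by blast
    fix m
    have yY: "insert y Y \<in> indeps ?M" using pair[OF y y] by simp
    have "x \<notin> insert y Y" using x xy R(9) by blast
    then have "\<phi> x \<notin> fvec.span (\<phi> ` insert y Y)"
      using vector_matroid_insert_indep[OF yY, of x] pair[OF x y] x R(4) by blast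
    then have "\<phi> x - (\<lambda>i. (- m) * \<phi> y i) \<notin> ?A" using fvec.span_breakdown_eq by fastforce
    then show "\<phi> x + (\<lambda>i. m * \<phi> y i) \<notin> ?A" by (simp add: fun_diff_def plus_fun_def)
  qed
  have YE: "\<phi> ` Y \<subseteq> \<phi> ` E" using matroid_sub[OF M R(1)] by auto
  have ptE: "ffs.pt (\<phi> ` E) ?A (\<phi> x)" if "x \<in> ground N" for x
    using that R(4,7) by (intro ffs.pt_mem) auto
  obtain s0 t0 where st0: "\<phi> c - ((\<lambda>i. s0 * \<phi> a i) + (\<lambda>i. t0 * \<phi> b i)) \<in> ?A"
    using line[OF mem(3,1,2) abc(2)] by blast
  have s0: "s0 \<noteq> 0"
  proof
    assume "s0 = 0"
    then have "(\<lambda>i. 1 * \<phi> c i) + (\<lambda>i. (- t0) * \<phi> b i) \<in> ?A" using st0 by (simp add: fun_diff_def plus_fun_def)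
    then show False using ind2[OF mem(3,2)] abc(4) unfolding ffs.indep2_def by (metis zero_neq_one)
  qed
  have t0: "t0 \<noteq> 0"
  proof
    assume "t0 = 0"
    then have "(\<lambda>i. 1 * \<phi> c i) + (\<lambda>i. (- s0) * \<phi> a i) \<in> ?A" using st0 by (simp add: fun_diff_def plus_fun_def)
    then show False using ind2[OF mem(3,1)] abc(3) unfolding ffs.indep2_def by (metis zero_neq_one)
  qed
  have pc: "ffs.pt (\<phi> ` E) ?A ((\<lambda>i. s0 * \<phi> a i) + (\<lambda>i. t0 * \<phi> b i))"
    using ffs.pt_cong[OF fvec.subspace_span ptE[OF mem(3)] st0] .
  note full = ffs.clean_line[OF cl YE ptE[OF mem(1)] ptE[OF mem(2)] pc s0 t0]
  have "card (?G - \<phi> ` Y) \<le> card ?G" using fin by (intro card_mono) auto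
  also have "\<dots> \<le> k" using card_image_le[OF fin, of \<phi>] card by simp
  finally have "card (?G - \<phi> ` Y) \<le> CARD('f)" using k by simp
  from ffs.missing_point[OF _ this _ _ ind2[OF mem(1,2) abc(2)]] fin mem
  obtain z where z: "z \<in> fvec.span ?G" "z \<notin> ?A" "\<not> ffs.pt ?G ?A z" by blast
  have "?G \<subseteq> fvec.span (insert (\<phi> a) (insert (\<phi> b) (\<phi> ` Y)))"
    using line[OF _ mem(1,2) abc(2)] ffs.in_span_insert2 by blast
  then have "z \<in> fvec.span (insert (\<phi> a) (insert (\<phi> b) (\<phi> ` Y)))"
    using z(1) fvec.span_minimal[OF _ fvec.subspace_span] by blast
  then obtain s t where st: "z - ((\<lambda>i. s * \<phi> a i) + (\<lambda>i. t * \<phi> b i)) \<in> ?A" using ffs.in_span_insert2 by blast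
  let ?w = "(\<lambda>i. s * \<phi> a i) + (\<lambda>i. t * \<phi> b i)"
  have w: "?w \<notin> ?A" using z(2) ffs.diff_mem_cong[OF fvec.subspace_span st] by blast
  from full[OF w] ffs.ptE[OF _ fvec.subspace_span] obtain v m where
    v: "v \<in> \<phi> ` E" "m \<noteq> 0" "?w - (\<lambda>i. m * v i) \<in> ?A" "v \<notin> ?A" by metis
  then obtain e where e: "e \<in> E" "v = \<phi> e" by blast
  have "?A \<subseteq> B" using fvec.span_minimal[OF R(3,2)] .
  then have wv: "?w - (\<lambda>i. m * v i) \<in> B" using v(3) by blast
  have wB: "?w \<in> B" using R(2,6) mem by (intro fvec.subspace_add fvec.subspace_scale) auto
  have "?w - (?w - (\<lambda>i. m * v i)) \<in> B" using fvec.subspace_diff[OF R(2) wB wv] .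
  moreover have "?w - (?w - (\<lambda>i. m * v i)) = (\<lambda>i. m * v i)" by (simp add: fun_eq_iff)
  ultimately have "(\<lambda>i. m * v i) \<in> B" by (simp only:)
  then have "\<phi> e \<in> B" using ffs.scale_mem_iff[OF R(2) v(2)] e(2) by blast
  then have "ffs.pt ?G ?A (\<phi> e)" using R(8) e v(4) by blast
  then have "ffs.pt ?G ?A (\<lambda>i. m * v i)" unfolding e(2) using ffs.pt_scale[OF fvec.subspace_span _ v(2)] by blast
  moreover have "(\<lambda>i. m * v i) - z \<in> ?A"
    by (rule ffs.lin2[OF fvec.subspace_span v(3) st, of _ "-1" "-1"]) (simp add: fun_eq_iff algebra_simps)
  ultimately show False using ffs.pt_cong[OF fvec.subspace_span] z(3) by blast
qed

text \<open>Among the subspaces whose elements form an unclean configuration, one with the fewest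
  elements provides the minimality that \<open>minimal_unclean_uniform\<close> assumes.\<close>

lemma unclean_uniform_flat:
  fixes \<phi> :: "'a \<Rightarrow> nat \<Rightarrow> 'f::{finite,field}"
  assumes prime: "prime CARD('f)" and odd: "odd CARD('f)"
    and M: "is_matroid (vector_matroid E \<phi>)" and simple: "is_simple (vector_matroid E \<phi>)"
    and ncl: "\<not> ffs.clean (\<phi> ` E)"
  obtains F r k where "flat (vector_matroid E \<phi>) F" "2 \<le> r" "3 \<le> k" "k \<le> CARD('f)"
    "isomorphic (restr (vector_matroid E \<phi>) F) (uniform r (r - 2 + k))"
    "4 \<le> k \<Longrightarrow> r - 2 + k \<le> CARD('f) + 1"
proof -
  note sm = simple_vector_matroid[OF simple]
  have fin: "finite E" using matroid_finite[OF M] by simp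
  let ?P = "\<lambda>W. fvec.subspace W \<and> \<not> ffs.clean (\<phi> ` E \<inter> W)"
  have "?P UNIV" using ncl by simp
  then obtain W where W: "?P W" and min: "\<And>W'. ?P W' \<Longrightarrow> card (\<phi> ` E \<inter> W) \<le> card (\<phi> ` E \<inter> W')"
    using ex_has_least_nat[of ?P UNIV "\<lambda>W. card (\<phi> ` E \<inter> W)"] by blast
  let ?V = "\<phi> ` E \<inter> W"
  have finV: "finite ?V" using fin by simp
  have minimal: "ffs.clean (?V \<inter> W')" if W': "fvec.subspace W'" "\<not> ?V \<subseteq> W'" for W'
  proof (rule ccontr)
    assume "\<not> ?thesis"
    then have "?P (W \<inter> W')" using fvec.subspace_inter[OF conjunct1[OF W] W'(1)] by (simp add: Int_assoc)
    then have "card ?V \<le> card (\<phi> ` E \<inter> (W \<inter> W'))" by (rule min)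
    moreover have "card (\<phi> ` E \<inter> (W \<inter> W')) < card ?V" using finV W'(2) by (intro psubset_card_mono) auto
    ultimately show False by simp
  qed
  have pairs: "fvec.independent {x, y}" if "x \<in> ?V" "y \<in> ?V" for x y using sm(2) that by blast
  obtain r k where rk: "3 \<le> k" "k \<le> CARD('f)" "2 \<le> r" "card ?V = r - 2 + k"
    and uni: "\<And>I. I \<subseteq> ?V \<Longrightarrow> fvec.independent I \<longleftrightarrow> card I \<le> r"
  proof (rule ffs.minimal_unclean_uniform[OF finV pairs minimal])
    show "\<not> ffs.clean ?V" using W by blast
  qed (assumption | blast)+
  define F where "F = {e \<in> E. \<phi> e \<in> W}"
  have im: "\<phi> ` F = ?V" unfolding F_def by blast
  have FE: "F \<subseteq> E" unfolding F_def by blast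
  have injF: "inj_on \<phi> F" using sm(1) FE inj_on_subset by blast
  have "fvec.span (\<phi> ` F) \<subseteq> W" unfolding im using W by (intro fvec.span_minimal) auto
  then have fl: "flat (vector_matroid E \<phi>) F" unfolding flat_vector_matroid[OF M] using FE F_def by auto
  have "isomorphic (restr (vector_matroid E \<phi>) F) (uniform r (r - 2 + k))"
    unfolding isomorphic_uniform_iff restr_vector_matroid[OF FE] ground_vector_matroid
  proof (intro conjI allI impI)
    show "finite F" using FE fin finite_subset by blast
    show "card F = r - 2 + k" using card_image[OF injF] im rk(4) by simp
    fix X assume X: "X \<subseteq> F"
    have "inj_on \<phi> X" using injF X inj_on_subset by blast
    moreover have "\<phi> ` X \<subseteq> ?V" using X im by blast
    ultimately show "X \<in> indeps (vector_matroid F \<phi>) \<longleftrightarrow> card X \<le> r"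
      using X uni[of "\<phi> ` X"] by (simp add: indeps_vector_matroid card_image)
  qed
  moreover have "r - 2 + k \<le> CARD('f) + 1" if "4 \<le> k"
    using ffs.uniform_length_bound[OF prime odd finV uni rk(4,3) that rk(2)] .
  ultimately show ?thesis using that[OF fl rk(3,1,2)] by blast
qed

theorem theorem1p2:
  fixes p :: nat and M :: "'a matroid"
  assumes "prime p" and "p > 2" and "CARD('f::{finite,field}) = p"
    and "is_matroid M" and "is_simple M" and "representable TYPE('f) M"
  shows "(chordal TYPE('f) M \<longleftrightarrow>
            \<not> (\<exists>N k. induced_minor M N \<and> 3 \<le> k \<and> k \<le> p \<and> isomorphic N (uniform 2 k)))
       \<and> (chordal TYPE('f) M \<longleftrightarrow>
            \<not> (\<exists>N. induced_restriction M N \<and>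
                 ((\<exists>n\<ge>2. isomorphic N (uniform n (n + 1))) \<or>
                  (\<exists>k t. 4 \<le> k \<and> k \<le> p \<and> t \<le> p + 1 - k \<and>
                     isomorphic N (uniform (2 + t) (k + t))))))"
proof -
  define no_minor where "no_minor \<longleftrightarrow>
    \<not> (\<exists>N k. induced_minor M N \<and> 3 \<le> k \<and> k \<le> p \<and> isomorphic N (uniform 2 k))"
  define no_restriction where "no_restriction \<longleftrightarrow>
    \<not> (\<exists>N. induced_restriction M N \<and> ((\<exists>n\<ge>2. isomorphic N (uniform n (n + 1))) \<or>
        (\<exists>k t. 4 \<le> k \<and> k \<le> p \<and> t \<le> p + 1 - k \<and> isomorphic N (uniform (2 + t) (k + t)))))"
  obtain \<phi> :: "'a \<Rightarrow> nat \<Rightarrow> 'f" where Mv: "M = vector_matroid (ground M) \<phi>"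
    using assms(6) unfolding representable_def by blast
  let ?E = "ground M"
  have M: "is_matroid (vector_matroid ?E \<phi>)" "is_simple (vector_matroid ?E \<phi>)" using assms(4,5) Mv by auto
  have prime: "prime CARD('f)" and two: "CARD('f) > 2" using assms by auto
  have odd: "odd CARD('f)" using prime_odd_nat[OF prime two] .
  have "ffs.clean (\<phi> ` ?E)" if "chordal TYPE('f) M" using chordal_imp_clean[OF that assms(5) Mv] .
  moreover have no_minor if "ffs.clean (\<phi> ` ?E)"
    unfolding no_minor_def using clean_no_line_minor[OF M that] Mv assms(3) by metis
  moreover have no_restriction if no_minor
    unfolding no_restriction_def
  proof (rule notI, elim exE conjE)
    fix N assume N: "induced_restriction M N"
      and h: "(\<exists>n\<ge>2. isomorphic N (uniform n (n + 1))) \<or>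
        (\<exists>k t. 4 \<le> k \<and> k \<le> p \<and> t \<le> p + 1 - k \<and> isomorphic N (uniform (2 + t) (k + t)))"
    have "\<exists>k t. 3 \<le> k \<and> k \<le> p \<and> isomorphic N (uniform (2 + t) (k + t))"
      using h
    proof
      assume "\<exists>n\<ge>2. isomorphic N (uniform n (n + 1))"
      then obtain n where n: "n \<ge> 2" "isomorphic N (uniform n (n + 1))" by blast
      \<comment> \<open>A circuit is the case \<open>k = 3\<close>, \<open>t = n - 2\<close> of the
        second pattern, so both families contract to a line with \<open>k\<close> points.\<close>
      then have "2 + (n - 2) = n" "3 + (n - 2) = n + 1" by auto
      then have "isomorphic N (uniform (2 + (n - 2)) (3 + (n - 2)))" using n(2) by (simp only:)
      then show ?thesis using assms(2) by (intro exI[of _ 3] exI[of _ "n - 2"]) simp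
    next
      assume "\<exists>k t. 4 \<le> k \<and> k \<le> p \<and> t \<le> p + 1 - k \<and> isomorphic N (uniform (2 + t) (k + t))"
      then obtain k t where "4 \<le> k" "k \<le> p" "isomorphic N (uniform (2 + t) (k + t))" by blast
      then show ?thesis by (intro exI[of _ k] exI[of _ t]) simp
    qed
    then obtain k t where kt: "3 \<le> k" "k \<le> p" "isomorphic N (uniform (2 + t) (k + t))" by blast
    obtain X N' where X: "X \<subseteq> ground N" "simplification (contract N X) N'" "isomorphic N' (uniform 2 k)"
      using contract_uniform[OF kt(3)] .
    have "induced_minor M N"
      using N induced_minor.restriction[OF induced_minor.self] unfolding induced_restriction_def by blast
    then have "induced_minor M N'" using induced_minor.contraction X(1,2) by blast
    then show False using that kt(1,2) X(3) unfolding no_minor_def by blast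
  qed
  moreover have "ffs.clean (\<phi> ` ?E)" if nr: no_restriction
  proof (rule ccontr)
    assume "\<not> ?thesis"
    then obtain F r k where F: "flat M F" "2 \<le> r" "3 \<le> k" "k \<le> p"
      "isomorphic (restr M F) (uniform r (r - 2 + k))" "4 \<le> k \<Longrightarrow> r - 2 + k \<le> p + 1"
      using unclean_uniform_flat[OF prime odd M] Mv assms(3) by metis
    have ir: "induced_restriction M (restr M F)" unfolding induced_restriction_def using F(1) by blast
    show False
    proof (cases "k = 3")
      case True
      \<comment> \<open>With \<open>k = 3\<close> the uniform flat has one element more than its
        rank, which is the first family in arbitrary rank.\<close>
      then have "r - 2 + k = r + 1" using F(2) by simp
      then have "isomorphic (restr M F) (uniform r (r + 1))" using F(5) by simp
      then show False using nr ir F(2) unfolding no_restriction_def by blast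
    next
      case False
      then have k4: "4 \<le> k" using F(3) by simp
      then have "r - 2 \<le> p + 1 - k" using F(6) by simp
      moreover have "2 + (r - 2) = r" "k + (r - 2) = r - 2 + k" using F(2) by simp_all
      then have "isomorphic (restr M F) (uniform (2 + (r - 2)) (k + (r - 2)))"
        using F(5) by (simp only:)
      ultimately show False using nr ir k4 F(4) unfolding no_restriction_def by blast
    qed
  qed
  moreover have "chordal TYPE('f) M" if "ffs.clean (\<phi> ` ?E)"
    using clean_imp_chordal[OF odd two M that] Mv by simp
  ultimately have "(chordal TYPE('f) M \<longleftrightarrow> no_minor) \<and> (chordal TYPE('f) M \<longleftrightarrow> no_restriction)" by blast
  then show ?thesis unfolding no_minor_def no_restriction_def .
qed

end
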